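(* The invariant $\rho_4$ of degree $15$ of ternary quartic forms satisfies the identity \[ \begin{aligned} \frac{2 \cdot 5^4 \cdot 7}{24^{15}}\,\rho_4 ={}& 2\cdot 3^3\cdot 5\cdot 7^2\, J_{15} - 2\cdot 3^3\cdot 5\cdot 7\, I_{15} - 3^2\cdot 5\cdot 109\, I_3J_{12} + 2^3\cdot 3^5\cdot 5\, I_3I_{12}\\ &+ 2\cdot 3^2\cdot 137\, I_3^2J_9 + 3\cdot 271\, I_3^2 I_9 + 2^3\cdot 3^3\cdot 5\cdot 7^2\, I_6J_9 - 2^4\cdot 3^3\cdot 5\cdot 7^2\, I_6I_9\\ &- 2^3\cdot 5\cdot 7\cdot 149\, I_3^3I_6 + 2^7\cdot 3^3\cdot 5\cdot 7\cdot 13\, I_3I_6^2 , \end{aligned} \] where $I_3,I_6,I_9,I_{12},I_{15},J_9,J_{12},J_{15}$ are the Dixmier-Ohno invariants.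
   Context: Let $q=\sum_{i+j+k=4}a_{ijk}x^iy^jz^k$ be the universal ternary quartic form, with $15$ indeterminate coefficients $a_{ijk}$. The identity is an identity of polynomials in the $a_{ijk}$ with rational coefficients. Definition of $\rho_4$. For quartic forms $q_1,q_2$ in $x,y,z$, set $J_4(q_1,q_2)=q_1(w\,\partial_y - v\,\partial_z,\; u\,\partial_z - w\,\partial_x,\; v\,\partial_x-u\,\partial_y)\,q_2(x,y,z)$, a quartic form in $u,v,w$ (the operators act on $x,y,z$ only, treating $u,v,w$ as constants). Set $t_4(q_1,q_2,q_3)=J_4(q_1,q_2)(\partial_x,\partial_y,\partial_z)\,q_3(x,y,z)$, extended linearly over $\mathbb{Z}[a_{ijk}]$. Let $R_4$ be the $15\times 15$ symmetric matrix indexed by the monomials of degree $4$ in $x,y,z$, with entries $(R_4)_{m_1,m_2}=t_4(q,m_1,m_2)$. Let $\kappa_4=\prod_{i,j,k\ge 0,\ i+j+k=4}i!\,j!\,k!=2^{24}\cdot 3^9$. Then $\rho_4=\frac{1}{\kappa_4}\det R_4$. Definition of the Dixmier-Ohno invariants. For a form $A$ in $x,y,z$ and a form $B$ in $u,v,w$, write $D_B(A)=B(\partial_x,\partial_y,\partial_z)A$ and $D_A(B)=A(\partial_u,\partial_v,\partial_w)B$. For a quadratic form $A$, also write $A$ for its symmetric Gram matrix (so $A(x)=x^{T}Ax$, with off-diagonal entries equal to half of the mixed coefficients). For a quadratic form $A$ in $x,y,z$ and a quadratic form $B$ in $u,v,w$, put $J_{1,1}(A,B)=\operatorname{tr}(AB)$,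 $J_{3,0}(A)=\det A$, $J_{0,3}(B)=\det B$. For the quartic $q$: \begin{itemize} \item $\sigma=\frac1{48}J_4(q,q)$, a quartic form in $u,v,w$. \item $\psi$ is the sextic form in $u,v,w$ with $w^6\psi(u,v,w)=ace+2bcd-ad^2-b^2e-c^3$, where $w^4q(x,y,-(ux+vy)/w)=ax^4+4bx^3y+6cx^2y^2+4dxy^3+ey^4$. \item $\mathrm{He}=\frac1{1728}\det(\text{Hessian matrix of second partial derivatives of }q)$. \item $\rho=\frac1{144}D_q(\psi)$, $\tau=\frac1{12}D_\rho(q)$, $\xi=\frac1{72}D_\sigma(\mathrm{He})$, $\eta=\frac1{12}D_\xi(\sigma)$. These are quadratic forms: $\tau,\xi$ in $x,y,z$ and $\rho,\eta$ in $u,v,w$. \end{itemize} Then $I_3=\frac1{72}D_\sigma(q)$, $I_6=\frac1{4608}\bigl(D_\psi(\mathrm{He})-8I_3^2\bigr)$, $I_9=J_{1,1}(\tau,\rho)$, $I_{12}=J_{0,3}(\rho)$, $I_{15}=J_{3,0}(\tau)$, $J_9=J_{1,1}(\xi,\rho)$, $J_{12}=J_{1,1}(\tau,\eta)$, $J_{15}=J_{3,0}(\xi)$. The subscript of each invariant is its degree in the coefficients of $q$. (The quadratic form $\rho$ is unrelated to the invariant $\rho_4$.) *)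

theory Defs
  imports "HOL-Library.Poly_Mapping" "Jordan_Normal_Form.Determinant"
begin

(* Multivariate polynomials with variables 'v and coefficients 'r: finitely supported maps
   from exponent vectors to coefficients, with the convolution product of Poly_Mapping. *)

type_synonym ('v, 'r) mpoly = "('v \<Rightarrow>\<^sub>0 nat) \<Rightarrow>\<^sub>0 'r"

definition Const :: "'r \<Rightarrow> ('v, 'r::zero) mpoly" where
  "Const c = Poly_Mapping.single 0 c"

definition Var :: "'v \<Rightarrow> ('v, 'r::zero_neq_one) mpoly" where
  "Var v = Poly_Mapping.single (Poly_Mapping.single v 1) 1"

definition const_term :: "('v, 'r::zero) mpoly \<Rightarrow> 'r" where
  "const_term p = Poly_Mapping.lookup p 0"

definition vars :: "('v, 'r::zero) mpoly \<Rightarrow> 'v set" where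
  "vars p = (\<Union>m\<in>Poly_Mapping.keys p. Poly_Mapping.keys m)"

definition pderiv_at :: "'v \<Rightarrow> ('v, 'r::comm_ring_1) mpoly \<Rightarrow> ('v, 'r) mpoly" where
  "pderiv_at v p = (\<Sum>m\<in>Poly_Mapping.keys p.
     Poly_Mapping.single (m - Poly_Mapping.single v 1)
       (of_nat (Poly_Mapping.lookup m v) * Poly_Mapping.lookup p m))"

definition subst :: "('v \<Rightarrow> ('v, 'r::comm_ring_1) mpoly) \<Rightarrow> ('v, 'r) mpoly \<Rightarrow> ('v, 'r) mpoly" where
  "subst s p = (\<Sum>m\<in>Poly_Mapping.keys p.
     Const (Poly_Mapping.lookup p m) *
     (\<Prod>v\<in>Poly_Mapping.keys m. s v ^ Poly_Mapping.lookup m v))"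

(* coef contains the ring of rational polynomials in the indeterminates a_ijk; the
   indeterminates with i + j + k different from 4 never occur.  Forms in x, y, z, in u, v, w,
   and mixed ones all live in one polynomial ring in six variables over coef. *)

datatype var = X | Y | Z | U | V | W

type_synonym coef = "(nat \<times> nat \<times> nat, rat) mpoly"

type_synonym form = "(var, coef) mpoly"

definition rscale :: "rat \<Rightarrow> form \<Rightarrow> form" where
  "rscale r p = Const (Const r) * p"

definition quartic_exps :: "(nat \<times> nat \<times> nat) list" where
  "quartic_exps = concat (map (\<lambda>i. map (\<lambda>j. (i, j, 4 - i - j)) [0..<5 - i]) [0..<5])"

definition xyz_monom :: "nat \<times> nat \<times> nat \<Rightarrow> form" where
  "xyz_monom = (\<lambda>(i, j, k). Var X ^ i * Var Y ^ j * Var Z ^ k)"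

definition universal_quartic :: form where
  "universal_quartic = (\<Sum>(i, j, k)\<in>{(i, j, k). i + j + k = 4}.
     Const (Var (i, j, k)) * xyz_monom (i, j, k))"

(* The operator p(L1, L2, L3) applied to f, where p is a form in the variables v1, v2, v3.
   It is only used for pairwise commuting L1, L2, L3 that are linear over the coefficients,
   so the order of composition is immaterial. *)

definition subst_op :: "var \<times> var \<times> var \<Rightarrow> form \<Rightarrow>
    (form \<Rightarrow> form) \<Rightarrow> (form \<Rightarrow> form) \<Rightarrow> (form \<Rightarrow> form) \<Rightarrow> form \<Rightarrow> form" where
  "subst_op = (\<lambda>(v1, v2, v3) p L1 L2 L3 f.
     \<Sum>m\<in>Poly_Mapping.keys p. Const (Poly_Mapping.lookup p m) *
       (L1 ^^ Poly_Mapping.lookup m v1)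
         ((L2 ^^ Poly_Mapping.lookup m v2)
           ((L3 ^^ Poly_Mapping.lookup m v3) f)))"

(* D_uvw B A is B(d/dx, d/dy, d/dz) A for B in u, v, w and A in x, y, z;
   D_xyz A B is A(d/du, d/dv, d/dw) B. *)

definition D_uvw :: "form \<Rightarrow> form \<Rightarrow> form" where
  "D_uvw B A = subst_op (U, V, W) B (pderiv_at X) (pderiv_at Y) (pderiv_at Z) A"

definition D_xyz :: "form \<Rightarrow> form \<Rightarrow> form" where
  "D_xyz A B = subst_op (X, Y, Z) A (pderiv_at U) (pderiv_at V) (pderiv_at W) B"

definition J4 :: "form \<Rightarrow> form \<Rightarrow> form" where
  "J4 q1 q2 = subst_op (X, Y, Z) q1
     (\<lambda>f. Var W * pderiv_at Y f - Var V * pderiv_at Z f)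
     (\<lambda>f. Var U * pderiv_at Z f - Var W * pderiv_at X f)
     (\<lambda>f. Var V * pderiv_at X f - Var U * pderiv_at Y f) q2"

definition t4 :: "form \<Rightarrow> form \<Rightarrow> form \<Rightarrow> coef" where
  "t4 q1 q2 q3 = const_term (D_uvw (J4 q1 q2) q3)"

definition R4 :: "form \<Rightarrow> coef mat" where
  "R4 q = mat 15 15 (\<lambda>(r, s). t4 q (xyz_monom (quartic_exps ! r)) (xyz_monom (quartic_exps ! s)))"

definition kappa4 :: nat where
  "kappa4 = (\<Prod>(i, j, k)\<in>{(i, j, k). i + j + k = 4}. fact i * fact j * fact k)"

definition rho4 :: "form \<Rightarrow> coef" where
  "rho4 q = Const (1 / of_nat kappa4) * det (R4 q)"

definition gram :: "var list \<Rightarrow> form \<Rightarrow> coef mat" where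
  "gram vs A = mat 3 3 (\<lambda>(r, s).
     (if r = s then 1 else Const (1 / 2)) *
     Poly_Mapping.lookup A (Poly_Mapping.single (vs ! r) 1 + Poly_Mapping.single (vs ! s) 1))"

definition J11 :: "form \<Rightarrow> form \<Rightarrow> coef" where
  "J11 A B = (\<Sum>r<3. (gram [X, Y, Z] A * gram [U, V, W] B) $$ (r, r))"

definition J30 :: "form \<Rightarrow> coef" where
  "J30 A = det (gram [X, Y, Z] A)"

definition J03 :: "form \<Rightarrow> coef" where
  "J03 B = det (gram [U, V, W] B)"

definition sigma :: "form \<Rightarrow> form" where
  "sigma q = rscale (1 / 48) (J4 q q)"

(* By homogeneity, w^4 q(x, y, -(ux + vy)/w) = q(wx, wy, -(ux + vy)), which needs no division. *)

definition line_section :: "form \<Rightarrow> form" where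
  "line_section q = subst (Var(X := Var W * Var X, Y := Var W * Var Y,
                                Z := - (Var U * Var X + Var V * Var Y))) q"

(* The coefficients a, ..., e are determined by q, and Var W is not a zero divisor, so there is
   at most one such s; for quartic forms q in x, y, z the right-hand side is divisible by w^6. *)

definition psi :: "form \<Rightarrow> form" where
  "psi q = (THE s. \<exists>a b c d e.
     vars a \<union> vars b \<union> vars c \<union> vars d \<union> vars e \<subseteq> {U, V, W} \<and>
     line_section q = a * Var X ^ 4 + 4 * b * Var X ^ 3 * Var Y + 6 * c * Var X ^ 2 * Var Y ^ 2
                      + 4 * d * Var X * Var Y ^ 3 + e * Var Y ^ 4 \<and>
     Var W ^ 6 * s = a * c * e + 2 * b * c * d - a * d ^ 2 - b ^ 2 * e - c ^ 3)"

definition He :: "form \<Rightarrow> form" where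
  "He q = rscale (1 / 1728)
     (det (mat 3 3 (\<lambda>(r, s). pderiv_at ([X, Y, Z] ! r) (pderiv_at ([X, Y, Z] ! s) q))))"

definition rho :: "form \<Rightarrow> form" where
  "rho q = rscale (1 / 144) (D_xyz q (psi q))"

definition tau :: "form \<Rightarrow> form" where
  "tau q = rscale (1 / 12) (D_uvw (rho q) q)"

definition xi :: "form \<Rightarrow> form" where
  "xi q = rscale (1 / 72) (D_uvw (sigma q) (He q))"

definition eta :: "form \<Rightarrow> form" where
  "eta q = rscale (1 / 12) (D_xyz (xi q) (sigma q))"

definition I3 :: "form \<Rightarrow> coef" where
  "I3 q = Const (1 / 72) * const_term (D_uvw (sigma q) q)"

definition I6 :: "form \<Rightarrow> coef" where
  "I6 q = Const (1 / 4608) * (const_term (D_uvw (psi q) (He q)) - 8 * I3 q ^ 2)"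

definition I9 :: "form \<Rightarrow> coef" where
  "I9 q = J11 (tau q) (rho q)"

definition I12 :: "form \<Rightarrow> coef" where
  "I12 q = J03 (rho q)"

definition I15 :: "form \<Rightarrow> coef" where
  "I15 q = J30 (tau q)"

definition J9 :: "form \<Rightarrow> coef" where
  "J9 q = J11 (xi q) (rho q)"

definition J12 :: "form \<Rightarrow> coef" where
  "J12 q = J11 (tau q) (eta q)"

definition J15 :: "form \<Rightarrow> coef" where
  "J15 q = J30 (xi q)"

end

theory Submission
  imports Defs
begin

text \<open>
  Both sides are polynomials in the fifteen coefficients of the quartic that are invariant under
  the special linear group, so it is enough to compare them on a linear family of quartics
  that meets the orbit of a generic quartic.

  Invariance enters only through the Lie algebra. For distinct \<open>a\<close>, \<open>b\<close> among \<open>x\<close>, \<open>y\<close>, \<open>z\<close>, the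
  derivation \<open>theta a b\<close> of the ring of forms is the sum of the vector field \<open>a \<partial>/\<partial>b\<close>, of its
  contragredient on \<open>u\<close>, \<open>v\<close>, \<open>w\<close>, and of the derivation \<open>lie a b\<close> of the coefficient ring that makes
  the sum kill the universal quartic. The operations \<open>J4\<close>, \<open>D_uvw\<close> and \<open>D_xyz\<close> are equivariant, and
  Hessians and Gram matrices are transformed by congruence, which does not change their determinants
  to first order (\<open>derivation_det_congruence\<close>). The contravariant \<open>psi\<close> is defined by a division by
  \<open>w^6\<close>; its invariance is checked on the explicit quotient. Hence every covariant is killed by
  \<open>theta a b\<close>, and every invariant, as well as \<open>rho4\<close>, by \<open>lie a b\<close>.

  The linear family consists of the quartics without the monomials \<open>z^4\<close>, \<open>yz^3\<close>, \<open>y^2z^2\<close>, \<open>xyz^2\<close>,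
  \<open>xy^2z\<close>, \<open>x^2z^2\<close>. An element \<open>f\<close> of the coefficient ring that is killed by the six derivations
  \<open>lie a b\<close> and vanishes on this slice is zero (\<open>eq_0_if_killed_by_lie\<close>): if \<open>f\<close> vanishes to order
  \<open>N \<ge> 1\<close> along the slice, then modulo terms of order \<open>N\<close> the six equations \<open>lie a b f = 0\<close> are a
  triangular linear system for the six derivatives of \<open>f\<close> transversal to the slice. Its pivots are
  multiples of the coefficients of \<open>xz^3\<close> and \<open>y^3z\<close>, which are not zero divisors on the slice.
  So all transversal derivatives vanish to order \<open>N\<close>, and \<open>f\<close> vanishes to order \<open>N + 1\<close>.

  On the slice only nine coefficients are left, the matrix \<open>R4\<close> is sparse, and both sides of the
  identity have 251 terms. There the identity is verified by rewriting (\<open>check_slice\<close>), with a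
  verified arithmetic of sparse integral polynomials in Horner form.
\<close>

section \<open>Polynomials and their coefficients\<close>

text \<open>
  The exponent vectors \<open>single v 1\<close> occur everywhere; rewriting \<open>1\<close> to \<open>Suc 0\<close> inside them would
  hide them from the rules below.
\<close>

declare One_nat_def [simp del]

lemma Const_0 [simp]: "Const 0 = 0"
  by (simp add: Const_def)

lemma Const_1 [simp]: "Const 1 = 1"
  by (simp add: Const_def)

lemma Const_add: "Const (a + b) = Const a + Const b"
  by (simp add: Const_def single_add)

lemma Const_uminus: "Const (- a) = - Const a"
  by (simp add: Const_def single_uminus)

lemma Const_mult: "Const (a * b) = Const a * Const b"
  by (simp add: Const_def mult_single)

lemma lookup_Const: "Poly_Mapping.lookup (Const c) m = (if m = 0 then c else 0)"
  by (simp add: Const_def lookup_single when_def)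

lemma lookup_single_mult:
  fixes p :: "('v, 'r::comm_ring_1) mpoly"
  shows "Poly_Mapping.lookup (Poly_Mapping.single k c * p) (k + m) = c * Poly_Mapping.lookup p m"
proof -
  have "Poly_Mapping.lookup (Poly_Mapping.single k c * p) (k + m) =
      (\<Sum>l. (c when k = l) * (\<Sum>q. Poly_Mapping.lookup p q when k + m = l + q))"
    by (simp add: lookup_mult lookup_single)
  also have "\<dots> = (\<Sum>l. (c * (\<Sum>q. Poly_Mapping.lookup p q when k + m = l + q)) when l = k)"
    by (intro Sum_any.cong) (auto simp: when_def)
  also have "\<dots> = c * (\<Sum>q. Poly_Mapping.lookup p q when m = q)"
    by simp
  also have "\<dots> = c * Poly_Mapping.lookup p m"
    by (simp add: eq_commute[of m])
  finally show ?thesis .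
qed

lemma lookup_single_mult_eq_0:
  fixes p :: "('v, 'r::comm_ring_1) mpoly"
  assumes "\<And>l. m \<noteq> k + l"
  shows "Poly_Mapping.lookup (Poly_Mapping.single k c * p) m = 0"
proof -
  have "m \<notin> Poly_Mapping.keys (Poly_Mapping.single k c * p)"
    using keys_mult[of "Poly_Mapping.single k c" p] assms by (auto split: if_splits)
  then show ?thesis by (simp add: in_keys_iff)
qed

lemma lookup_Const_mult: "Poly_Mapping.lookup (Const c * p) m = c * Poly_Mapping.lookup p m"
  for p :: "('v, 'r::comm_ring_1) mpoly"
  using lookup_single_mult[of 0 c p m] by (simp add: Const_def)

lemma lookup_Var_mult_add:
  "Poly_Mapping.lookup (Var v * p) (Poly_Mapping.single v 1 + m) = Poly_Mapping.lookup p m"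
  for p :: "('v, 'r::comm_ring_1) mpoly"
  by (simp add: Var_def lookup_single_mult)

lemma single_1_add_minus:
  "Poly_Mapping.lookup m v \<noteq> 0 \<Longrightarrow> Poly_Mapping.single v 1 + (m - Poly_Mapping.single v (1::nat)) = m"
  by (rule poly_mapping_eqI) (auto simp: lookup_add lookup_minus lookup_single when_def)

lemma lookup_Var_mult:
  "Poly_Mapping.lookup (Var v * p) m =
     (if Poly_Mapping.lookup m v = 0 then 0 else Poly_Mapping.lookup p (m - Poly_Mapping.single v 1))"
  for p :: "('v, 'r::comm_ring_1) mpoly"
proof (cases "Poly_Mapping.lookup m v = 0")
  case True
  then have "\<And>l. m \<noteq> Poly_Mapping.single v 1 + l"
    by (auto simp: lookup_add)
  then show ?thesis
    using True by (simp add: Var_def lookup_single_mult_eq_0)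
next
  case False
  then show ?thesis
    using lookup_Var_mult_add[of v p "m - Poly_Mapping.single v 1"] single_1_add_minus[of m v] by simp
qed

lemma poly_mapping_induct [case_names single add]:
  fixes p :: "'a \<Rightarrow>\<^sub>0 'b::comm_monoid_add"
  assumes single: "\<And>k c. P (Poly_Mapping.single k c)"
    and add: "\<And>p q. P p \<Longrightarrow> P q \<Longrightarrow> P (p + q)"
  shows "P p"
proof -
  have sum: "P (\<Sum>k\<in>A. Poly_Mapping.single k (c k))" if "finite A" for A and c :: "'a \<Rightarrow> 'b"
    using that
  proof induction
    case empty
    show ?case using single[of undefined 0] by simp
  qed (simp add: single add)
  have "p = (\<Sum>k\<in>Poly_Mapping.keys p. Poly_Mapping.single k (Poly_Mapping.lookup p k))"
    by (rule poly_mapping_eqI)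
      (auto simp: lookup_sum lookup_single when_def in_keys_iff sum.delta[OF finite_keys]
        cong: if_cong)
  then show ?thesis using sum[OF finite_keys] by metis
qed

lemma single_plus_Var: "Poly_Mapping.single (Poly_Mapping.single v 1 + m) c = Var v * Poly_Mapping.single m c"
  for c :: "'r::comm_ring_1"
  by (simp add: Var_def mult_single)

lemma exponent_induct [case_names zero add]:
  fixes m :: "'v \<Rightarrow>\<^sub>0 nat"
  assumes "P 0" and "\<And>v m. P m \<Longrightarrow> P (Poly_Mapping.single v 1 + m)"
  shows "P m"
proof (induction "\<Sum>v\<in>Poly_Mapping.keys m. Poly_Mapping.lookup m v" arbitrary: m)
  case 0
  then have "m = 0" by (auto simp: in_keys_iff intro: poly_mapping_eqI)
  then show ?case using assms(1) by simp
next
  case (Suc n)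
  then obtain v where v: "v \<in> Poly_Mapping.keys m"
    by (metis Zero_not_Suc sum.empty equals0I)
  define m' where "m' = m - Poly_Mapping.single v 1"
  have m: "m = Poly_Mapping.single v 1 + m'"
    using v single_1_add_minus[of m v] by (auto simp: m'_def in_keys_iff)
  have "(\<Sum>w\<in>Poly_Mapping.keys m. Poly_Mapping.lookup m w) =
      (\<Sum>w\<in>Poly_Mapping.keys m. (if w = v then 1 else 0) + Poly_Mapping.lookup m' w)"
    by (intro sum.cong) (auto simp: m lookup_add lookup_single when_def)
  also have "\<dots> = 1 + (\<Sum>w\<in>Poly_Mapping.keys m. Poly_Mapping.lookup m' w)"
    using v by (simp add: sum.distrib)
  also have "(\<Sum>w\<in>Poly_Mapping.keys m. Poly_Mapping.lookup m' w) =
      (\<Sum>w\<in>Poly_Mapping.keys m'. Poly_Mapping.lookup m' w)"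
    by (rule sum.mono_neutral_right) (auto simp: m lookup_add in_keys_iff)
  finally have "n = (\<Sum>w\<in>Poly_Mapping.keys m'. Poly_Mapping.lookup m' w)"
    using Suc.hyps(2) by simp
  then show ?case using Suc.hyps(1) assms(2) m by metis
qed

text \<open>
  Every polynomial is obtained from constants by addition and multiplication with variables. This
  form of induction fits operators that are additive and compatible with one variable at a time,
  and it keeps track of the variables that are needed.
\<close>

lemma mpoly_induct_vars [consumes 1, case_names Const add Var_mult]:
  fixes p :: "('v, 'r::comm_ring_1) mpoly"
  assumes vars: "vars p \<subseteq> N"
    and Const: "\<And>c. P (Const c)"
    and add: "\<And>p q. P p \<Longrightarrow> P q \<Longrightarrow> P (p + q)"
    and Var: "\<And>v p. v \<in> N \<Longrightarrow> P p \<Longrightarrow> P (Var v * p)"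
  shows "P p"
proof -
  have single: "P (Poly_Mapping.single m c)" if "Poly_Mapping.keys m \<subseteq> N" for m c
    using that
  proof (induction m rule: exponent_induct)
    case zero
    show ?case using Const[of c] by (simp add: Const_def)
  next
    case (add v m)
    have "Poly_Mapping.keys m \<subseteq> N" "v \<in> N"
      using add.prems by (auto simp: in_keys_iff lookup_add subset_iff)
    then show ?case
      using add.IH Var by (simp add: single_plus_Var)
  qed
  have sum: "finite A \<Longrightarrow> (\<And>m. m \<in> A \<Longrightarrow> Poly_Mapping.keys m \<subseteq> N) \<Longrightarrow>
      P (\<Sum>m\<in>A. Poly_Mapping.single m (c m))" for A c
  proof (induction A rule: finite_induct)
    case empty
    show ?case using Const[of 0] by simp
  qed (simp add: single add)
  have "p = (\<Sum>m\<in>Poly_Mapping.keys p. Poly_Mapping.single m (Poly_Mapping.lookup p m))"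
    by (rule poly_mapping_eqI)
      (auto simp: lookup_sum lookup_single when_def in_keys_iff sum.delta[OF finite_keys]
        cong: if_cong)
  then show ?thesis
    using sum[OF finite_keys[of p]] vars unfolding vars_def by (metis UN_subset_iff)
qed

lemma mpoly_induct [case_names Const add Var_mult]:
  fixes p :: "('v, 'r::comm_ring_1) mpoly"
  assumes "\<And>c. P (Const c)"
    and "\<And>p q. P p \<Longrightarrow> P q \<Longrightarrow> P (p + q)"
    and "\<And>v p. P p \<Longrightarrow> P (Var v * p)"
  shows "P p"
  using subset_UNIV assms by (rule mpoly_induct_vars)

section \<open>Derivations\<close>

definition derivation :: "('a::comm_ring_1 \<Rightarrow> 'a) \<Rightarrow> bool" where
  "derivation D \<longleftrightarrow> (\<forall>x y. D (x + y) = D x + D y) \<and> (\<forall>x y. D (x * y) = D x * y + x * D y)"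

lemma derivation_add: "derivation D \<Longrightarrow> D (x + y) = D x + D y"
  and derivation_mult: "derivation D \<Longrightarrow> D (x * y) = D x * y + x * D y"
  by (auto simp: derivation_def)

lemma derivation_0: "derivation D \<Longrightarrow> D 0 = 0"
  using derivation_add[of D 0 0] by simp

lemma derivation_1: "derivation D \<Longrightarrow> D 1 = 0"
  using derivation_mult[of D 1 1] by simp

lemma derivation_uminus: "derivation D \<Longrightarrow> D (- x) = - D x"
  using derivation_add[of D x "- x"] by (simp add: derivation_0 eq_neg_iff_add_eq_0 add.commute)

lemma derivation_diff: "derivation D \<Longrightarrow> D (x - y) = D x - D y"
  using derivation_add[of D x "- y"] by (simp add: derivation_uminus)

lemma derivation_sum: "derivation D \<Longrightarrow> D (sum f A) = (\<Sum>x\<in>A. D (f x))"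
  by (induction A rule: infinite_finite_induct) (auto simp: derivation_0 derivation_add)

lemma derivation_of_nat: "derivation D \<Longrightarrow> D (of_nat n) = 0"
  by (induction n) (auto simp: derivation_0 derivation_1 derivation_add)

lemma derivation_of_int: "derivation D \<Longrightarrow> D (of_int n) = 0"
  by (cases n rule: int_cases2) (auto simp: derivation_of_nat derivation_uminus)

lemma derivation_numeral: "derivation D \<Longrightarrow> D (numeral n) = 0"
  using derivation_of_nat[of D "numeral n"] by simp

lemma derivation_power: "derivation D \<Longrightarrow> D (x ^ n) = of_nat n * x ^ (n - 1) * D x"
proof (induction n)
  case (Suc n)
  then show ?case
    by (cases n) (simp_all add: derivation_mult algebra_simps)
qed (simp add: derivation_1)

lemma derivation_zero_power: "derivation D \<Longrightarrow> D x = 0 \<Longrightarrow> D (x ^ n) = 0"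
  by (simp add: derivation_power)

lemma derivation_prod:
  assumes "derivation D" "finite A"
  shows "D (prod f A) = (\<Sum>i\<in>A. D (f i) * prod f (A - {i}))"
  using assms(2)
proof induction
  case (insert a A)
  have "(\<Sum>i\<in>A. D (f i) * prod f (insert a A - {i})) = f a * (\<Sum>i\<in>A. D (f i) * prod f (A - {i}))"
    unfolding sum_distrib_left
  proof (intro sum.cong refl)
    fix i assume "i \<in> A"
    then have "insert a A - {i} = insert a (A - {i})" using insert by auto
    then show "D (f i) * prod f (insert a A - {i}) = f a * (D (f i) * prod f (A - {i}))"
      using insert by simp
  qed
  then show ?case using insert by (simp add: derivation_mult[OF assms(1)] ac_simps)
qed (simp add: derivation_1[OF assms(1)])

lemma derivation_lincomb:
  "derivation D \<Longrightarrow> derivation E \<Longrightarrow> derivation (\<lambda>x. a * D x + b * E x)"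
  by (simp add: derivation_def algebra_simps)

lemma derivation_scale_sum:
  "(\<And>i. i \<in> A \<Longrightarrow> derivation (D i)) \<Longrightarrow> derivation (\<lambda>x. \<Sum>i\<in>A. a i * D i x)"
  by (simp add: derivation_def sum.distrib sum_distrib_left sum_distrib_right algebra_simps)

section \<open>Partial derivatives, coefficientwise maps and substitution\<close>

text \<open>
  Coefficients determine a polynomial, so this formula makes additivity, commutation of partial
  derivatives and commutation with coefficientwise maps immediate.
\<close>

lemma lookup_pderiv_at:
  "Poly_Mapping.lookup (pderiv_at v p) m =
     of_nat (Suc (Poly_Mapping.lookup m v)) * Poly_Mapping.lookup p (Poly_Mapping.single v 1 + m)"
proof -
  let ?s = "Poly_Mapping.single v (1::nat)"
  have "Poly_Mapping.lookup (pderiv_at v p) m = (\<Sum>m'\<in>Poly_Mapping.keys p.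
      if m' = ?s + m then of_nat (Poly_Mapping.lookup m' v) * Poly_Mapping.lookup p m' else 0)"
    unfolding pderiv_at_def lookup_sum
  proof (intro sum.cong refl)
    fix m'
    have "m' - ?s = m \<longleftrightarrow> m' = ?s + m" if "Poly_Mapping.lookup m' v \<noteq> 0"
      using single_1_add_minus[OF that] by (metis add_diff_cancel_left')
    then show "Poly_Mapping.lookup (Poly_Mapping.single (m' - ?s)
        (of_nat (Poly_Mapping.lookup m' v) * Poly_Mapping.lookup p m')) m =
        (if m' = ?s + m then of_nat (Poly_Mapping.lookup m' v) * Poly_Mapping.lookup p m' else 0)"
      by (cases "Poly_Mapping.lookup m' v = 0") (auto simp: lookup_single when_def)
  qed
  also have "\<dots> = of_nat (Suc (Poly_Mapping.lookup m v)) * Poly_Mapping.lookup p (?s + m)"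
    by (auto simp: in_keys_iff lookup_add)
  finally show ?thesis .
qed

lemma pderiv_at_add: "pderiv_at v (p + q) = pderiv_at v p + pderiv_at v q"
  by (rule poly_mapping_eqI) (simp add: lookup_pderiv_at lookup_add algebra_simps)

lemma single_1_add_neq_0: "Poly_Mapping.single v (1::nat) + m \<noteq> 0"
  using lookup_add[of "Poly_Mapping.single v 1" m v] by auto

lemma pderiv_at_Const [simp]: "pderiv_at v (Const c) = 0"
  by (rule poly_mapping_eqI) (simp add: lookup_pderiv_at lookup_Const single_1_add_neq_0)

lemma pderiv_at_Const_mult: "pderiv_at v (Const c * p) = Const c * pderiv_at v p"
  by (rule poly_mapping_eqI) (simp add: lookup_pderiv_at lookup_Const_mult mult.left_commute del: of_nat_Suc)

lemma pderiv_at_Var_mult: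
  "pderiv_at v (Var w * p) = (if v = w then p else 0) + Var w * pderiv_at v p"
proof (rule poly_mapping_eqI)
  fix m
  let ?s = "\<lambda>v. Poly_Mapping.single v (1::nat)"
  show "Poly_Mapping.lookup (pderiv_at v (Var w * p)) m =
      Poly_Mapping.lookup ((if v = w then p else 0) + Var w * pderiv_at v p) m"
  proof (cases "v = w")
    case True
    then show ?thesis
      using single_1_add_minus[of m w]
      by (auto simp: lookup_pderiv_at lookup_add lookup_Var_mult_add lookup_Var_mult[of w "pderiv_at w p"]
          lookup_minus ring_distribs)
  next
    case False
    have "?s v + m - ?s w = ?s v + (m - ?s w)" if "Poly_Mapping.lookup m w \<noteq> 0"
      using False that
      by (intro poly_mapping_eqI) (auto simp: lookup_add lookup_minus lookup_single when_def)
    then show ?thesis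
      using False by (auto simp: lookup_pderiv_at lookup_Var_mult lookup_add lookup_minus lookup_single)
  qed
qed

lemma pderiv_at_mult: "pderiv_at v (p * q) = pderiv_at v p * q + p * pderiv_at v q"
proof (induction p rule: mpoly_induct)
  case (add p p')
  then show ?case unfolding distrib_right pderiv_at_add by (simp only: add_ac)
next
  case (Var_mult w p)
  have "pderiv_at v (Var w * p * q) = (if v = w then p * q else 0) + Var w * (pderiv_at v p * q + p * pderiv_at v q)"
    unfolding mult.assoc pderiv_at_Var_mult Var_mult ..
  then show ?case
    unfolding pderiv_at_Var_mult by (simp only: distrib_left distrib_right mult.assoc add.assoc if_distrib[of "\<lambda>x. x * q"] mult_zero_left)
qed (simp only: pderiv_at_Const_mult pderiv_at_Const mult_zero_left add_0)

lemma derivation_pderiv_at: "derivation (pderiv_at v)"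
  unfolding derivation_def by (intro conjI allI pderiv_at_add pderiv_at_mult)

lemma pderiv_at_Var: "pderiv_at v (Var w) = (if v = w then 1 else 0)"
  using pderiv_at_Var_mult[of v w 1]
  unfolding derivation_1[OF derivation_pderiv_at] mult_1_right mult_zero_right add_0_right .

lemma pderiv_at_commute: "pderiv_at v (pderiv_at w p) = pderiv_at w (pderiv_at v p)"
proof (cases "v = w")
  case False
  show ?thesis
  proof (rule poly_mapping_eqI)
    fix m
    show "Poly_Mapping.lookup (pderiv_at v (pderiv_at w p)) m = Poly_Mapping.lookup (pderiv_at w (pderiv_at v p)) m"
      using False
      by (simp add: lookup_pderiv_at lookup_add lookup_single
          add.left_commute[of "Poly_Mapping.single v 1"] mult.left_commute[of "of_nat (Suc (Poly_Mapping.lookup m v))"]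
          del: of_nat_Suc)
  qed
qed simp

text \<open>
  Derivations and homomorphisms of the coefficient ring extend to forms by acting on coefficients;
  for an additive \<open>f\<close> the value at a zero coefficient is zero again.
\<close>

definition coeff_map :: "('r \<Rightarrow> 'r) \<Rightarrow> ('v, 'r::comm_ring_1) mpoly \<Rightarrow> ('v, 'r) mpoly" where
  "coeff_map f p = Poly_Mapping.map f p"

locale additive_map =
  fixes f :: "'r::comm_ring_1 \<Rightarrow> 'r"
  assumes additive: "f (x + y) = f x + f y"
begin

lemma zero: "f 0 = 0"
  using additive[of 0 0] by simp

lemma of_nat_mult: "f (of_nat n * x) = of_nat n * f x"
  by (induction n) (simp_all add: zero additive algebra_simps)

lemma lookup_coeff_map: "Poly_Mapping.lookup (coeff_map f p) m = f (Poly_Mapping.lookup p m)"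
  by (simp add: coeff_map_def map.rep_eq when_def zero)

lemma coeff_map_add: "coeff_map f (p + q) = coeff_map f p + coeff_map f q"
  by (rule poly_mapping_eqI) (simp add: lookup_coeff_map lookup_add additive)

lemma coeff_map_Const: "coeff_map f (Const c) = Const (f c)"
  by (rule poly_mapping_eqI) (simp add: lookup_coeff_map lookup_Const zero)

lemma coeff_map_Var_mult: "coeff_map f (Var v * p) = Var v * coeff_map f p"
  by (rule poly_mapping_eqI) (simp add: lookup_coeff_map lookup_Var_mult zero)

lemma coeff_map_pderiv_at: "coeff_map f (pderiv_at v p) = pderiv_at v (coeff_map f p)"
  by (rule poly_mapping_eqI) (simp add: lookup_coeff_map lookup_pderiv_at of_nat_mult del: of_nat_Suc)

end

lemma derivation_coeff_map:
  assumes "derivation D"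
  shows "derivation (coeff_map D :: ('v, 'r::comm_ring_1) mpoly \<Rightarrow> ('v, 'r) mpoly)"
proof -
  interpret additive_map D using assms by unfold_locales (simp add: derivation_add)
  have Const: "coeff_map D (Const c * p) = Const (D c) * p + Const c * coeff_map D p" for c and p :: "('v, 'r) mpoly"
    by (rule poly_mapping_eqI)
      (simp add: lookup_coeff_map lookup_Const_mult lookup_add derivation_mult[OF assms])
  have "coeff_map D (p * q) = coeff_map D p * q + p * coeff_map D q" for p q :: "('v, 'r) mpoly"
    by (induction p rule: mpoly_induct)
      (simp_all add: Const coeff_map_Const coeff_map_add coeff_map_Var_mult ring_distribs mult.assoc add_ac)
  then show ?thesis unfolding derivation_def by (intro conjI allI coeff_map_add)
qed

lemma comm_ring_hom_coeff_map:
  assumes "comm_ring_hom h"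
  shows "comm_ring_hom (coeff_map h :: ('v, 'r::comm_ring_1) mpoly \<Rightarrow> ('v, 'r) mpoly)"
proof -
  interpret h: comm_ring_hom h by fact
  interpret additive_map h by unfold_locales (simp add: h.hom_add)
  have Const: "coeff_map h (Const c * p) = Const (h c) * coeff_map h p" for c and p :: "('v, 'r) mpoly"
    by (rule poly_mapping_eqI) (simp add: lookup_coeff_map lookup_Const_mult h.hom_mult)
  have mult: "coeff_map h (p * q) = coeff_map h p * coeff_map h q" for p q :: "('v, 'r) mpoly"
    by (induction p rule: mpoly_induct)
      (simp_all add: Const coeff_map_Const coeff_map_add coeff_map_Var_mult ring_distribs mult.assoc)
  show ?thesis
    using coeff_map_Const[of 1] coeff_map_Const[of 0]
    by unfold_locales (simp_all add: coeff_map_add mult)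
qed

text \<open>
  Summing over a common finite set of exponents makes substitution additive even when terms
  cancel.
\<close>

lemma subst_superset:
  assumes "finite A" "Poly_Mapping.keys p \<subseteq> A"
  shows "subst s p = (\<Sum>m\<in>A. Const (Poly_Mapping.lookup p m) *
     (\<Prod>v\<in>Poly_Mapping.keys m. s v ^ Poly_Mapping.lookup m v))"
  unfolding subst_def using assms
  by (intro sum.mono_neutral_left) (auto simp: in_keys_iff)

lemma subst_add: "subst s (p + q) = subst s p + subst s q"
proof -
  have "Poly_Mapping.keys (p + q) \<subseteq> Poly_Mapping.keys p \<union> Poly_Mapping.keys q"
    by (rule keys_add)
  then show ?thesis
    by (simp add: subst_superset[of "Poly_Mapping.keys p \<union> Poly_Mapping.keys q"]
        lookup_add Const_add algebra_simps sum.distrib)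
qed

lemma prod_keys_superset:
  fixes s :: "'v \<Rightarrow> 'a::comm_monoid_mult"
  assumes "finite A" "Poly_Mapping.keys m \<subseteq> A"
  shows "(\<Prod>v\<in>Poly_Mapping.keys m. s v ^ Poly_Mapping.lookup m v) = (\<Prod>v\<in>A. s v ^ Poly_Mapping.lookup m v)"
  using assms by (intro prod.mono_neutral_left) (auto simp: in_keys_iff)

lemma subst_Const [simp]: "subst s (Const c) = Const c"
  by (cases "c = 0") (simp_all add: subst_def Const_def)

lemma subst_single: "subst s (Poly_Mapping.single m c) =
    Const c * (\<Prod>v\<in>Poly_Mapping.keys m. s v ^ Poly_Mapping.lookup m v)"
  by (cases "c = 0") (simp_all add: subst_def)

lemma subst_Var_mult: "subst s (Var v * p) = s v * subst s p"
proof (induction p rule: poly_mapping_induct)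
  case (single m c)
  let ?A = "insert v (Poly_Mapping.keys m)"
  let ?m = "Poly_Mapping.single v 1 + m"
  have "Poly_Mapping.keys ?m \<subseteq> ?A"
    using keys_add[of "Poly_Mapping.single v 1" m] by auto
  then have "(\<Prod>w\<in>Poly_Mapping.keys ?m. s w ^ Poly_Mapping.lookup ?m w) =
      (\<Prod>w\<in>?A. s w ^ Poly_Mapping.lookup ?m w)"
    by (intro prod_keys_superset) auto
  also have "\<dots> = (\<Prod>w\<in>?A. (if w = v then s v else 1) * s w ^ Poly_Mapping.lookup m w)"
    by (intro prod.cong) (auto simp: lookup_add lookup_single when_def power_add)
  also have "\<dots> = s v * (\<Prod>w\<in>?A. s w ^ Poly_Mapping.lookup m w)"
    by (subst prod.distrib) simp
  also have "(\<Prod>w\<in>?A. s w ^ Poly_Mapping.lookup m w) =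
      (\<Prod>w\<in>Poly_Mapping.keys m. s w ^ Poly_Mapping.lookup m w)"
    by (intro prod_keys_superset[symmetric]) auto
  finally show ?case
    by (simp add: subst_single ac_simps flip: single_plus_Var)
qed (simp add: subst_add ring_distribs)

lemma subst_mult: "subst s (p * q) = subst s p * subst s q"
proof -
  have Const: "subst s (Const c * q) = Const c * subst s q" for c q
  proof (induction q rule: mpoly_induct)
    case (Const d)
    then show ?case by (simp flip: Const_mult)
  next
    case (Var_mult v p)
    have "subst s (Const c * (Var v * p)) = subst s (Var v * (Const c * p))"
      by (simp only: mult.left_commute)
    also have "\<dots> = s v * (Const c * subst s p)"
      by (simp only: subst_Var_mult Var_mult)
    finally show ?case by (simp only: subst_Var_mult mult.left_commute)
  qed (simp add: ring_distribs subst_add)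
  show ?thesis
    by (induction p rule: mpoly_induct)
      (simp_all add: Const subst_add subst_Var_mult ring_distribs mult.assoc)
qed

lemma comm_ring_hom_subst: "comm_ring_hom (subst s)"
  using subst_Const[of s 0] subst_Const[of s 1]
  by unfold_locales (simp_all add: subst_add subst_mult del: subst_Const)

lemma subst_Var [simp]: "subst s (Var v) = s v"
  using subst_Var_mult[of s v 1] subst_Const[of s 1] by simp

section \<open>Variables occurring in a polynomial\<close>

lemma vars_Const [simp]: "vars (Const c) = {}"
  by (auto simp: vars_def Const_def)

lemma vars_0 [simp]: "vars 0 = {}" and vars_1 [simp]: "vars 1 = {}"
  by (simp_all add: vars_def)

lemma vars_Var [simp]: "vars (Var v :: ('v, 'r::zero_neq_one) mpoly) = {v}"
  by (simp add: vars_def Var_def)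

lemma vars_add: "vars p \<subseteq> N \<Longrightarrow> vars q \<subseteq> N \<Longrightarrow> vars (p + q) \<subseteq> N"
  using keys_add[of p q] unfolding vars_def by blast

lemma vars_uminus [simp]: "vars (- p) = vars (p :: ('v, 'r::comm_ring_1) mpoly)"
  by (simp add: vars_def)

lemma vars_mult: "vars p \<subseteq> N \<Longrightarrow> vars q \<subseteq> N \<Longrightarrow> vars (p * q) \<subseteq> N"
  for p :: "('v, 'r::comm_ring_1) mpoly"
proof -
  assume *: "vars p \<subseteq> N" "vars q \<subseteq> N"
  have "Poly_Mapping.keys m \<subseteq> N" if "m \<in> Poly_Mapping.keys (p * q)" for m
  proof -
    from that keys_mult[of p q] obtain k l
      where "m = k + l" "k \<in> Poly_Mapping.keys p" "l \<in> Poly_Mapping.keys q" by blast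
    then show ?thesis using * keys_add[of k l] unfolding vars_def by blast
  qed
  then show ?thesis by (auto simp: vars_def)
qed

lemma vars_power: "vars p \<subseteq> N \<Longrightarrow> vars (p ^ n) \<subseteq> N"
  for p :: "('v, 'r::comm_ring_1) mpoly"
  by (induction n) (simp_all add: vars_mult)

lemma vars_sum: "(\<And>i. i \<in> A \<Longrightarrow> vars (f i) \<subseteq> N) \<Longrightarrow> vars (sum f A) \<subseteq> N"
  by (induction A rule: infinite_finite_induct) (simp_all add: vars_add)

lemma keys_pderiv_at: "m \<in> Poly_Mapping.keys (pderiv_at v p) \<Longrightarrow> Poly_Mapping.single v 1 + m \<in> Poly_Mapping.keys p"
  by (auto simp: in_keys_iff lookup_pderiv_at simp del: of_nat_Suc)

lemma vars_pderiv_at: "vars p \<subseteq> N \<Longrightarrow> vars (pderiv_at v p) \<subseteq> N"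
proof -
  assume *: "vars p \<subseteq> N"
  have "Poly_Mapping.keys m \<subseteq> N" if "m \<in> Poly_Mapping.keys (pderiv_at v p)" for m
  proof -
    have "Poly_Mapping.keys (Poly_Mapping.single v 1 + m) \<subseteq> N"
      using * keys_pderiv_at[OF that] by (auto simp: vars_def)
    then show ?thesis by (auto simp: in_keys_iff lookup_add)
  qed
  then show ?thesis by (auto simp: vars_def)
qed

lemma pderiv_at_eq_0: "v \<notin> vars p \<Longrightarrow> pderiv_at v p = 0"
proof -
  assume v: "v \<notin> vars p"
  have "m \<notin> Poly_Mapping.keys (pderiv_at v p)" for m
  proof
    assume "m \<in> Poly_Mapping.keys (pderiv_at v p)"
    then have "Poly_Mapping.single v 1 + m \<in> Poly_Mapping.keys p" by (rule keys_pderiv_at)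
    moreover have "v \<in> Poly_Mapping.keys (Poly_Mapping.single v 1 + m)" by (simp add: in_keys_iff lookup_add)
    ultimately show False using v by (auto simp: vars_def)
  qed
  then show ?thesis by (metis ex_in_conv keys_eq_empty)
qed

section \<open>Polynomials in commuting operators\<close>

text \<open>
  The constant \<open>subst_op\<close> evaluates a polynomial \<open>p\<close> at three operators and sets the other variables
  to one. Giving each of those other variables the identity as its operator turns \<open>p \<mapsto> Op p\<close> into a
  ring homomorphism into operators, so that \<open>Op_Const\<close>, \<open>Op_add\<close> and \<open>Op_Var_mult\<close> characterise it.
\<close>

locale commuting_operators =
  fixes v1 v2 v3 :: var and L :: "var \<Rightarrow> form \<Rightarrow> form"
  assumes distinct: "v1 \<noteq> v2" "v1 \<noteq> v3" "v2 \<noteq> v3"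
    and L_add: "L v (f + g) = L v f + L v g"
    and L_Const_mult: "L v (Const c * f) = Const c * L v f"
    and L_commute: "L v (L w f) = L w (L v f)"
    and L_other: "v \<notin> {v1, v2, v3} \<Longrightarrow> L v f = f"
begin

definition Op :: "form \<Rightarrow> form \<Rightarrow> form" where
  "Op p f = subst_op (v1, v2, v3) p (L v1) (L v2) (L v3) f"

definition monom_op :: "(var \<Rightarrow>\<^sub>0 nat) \<Rightarrow> form \<Rightarrow> form" where
  "monom_op m f = (L v1 ^^ Poly_Mapping.lookup m v1)
     ((L v2 ^^ Poly_Mapping.lookup m v2) ((L v3 ^^ Poly_Mapping.lookup m v3) f))"

lemma Op_superset:
  assumes "finite A" "Poly_Mapping.keys p \<subseteq> A"
  shows "Op p f = (\<Sum>m\<in>A. Const (Poly_Mapping.lookup p m) * monom_op m f)"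
  unfolding Op_def subst_op_def monom_op_def using assms
  by (auto intro!: sum.mono_neutral_left simp: in_keys_iff)

lemma Op_add: "Op (p + q) f = Op p f + Op q f"
  using keys_add[of p q]
  by (simp add: Op_superset[of "Poly_Mapping.keys p \<union> Poly_Mapping.keys q"]
      lookup_add Const_add algebra_simps sum.distrib)

lemma Op_single: "Op (Poly_Mapping.single m c) f = Const c * monom_op m f"
  by (subst Op_superset[of "{m}"]) auto

lemma Op_0: "Op 0 f = 0"
  using Op_add[of 0 0 f] by simp

lemma Op_Const: "Op (Const c) f = Const c * f"
  using Op_single[of 0 c f] by (simp add: Const_def monom_op_def)

lemma funpow_commute: "L v ((L w ^^ n) f) = (L w ^^ n) (L v f)"
  by (induction n) (simp_all add: L_commute[of v w])

lemma monom_op_plus: "monom_op (Poly_Mapping.single v 1 + m) f = L v (monom_op m f)"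
proof (cases "v \<in> {v1, v2, v3}")
  case True
  then show ?thesis
    using distinct by (auto simp: monom_op_def lookup_add lookup_single funpow_commute plus_1_eq_Suc)
next
  case False
  then show ?thesis
    by (auto simp: monom_op_def lookup_add lookup_single L_other)
qed

lemma Op_Var_mult: "Op (Var v * p) f = L v (Op p f)"
proof (induction p rule: poly_mapping_induct)
  case (single m c)
  show ?case
    by (simp only: single_plus_Var[symmetric] Op_single monom_op_plus L_Const_mult)
qed (simp add: algebra_simps Op_add L_add)

lemma Op_Const_mult: "Op (Const c * p) f = Const c * Op p f"
proof (induction p rule: mpoly_induct)
  case (Const d)
  show ?case by (simp add: Op_Const ac_simps flip: Const_mult)
next
  case (Var_mult v p)
  have "Op (Const c * (Var v * p)) f = Op (Var v * (Const c * p)) f"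
    by (simp only: mult.left_commute)
  also have "\<dots> = L v (Const c * Op p f)"
    by (simp only: Op_Var_mult Var_mult)
  finally show ?case by (simp only: L_Const_mult Op_Var_mult)
qed (simp add: distrib_left Op_add)

lemma Op_add_right: "Op p (f + g) = Op p f + Op p g"
  by (induction p rule: mpoly_induct) (simp_all add: Op_Const Op_add Op_Var_mult L_add distrib_left add_ac)

lemma Op_Const_mult_right: "Op p (Const c * f) = Const c * Op p f"
  by (induction p rule: mpoly_induct) (simp_all add: Op_Const Op_add Op_Var_mult L_Const_mult distrib_left mult.left_commute)

lemma Op_0_right: "Op p 0 = 0"
  using Op_add_right[of p 0 0] by simp

lemma coeff_map_Op:
  assumes h: "comm_ring_hom h"
    and L: "\<And>v f. coeff_map h (L v f) = L v (coeff_map h f)"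
  shows "coeff_map h (Op p f) = Op (coeff_map h p) (coeff_map h f)"
proof -
  interpret h: comm_ring_hom h by fact
  interpret additive_map h by unfold_locales (simp add: h.hom_add)
  interpret H: comm_ring_hom "coeff_map h :: form \<Rightarrow> form" using h by (rule comm_ring_hom_coeff_map)
  have Const: "coeff_map h (Const c * f) = Const (h c) * coeff_map h f" for c
    by (simp add: H.hom_mult coeff_map_Const)
  show ?thesis
    by (induction p rule: mpoly_induct)
      (simp_all add: Op_Const Op_add Op_Var_mult L Const coeff_map_add coeff_map_Const coeff_map_Var_mult del: H.hom_mult)
qed

text \<open>
  Equivariance of a contraction. On the variables of \<open>p\<close> the derivation \<open>D\<close> is an elementary matrix
  sending \<open>s\<close> to \<open>e t\<close>, and its commutators with the operators follow the same matrix; then the product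
  rule for \<open>Op\<close> propagates from the variables to all polynomials in them.
\<close>

lemma derivation_Op:
  assumes D: "derivation D"
    and D_Const: "\<And>c. D (Const c) = Const (d c)"
    and D_Var: "\<And>v. v \<in> {v1, v2, v3} \<Longrightarrow> D (Var v) = (if v = s then Const e * Var t else 0)"
    and D_L: "\<And>v f. v \<in> {v1, v2, v3} \<Longrightarrow> D (L v f) = L v (D f) + (if v = s then Const e * L t f else 0)"
    and p: "vars p \<subseteq> {v1, v2, v3}"
  shows "D (Op p f) = Op (D p) f + Op p (D f)"
  using p
proof (induction p rule: mpoly_induct_vars)
  case (Const c)
  show ?case by (simp add: Op_Const D_Const derivation_mult[OF D])
next
  case (add p q)
  then show ?case by (simp add: Op_add derivation_add[OF D] algebra_simps)
next
  case (Var_mult v p)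
  have "D (Op (Var v * p) f) = L v (Op (D p) f) + L v (Op p (D f)) + (if v = s then Const e * L t (Op p f) else 0)"
    using Var_mult by (simp add: Op_Var_mult D_L L_add)
  moreover have "Op (D (Var v * p)) f = L v (Op (D p) f) + (if v = s then Const e * L t (Op p f) else 0)"
    using Var_mult(1) by (simp add: derivation_mult[OF D] Op_add Op_Var_mult D_Var mult.assoc Op_Const_mult Op_0)
  ultimately show ?case by (simp add: Op_Var_mult add_ac)
qed

lemma Op_induct_right:
  assumes "\<And>f g. P f \<Longrightarrow> P g \<Longrightarrow> P (f + g)" "\<And>c f. P f \<Longrightarrow> P (Const c * f)" "\<And>v f. P f \<Longrightarrow> P (L v f)" "P f"
  shows "P (Op p f)"
  by (induction p rule: mpoly_induct) (simp_all add: Op_Const Op_add Op_Var_mult assms)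

end

fun diff_uvw :: "var \<Rightarrow> form \<Rightarrow> form" where
  "diff_uvw U = pderiv_at X" | "diff_uvw V = pderiv_at Y" | "diff_uvw W = pderiv_at Z" | "diff_uvw _ = id"

fun diff_xyz :: "var \<Rightarrow> form \<Rightarrow> form" where
  "diff_xyz X = pderiv_at U" | "diff_xyz Y = pderiv_at V" | "diff_xyz Z = pderiv_at W" | "diff_xyz _ = id"

text \<open>
  The components of \<open>\<partial> \<times> (u, v, w)\<close>. Both factors are transformed contragrediently, so for a
  traceless matrix their cross product is transformed like \<open>(x, y, z)\<close>.
\<close>

fun diff_cross :: "var \<Rightarrow> form \<Rightarrow> form" where
  "diff_cross X = (\<lambda>f. Var W * pderiv_at Y f - Var V * pderiv_at Z f)"
| "diff_cross Y = (\<lambda>f. Var U * pderiv_at Z f - Var W * pderiv_at X f)"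
| "diff_cross Z = (\<lambda>f. Var V * pderiv_at X f - Var U * pderiv_at Y f)"
| "diff_cross _ = id"

lemmas pderiv_rules = derivation_add[OF derivation_pderiv_at] derivation_diff[OF derivation_pderiv_at]
  pderiv_at_Var_mult pderiv_at_Const_mult derivation_0[OF derivation_pderiv_at]

interpretation uvw: commuting_operators U V W diff_uvw
proof
  fix v w f
  show "diff_uvw v (diff_uvw w f) = diff_uvw w (diff_uvw v f)"
    by (cases v; cases w) (simp_all add: pderiv_at_commute)
next
  fix v and f g :: form
  show "diff_uvw v (f + g) = diff_uvw v f + diff_uvw v g"
    by (cases v) (simp_all add: pderiv_rules)
next
  fix v c and f :: form
  show "diff_uvw v (Const c * f) = Const c * diff_uvw v f"
    by (cases v) (simp_all add: pderiv_rules)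
next
  fix v and f :: form
  show "v \<notin> {U, V, W} \<Longrightarrow> diff_uvw v f = f"
    by (cases v) simp_all
qed simp_all

interpretation xyz: commuting_operators X Y Z diff_xyz
proof
  fix v w f
  show "diff_xyz v (diff_xyz w f) = diff_xyz w (diff_xyz v f)"
    by (cases v; cases w) (simp_all add: pderiv_at_commute)
next
  fix v and f g :: form
  show "diff_xyz v (f + g) = diff_xyz v f + diff_xyz v g"
    by (cases v) (simp_all add: pderiv_rules)
next
  fix v c and f :: form
  show "diff_xyz v (Const c * f) = Const c * diff_xyz v f"
    by (cases v) (simp_all add: pderiv_rules)
next
  fix v and f :: form
  show "v \<notin> {X, Y, Z} \<Longrightarrow> diff_xyz v f = f"
    by (cases v) simp_all
qed simp_all

interpretation cross: commuting_operators X Y Z diff_cross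
proof
  fix v w f
  show "diff_cross v (diff_cross w f) = diff_cross w (diff_cross v f)"
    by (cases v; cases w) (simp_all add: pderiv_rules algebra_simps pderiv_at_commute[of Y X] pderiv_at_commute[of Z X] pderiv_at_commute[of Z Y])
next
  fix v and f g :: form
  show "diff_cross v (f + g) = diff_cross v f + diff_cross v g"
    by (cases v) (simp_all add: pderiv_rules algebra_simps)
next
  fix v c and f :: form
  show "diff_cross v (Const c * f) = Const c * diff_cross v f"
    by (cases v) (simp_all add: pderiv_rules right_diff_distrib mult.left_commute)
next
  fix v and f :: form
  show "v \<notin> {X, Y, Z} \<Longrightarrow> diff_cross v f = f"
    by (cases v) simp_all
qed simp_all

lemma D_uvw_eq: "D_uvw p f = uvw.Op p f"
  by (simp add: D_uvw_def uvw.Op_def)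

lemma D_xyz_eq: "D_xyz p f = xyz.Op p f"
  by (simp add: D_xyz_def xyz.Op_def)

lemma J4_eq: "J4 p f = cross.Op p f"
  by (simp add: J4_def cross.Op_def)

section \<open>The infinitesimal action of the special linear group\<close>

fun dual :: "var \<Rightarrow> var" where
  "dual X = U" | "dual Y = V" | "dual Z = W" | "dual v = v"

fun expo :: "var \<Rightarrow> nat \<times> nat \<times> nat \<Rightarrow> nat" where
  "expo X (i, j, k) = i" | "expo Y (i, j, k) = j" | "expo Z (i, j, k) = k" | "expo _ m = 0"

fun raise :: "var \<Rightarrow> nat \<times> nat \<times> nat \<Rightarrow> nat \<times> nat \<times> nat" where
  "raise X (i, j, k) = (Suc i, j, k)" | "raise Y (i, j, k) = (i, Suc j, k)" | "raise Z (i, j, k) = (i, j, Suc k)"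
| "raise _ m = m"

fun lower :: "var \<Rightarrow> nat \<times> nat \<times> nat \<Rightarrow> nat \<times> nat \<times> nat" where
  "lower X (i, j, k) = (i - 1, j, k)" | "lower Y (i, j, k) = (i, j - 1, k)" | "lower Z (i, j, k) = (i, j, k - 1)"
| "lower _ m = m"

definition degree4 :: "(nat \<times> nat \<times> nat) set" where
  "degree4 = {(i, j, k). i + j + k = 4}"

lemma finite_degree4: "finite degree4"
  by (rule finite_subset[of _ "{..4} \<times> {..4} \<times> {..4}"]) (auto simp: degree4_def)

text \<open>
  The pairs indexing the root vectors of the Lie algebra of the special linear group.
\<close>

definition is_root :: "var \<Rightarrow> var \<Rightarrow> bool" where
  "is_root a b \<longleftrightarrow> a \<in> {X, Y, Z} \<and> b \<in> {X, Y, Z} \<and> a \<noteq> b"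

text \<open>
  The negative of the coefficient of the monomial \<open>m\<close> in \<open>a \<partial>/\<partial>b\<close> of the universal quartic.
\<close>

definition lie_Var :: "var \<Rightarrow> var \<Rightarrow> nat \<times> nat \<times> nat \<Rightarrow> coef" where
  "lie_Var a b m = (if expo a m = 0 then 0 else - of_nat (Suc (expo b m)) * Var (raise b (lower a m)))"

definition lie :: "var \<Rightarrow> var \<Rightarrow> coef \<Rightarrow> coef" where
  "lie a b f = (\<Sum>m\<in>degree4. lie_Var a b m * pderiv_at m f)"

lemma derivation_lie: "derivation (lie a b)"
  unfolding lie_def by (rule derivation_scale_sum) (rule derivation_pderiv_at)

lemma lie_Const [simp]: "lie a b (Const r) = 0"
  by (simp add: lie_def)

lemma lie_Var: "m \<in> degree4 \<Longrightarrow> lie a b (Var m) = lie_Var a b m"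
  by (simp add: lie_def pderiv_at_Var finite_degree4 if_distrib sum.delta cong: if_cong)

text \<open>
  The sign of the last term makes \<open>u\<close>, \<open>v\<close>, \<open>w\<close> dual to \<open>x\<close>, \<open>y\<close>, \<open>z\<close>: the pairing
  \<open>ux + vy + wz\<close> is killed.
\<close>

definition theta :: "var \<Rightarrow> var \<Rightarrow> form \<Rightarrow> form" where
  "theta a b p = coeff_map (lie a b) p + (Var a * pderiv_at b p - Var (dual b) * pderiv_at (dual a) p)"

interpretation lie: additive_map "lie a b"
  by unfold_locales (rule derivation_add[OF derivation_lie])

lemma derivation_theta: "derivation (theta a b)"
proof -
  have "derivation (\<lambda>p. 1 * coeff_map (lie a b) p +
      1 * (Var a * pderiv_at b p + (- Var (dual b)) * pderiv_at (dual a) p))"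
    by (intro derivation_lincomb derivation_coeff_map derivation_lie derivation_pderiv_at)
  moreover have "theta a b = (\<lambda>p. 1 * coeff_map (lie a b) p +
      1 * (Var a * pderiv_at b p + (- Var (dual b)) * pderiv_at (dual a) p))"
    by (simp add: fun_eq_iff theta_def)
  ultimately show ?thesis by simp
qed

lemma theta_Const: "theta a b (Const c) = Const (lie a b c)"
  by (simp add: theta_def lie.coeff_map_Const)

lemma coeff_map_lie_Var [simp]: "coeff_map (lie a b) (Var v) = 0"
proof -
  have "coeff_map (lie a b) (Var v * 1) = Var v * coeff_map (lie a b) (Const 1)"
    by (simp only: lie.coeff_map_Var_mult Const_1)
  also have "\<dots> = 0"
    by (simp only: lie.coeff_map_Const derivation_1[OF derivation_lie]) simp
  finally show ?thesis by simp
qed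

lemma theta_Var: "theta a b (Var v) = (if v = b then Var a else 0) - (if v = dual a then Var (dual b) else 0)"
  by (auto simp: theta_def pderiv_at_Var)

lemma theta_pderiv_at:
  "theta a b (pderiv_at v p) = pderiv_at v (theta a b p)
     - (if v = a then pderiv_at b p else 0) + (if v = dual b then pderiv_at (dual a) p else 0)"
  by (simp add: theta_def lie.coeff_map_pderiv_at pderiv_rules pderiv_at_commute[of v])

lemma const_term_theta: "const_term (theta a b p) = lie a b (const_term p)"
  by (simp add: theta_def const_term_def lookup_add lookup_minus lookup_Var_mult lie.lookup_coeff_map)

lemma theta_D_uvw:
  assumes "is_root a b" "vars B \<subseteq> {U, V, W}"
  shows "theta a b (D_uvw B A) = D_uvw (theta a b B) A + D_uvw B (theta a b A)"
  unfolding D_uvw_eq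
\<comment> \<open>The dual action sends the dual of \<open>a\<close> to minus the dual of \<open>b\<close>.\<close>
proof (rule uvw.derivation_Op[OF derivation_theta theta_Const _ _ assms(2), where s = "dual a" and t = "dual b" and e = "- 1"])
  fix v assume "v \<in> {U, V, W}"
  then show "theta a b (Var v) = (if v = dual a then Const (- 1) * Var (dual b) else 0)"
    using assms(1) by (auto simp: theta_Var is_root_def Const_uminus)
  fix f
  show "theta a b (diff_uvw v f) = diff_uvw v (theta a b f) + (if v = dual a then Const (- 1) * diff_uvw (dual b) f else 0)"
    using assms(1) \<open>v \<in> {U, V, W}\<close> by (auto simp: theta_pderiv_at is_root_def Const_uminus)
qed

lemma theta_D_xyz:
  assumes "is_root a b" "vars A \<subseteq> {X, Y, Z}"
  shows "theta a b (D_xyz A B) = D_xyz (theta a b A) B + D_xyz A (theta a b B)"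
  unfolding D_xyz_eq
proof (rule xyz.derivation_Op[OF derivation_theta theta_Const _ _ assms(2), where s = b and t = a and e = 1])
  fix v assume "v \<in> {X, Y, Z}"
  then show "theta a b (Var v) = (if v = b then Const 1 * Var a else 0)"
    using assms(1) by (auto simp: theta_Var is_root_def)
  fix f
  show "theta a b (diff_xyz v f) = diff_xyz v (theta a b f) + (if v = b then Const 1 * diff_xyz a f else 0)"
    using assms(1) \<open>v \<in> {X, Y, Z}\<close> by (auto simp: theta_pderiv_at is_root_def)
qed

lemma theta_J4:
  assumes "is_root a b" "vars p \<subseteq> {X, Y, Z}"
  shows "theta a b (J4 p f) = J4 (theta a b p) f + J4 p (theta a b f)"
  unfolding J4_eq
proof (rule cross.derivation_Op[OF derivation_theta theta_Const _ _ assms(2), where s = b and t = a and e = 1])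
  fix v assume "v \<in> {X, Y, Z}"
  then show "theta a b (Var v) = (if v = b then Const 1 * Var a else 0)"
    using assms(1) by (auto simp: theta_Var is_root_def)
  fix f
  show "theta a b (diff_cross v f) = diff_cross v (theta a b f) + (if v = b then Const 1 * diff_cross a f else 0)"
    using assms(1) \<open>v \<in> {X, Y, Z}\<close>
    by (auto simp: theta_pderiv_at theta_Var derivation_diff[OF derivation_theta] derivation_mult[OF derivation_theta]
        is_root_def algebra_simps)
qed

lemma pderiv_at_xyz_monom:
  "b \<in> {X, Y, Z} \<Longrightarrow> pderiv_at b (xyz_monom m) = of_nat (expo b m) * xyz_monom (lower b m)"
  by (cases m) (auto simp: xyz_monom_def derivation_mult[OF derivation_pderiv_at]
      derivation_power[OF derivation_pderiv_at] pderiv_at_Var mult.assoc mult.left_commute)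

lemma Var_mult_xyz_monom: "a \<in> {X, Y, Z} \<Longrightarrow> Var a * xyz_monom m = xyz_monom (raise a m)"
  by (cases m) (auto simp: xyz_monom_def mult.assoc mult.left_commute)

lemma vars_xyz_monom: "vars (xyz_monom m) \<subseteq> {X, Y, Z}"
  by (cases m) (simp add: xyz_monom_def vars_mult vars_power)

lemma coeff_map_lie_xyz_monom: "coeff_map (lie a b) (xyz_monom m) = 0"
proof -
  have D: "derivation (coeff_map (lie a b) :: form \<Rightarrow> form)"
    by (intro derivation_coeff_map derivation_lie)
  show ?thesis
    by (cases m) (simp add: xyz_monom_def derivation_mult[OF D] derivation_zero_power[OF D])
qed

lemma pderiv_at_dual_eq_0:
  "is_root a b \<Longrightarrow> vars p \<subseteq> {X, Y, Z} \<Longrightarrow> pderiv_at (dual a) p = 0"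
  by (rule pderiv_at_eq_0) (auto simp: is_root_def)

lemma theta_xyz_monom:
  assumes "is_root a b"
  shows "theta a b (xyz_monom m) = of_nat (expo b m) * xyz_monom (raise a (lower b m))"
proof -
  have "theta a b (xyz_monom m) = Var a * (of_nat (expo b m) * xyz_monom (lower b m))"
    using assms pderiv_at_dual_eq_0[OF assms vars_xyz_monom]
    by (simp add: theta_def coeff_map_lie_xyz_monom pderiv_at_xyz_monom is_root_def)
  also have "\<dots> = of_nat (expo b m) * xyz_monom (raise a (lower b m))"
    using assms Var_mult_xyz_monom[of a "lower b m"]
    unfolding mult.left_commute[of "Var a"] by (simp add: is_root_def)
  finally show ?thesis .
qed

lemma universal_quartic_eq: "universal_quartic = (\<Sum>m\<in>degree4. Const (Var m) * xyz_monom m)"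
  unfolding universal_quartic_def degree4_def by (intro sum.cong) auto

lemma vars_universal_quartic: "vars universal_quartic \<subseteq> {X, Y, Z}"
  unfolding universal_quartic_eq by (intro vars_sum vars_mult vars_xyz_monom) simp

text \<open>
  Acting on the coefficients and on the monomials cancels, because the two sums are exchanged by
  shifting one exponent from \<open>b\<close> to \<open>a\<close>.
\<close>

lemma theta_universal_quartic:
  assumes "is_root a b"
  shows "theta a b universal_quartic = 0"
proof -
  note D = derivation_theta[of a b]
  have "theta a b universal_quartic =
     (\<Sum>m\<in>degree4. Const (lie_Var a b m) * xyz_monom m) +
     (\<Sum>m\<in>degree4. Const (Var m) * (of_nat (expo b m) * xyz_monom (raise a (lower b m))))"
    unfolding universal_quartic_eq derivation_sum[OF D] derivation_mult[OF D]
    by (simp add: theta_Const lie_Var theta_xyz_monom[OF assms] sum.distrib)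
  also have "(\<Sum>m\<in>degree4. Const (lie_Var a b m) * xyz_monom m) =
     (\<Sum>m\<in>{m\<in>degree4. expo a m \<noteq> 0}. - (Const (of_nat (Suc (expo b m)) * Var (raise b (lower a m))) * xyz_monom m))"
    by (rule sum.mono_neutral_cong_right)
      (auto simp: lie_Var_def finite_degree4 Const_uminus simp del: of_nat_Suc)
  also have "(\<Sum>m\<in>degree4. Const (Var m) * (of_nat (expo b m) * xyz_monom (raise a (lower b m)))) =
     (\<Sum>m\<in>{m\<in>degree4. expo b m \<noteq> 0}. Const (Var m) * (of_nat (expo b m) * xyz_monom (raise a (lower b m))))"
    by (rule sum.mono_neutral_right) (auto simp: finite_degree4)
  also have "\<dots> = (\<Sum>m\<in>{m\<in>degree4. expo a m \<noteq> 0}. Const (of_nat (Suc (expo b m)) * Var (raise b (lower a m))) * xyz_monom m)"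
  proof (rule sum.reindex_bij_witness[where i = "\<lambda>m. raise b (lower a m)" and j = "\<lambda>m. raise a (lower b m)"])
    fix m assume m: "m \<in> {m \<in> degree4. expo b m \<noteq> 0}"
    show "raise b (lower a (raise a (lower b m))) = m"
      using assms m by (cases m) (auto simp: is_root_def)
    show "raise a (lower b m) \<in> {m \<in> degree4. expo a m \<noteq> 0}"
      using assms m by (cases m) (auto simp: is_root_def degree4_def)
    have "raise b (lower a (raise a (lower b m))) = m" "Suc (expo b (raise a (lower b m))) = expo b m"
      using assms m by (cases m; auto simp: is_root_def)+
    then show "Const (of_nat (Suc (expo b (raise a (lower b m)))) * Var (raise b (lower a (raise a (lower b m))))) *
        xyz_monom (raise a (lower b m)) = Const (Var m) * (of_nat (expo b m) * xyz_monom (raise a (lower b m)))"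
      by (simp add: Const_mult Const_def[of "of_nat _"] mult.assoc mult.left_commute)
  next
    fix m assume m: "m \<in> {m \<in> degree4. expo a m \<noteq> 0}"
    show "raise a (lower b (raise b (lower a m))) = m"
      using assms m by (cases m) (auto simp: is_root_def)
    show "raise b (lower a m) \<in> {m \<in> degree4. expo b m \<noteq> 0}"
      using assms m by (cases m) (auto simp: is_root_def degree4_def)
  qed
  finally show ?thesis by (simp add: sum_negf)
qed

section \<open>Variables of the covariants\<close>

text \<open>
  The operators \<open>D_uvw\<close> and \<open>D_xyz\<close> ignore the variables that they do not replace, so equivariance
  requires their first argument to be free of them. For \<open>J4\<close> of two quartics this is a matter of degree:
  four derivatives in \<open>x\<close>, \<open>y\<close>, \<open>z\<close> exhaust a form of degree four.
\<close>

definition xyz_degree :: "nat \<Rightarrow> form \<Rightarrow> bool" where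
  "xyz_degree d p \<longleftrightarrow> (\<forall>m\<in>Poly_Mapping.keys p.
     Poly_Mapping.lookup m X + Poly_Mapping.lookup m Y + Poly_Mapping.lookup m Z = d)"

lemma xyz_degree_add: "xyz_degree d p \<Longrightarrow> xyz_degree d q \<Longrightarrow> xyz_degree d (p + q)"
  using keys_add[of p q] unfolding xyz_degree_def by blast

lemma xyz_degree_mult:
  assumes "xyz_degree d p" "xyz_degree e q"
  shows "xyz_degree (d + e) (p * q)"
  unfolding xyz_degree_def
proof
  fix m assume "m \<in> Poly_Mapping.keys (p * q)"
  then obtain k l where m: "m = k + l" and "k \<in> Poly_Mapping.keys p" "l \<in> Poly_Mapping.keys q"
    using keys_mult[of p q] by blast
  then have "Poly_Mapping.lookup k X + Poly_Mapping.lookup k Y + Poly_Mapping.lookup k Z = d"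
    "Poly_Mapping.lookup l X + Poly_Mapping.lookup l Y + Poly_Mapping.lookup l Z = e"
    using assms unfolding xyz_degree_def by blast+
  then show "Poly_Mapping.lookup m X + Poly_Mapping.lookup m Y + Poly_Mapping.lookup m Z = d + e"
    by (simp add: m lookup_add)
qed

lemma xyz_degree_sum: "(\<And>i. i \<in> A \<Longrightarrow> xyz_degree d (f i)) \<Longrightarrow> xyz_degree d (sum f A)"
  by (induction A rule: infinite_finite_induct) (simp_all add: xyz_degree_add, simp_all add: xyz_degree_def)

lemma xyz_degree_Const: "xyz_degree 0 (Const c)"
  by (auto simp: xyz_degree_def Const_def)

lemma xyz_degree_Var: "xyz_degree (if v \<in> {X, Y, Z} then 1 else 0) (Var v)"
  by (auto simp: xyz_degree_def Var_def lookup_single)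

lemma xyz_degree_power_Var: "v \<in> {X, Y, Z} \<Longrightarrow> xyz_degree n (Var v ^ n)"
proof (induction n)
  case 0
  show ?case using xyz_degree_Const[of 1] by simp
next
  case (Suc n)
  then show ?case using xyz_degree_mult[OF xyz_degree_Var[of v] Suc.IH] by (simp add: plus_1_eq_Suc)
qed

lemma xyz_degree_xyz_monom: "xyz_degree (i + j + k) (xyz_monom (i, j, k))"
  by (simp add: xyz_monom_def xyz_degree_mult xyz_degree_power_Var)

lemma xyz_degree_Const_mult: "xyz_degree d p \<Longrightarrow> xyz_degree d (Const c * p)"
  using xyz_degree_mult[OF xyz_degree_Const] by simp

lemma xyz_degree_universal_quartic: "xyz_degree 4 universal_quartic"
  unfolding universal_quartic_eq
  by (intro xyz_degree_sum xyz_degree_Const_mult) (auto simp: degree4_def intro: xyz_degree_xyz_monom[THEN ssubst[of _ _ "\<lambda>d. xyz_degree d _", rotated]])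

lemma xyz_degree_pderiv_at:
  assumes "v \<in> {X, Y, Z}" "xyz_degree (Suc d) p"
  shows "xyz_degree d (pderiv_at v p)"
  unfolding xyz_degree_def
proof
  fix m assume "m \<in> Poly_Mapping.keys (pderiv_at v p)"
  then have "Poly_Mapping.single v 1 + m \<in> Poly_Mapping.keys p" by (rule keys_pderiv_at)
  then show "Poly_Mapping.lookup m X + Poly_Mapping.lookup m Y + Poly_Mapping.lookup m Z = d"
    using assms by (fastforce simp: xyz_degree_def lookup_add lookup_single)
qed

lemma xyz_degree_diff_cross:
  assumes "v \<in> {X, Y, Z}" "xyz_degree (Suc d) p"
  shows "xyz_degree d (diff_cross v p)"
proof -
  have mult: "xyz_degree d (Var w * pderiv_at u p)" if "w \<notin> {X, Y, Z}" "u \<in> {X, Y, Z}" for w u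
    using xyz_degree_mult[OF xyz_degree_Var[of w] xyz_degree_pderiv_at[OF that(2) assms(2)]] that by simp
  have diff: "xyz_degree d (f - g)" if "xyz_degree d f" "xyz_degree d g" for f g
    using xyz_degree_add[OF that(1) xyz_degree_Const_mult[OF that(2), of "- 1"]] by (simp add: Const_uminus)
  show ?thesis using assms(1) by (auto intro!: mult diff)
qed

lemma xyz_degree_funpow_diff_cross:
  "v \<in> {X, Y, Z} \<Longrightarrow> xyz_degree (n + d) p \<Longrightarrow> xyz_degree d ((diff_cross v ^^ n) p)"
  by (induction n arbitrary: d) (simp_all add: xyz_degree_diff_cross flip: add_Suc_right)

lemma vars_J4:
  assumes "xyz_degree d p" "xyz_degree d q"
  shows "vars (J4 p q) \<subseteq> {U, V, W}"
proof -
  have "xyz_degree 0 (cross.monom_op m q)" if "m \<in> Poly_Mapping.keys p" for m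
  proof -
    have "Poly_Mapping.lookup m Z + (Poly_Mapping.lookup m Y + (Poly_Mapping.lookup m X + 0)) = d"
      using assms(1) that unfolding xyz_degree_def by fastforce
    then have "xyz_degree (Poly_Mapping.lookup m Z + (Poly_Mapping.lookup m Y + (Poly_Mapping.lookup m X + 0))) q"
      using assms(2) by simp
    then show ?thesis
      unfolding cross.monom_op_def by (intro xyz_degree_funpow_diff_cross) simp_all
  qed
  then have "xyz_degree 0 (J4 p q)"
    unfolding J4_eq cross.Op_superset[OF finite_keys subset_refl]
    by (intro xyz_degree_sum xyz_degree_Const_mult)
  then have "{X, Y, Z} \<inter> vars (J4 p q) = {}"
    by (auto simp: xyz_degree_def vars_def in_keys_iff)
  then have "v \<in> {U, V, W}" if "v \<in> vars (J4 p q)" for v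
    using that by (cases v) auto
  then show ?thesis by blast
qed

lemma vars_D_uvw: "vars A \<subseteq> N \<Longrightarrow> vars (D_uvw B A) \<subseteq> N"
  unfolding D_uvw_eq
proof (rule uvw.Op_induct_right[where P = "\<lambda>p. vars p \<subseteq> N"])
  show "vars f \<subseteq> N \<Longrightarrow> vars (diff_uvw v f) \<subseteq> N" for v f
    by (cases v) (simp_all add: vars_pderiv_at)
qed (simp_all add: vars_add vars_mult)

lemma vars_D_xyz: "vars B \<subseteq> N \<Longrightarrow> vars (D_xyz A B) \<subseteq> N"
  unfolding D_xyz_eq
proof (rule xyz.Op_induct_right[where P = "\<lambda>p. vars p \<subseteq> N"])
  show "vars f \<subseteq> N \<Longrightarrow> vars (diff_xyz v f) \<subseteq> N" for v f
    by (cases v) (simp_all add: vars_pderiv_at)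
qed (simp_all add: vars_add vars_mult)

lemma vars_rscale: "vars p \<subseteq> N \<Longrightarrow> vars (rscale r p) \<subseteq> N"
  by (simp add: rscale_def vars_mult)

lemma theta_rscale: "theta a b (rscale r p) = rscale r (theta a b p)"
  by (simp add: rscale_def derivation_mult[OF derivation_theta] theta_Const)

section \<open>Derivatives of determinants\<close>

text \<open>
  Jacobi's formula. Row by row, the Leibniz rule in the expansion over permutations yields the
  determinant with one row differentiated, which is expanded along that row.
\<close>

lemma derivation_det:
  assumes D: "derivation D" and A: "A \<in> carrier_mat n n"
  shows "D (det A) = (\<Sum>i<n. \<Sum>j<n. D (A $$ (i, j)) * cofactor A i j)"
proof -
  let ?P = "{p. p permutes {0..<n}}"
  have fin: "finite ?P" by (simp add: finite_permutations)
  have row: "(\<Sum>j<n. D (A $$ (i, j)) * cofactor A i j) =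
      (\<Sum>p\<in>?P. signof p * (D (A $$ (i, p i)) * (\<Prod>k\<in>{0..<n} - {i}. A $$ (k, p k))))" if i: "i < n" for i
  proof -
    define B where "B = mat n n (\<lambda>(k, j). if k = i then D (A $$ (i, j)) else A $$ (k, j))"
    have B: "B \<in> carrier_mat n n" by (simp add: B_def)
    have "mat_delete B i j = mat_delete A i j" if "j < n" for j
      using A i that unfolding mat_delete_def B_def by (intro eq_matI) auto
    then have cof: "cofactor B i j = cofactor A i j" if "j < n" for j
      using that by (simp add: cofactor_def)
    have "det B = (\<Sum>j<n. B $$ (i, j) * cofactor B i j)"
      by (rule laplace_expansion_row[OF B i])
    also have "\<dots> = (\<Sum>j<n. D (A $$ (i, j)) * cofactor A i j)"
      using i by (intro sum.cong) (auto simp: B_def cof[unfolded B_def])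
    finally have 1: "det B = (\<Sum>j<n. D (A $$ (i, j)) * cofactor A i j)" .
    have "det B = (\<Sum>p\<in>?P. signof p * (\<Prod>k = 0..<n. B $$ (k, p k)))"
      by (rule det_def'[OF B])
    also have "\<dots> = (\<Sum>p\<in>?P. signof p * (D (A $$ (i, p i)) * (\<Prod>k\<in>{0..<n} - {i}. A $$ (k, p k))))"
    proof (intro sum.cong refl arg_cong2[where f = "(*)"])
      fix p assume p: "p \<in> ?P"
      have pk: "p k < n" if "k < n" for k
        using permutes_in_image[of p "{0..<n}" k] p that by simp
      have "(\<Prod>k = 0..<n. B $$ (k, p k)) = B $$ (i, p i) * (\<Prod>k\<in>{0..<n} - {i}. B $$ (k, p k))"
        using i by (intro prod.remove) auto
      also have "\<dots> = D (A $$ (i, p i)) * (\<Prod>k\<in>{0..<n} - {i}. A $$ (k, p k))"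
        using i pk by (intro arg_cong2[where f = "(*)"] prod.cong) (auto simp: B_def)
      finally show "(\<Prod>k = 0..<n. B $$ (k, p k)) = D (A $$ (i, p i)) * (\<Prod>k\<in>{0..<n} - {i}. A $$ (k, p k))" .
    qed
    finally show ?thesis using 1 by simp
  qed
  have "D (det A) = (\<Sum>p\<in>?P. D (signof p * (\<Prod>k = 0..<n. A $$ (k, p k))))"
    by (simp add: det_def'[OF A] derivation_sum[OF D])
  also have "\<dots> = (\<Sum>p\<in>?P. \<Sum>i<n. signof p * (D (A $$ (i, p i)) * (\<Prod>k\<in>{0..<n} - {i}. A $$ (k, p k))))"
  proof (intro sum.cong refl)
    fix p
    have "D (signof p) = 0"
      by (simp add: sign_def derivation_1[OF D] derivation_uminus[OF D])
    then show "D (signof p * (\<Prod>k = 0..<n. A $$ (k, p k))) =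
        (\<Sum>i<n. signof p * (D (A $$ (i, p i)) * (\<Prod>k\<in>{0..<n} - {i}. A $$ (k, p k))))"
      by (simp add: derivation_mult[OF D] derivation_prod[OF D] sum_distrib_left lessThan_atLeast0)
  qed
  also have "\<dots> = (\<Sum>i<n. \<Sum>j<n. D (A $$ (i, j)) * cofactor A i j)"
    by (subst sum.swap) (simp add: row)
  finally show ?thesis .
qed

text \<open>
  The infinitesimal form of the invariance of a determinant under congruence by a unimodular
  matrix: the derivative is twice the trace of \<open>N\<close> times the determinant, and the trace vanishes.
\<close>

lemma derivation_det_congruence:
  assumes D: "derivation D" and A: "A \<in> carrier_mat n n"
    and DA: "\<And>i j. i < n \<Longrightarrow> j < n \<Longrightarrow>
      D (A $$ (i, j)) = (\<Sum>k<n. N i k * A $$ (k, j)) + (\<Sum>k<n. N j k * A $$ (i, k))"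
    and N: "\<And>i. i < n \<Longrightarrow> N i i = 0"
  shows "D (det A) = 0"
proof -
  note adj = adj_mat[OF A]
  have dims: "dim_row A = n" "dim_col A = n" using A by auto
  have row: "(\<Sum>j<n. A $$ (k, j) * cofactor A i j) = (if k = i then det A else 0)" if "i < n" "k < n" for i k
  proof -
    have "(A * adj_mat A) $$ (k, i) = (\<Sum>j<n. A $$ (k, j) * cofactor A i j)"
      using that A adj(1) by (simp add: adj_mat_def scalar_prod_def dims lessThan_atLeast0)
    then show ?thesis using that adj(2) by (cases "k = i") simp_all
  qed
  have col: "(\<Sum>i<n. A $$ (i, k) * cofactor A i j) = (if k = j then det A else 0)" if "j < n" "k < n" for j k
  proof -
    have "(adj_mat A * A) $$ (j, k) = (\<Sum>i<n. cofactor A i j * A $$ (i, k))"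
      using that A adj(1) by (simp add: adj_mat_def scalar_prod_def dims lessThan_atLeast0)
    then show ?thesis using that adj(3) by (cases "k = j") (simp_all add: mult.commute)
  qed
  have "(\<Sum>i<n. \<Sum>j<n. (\<Sum>k<n. N i k * A $$ (k, j)) * cofactor A i j) =
      (\<Sum>i<n. \<Sum>k<n. N i k * (\<Sum>j<n. A $$ (k, j) * cofactor A i j))"
    by (rule sum.cong[OF refl])
      (simp add: sum_distrib_left sum_distrib_right mult.assoc, rule sum.swap)
  also have "\<dots> = 0"
    using N by (simp add: row if_distrib cong: if_cong)
  finally have 1: "(\<Sum>i<n. \<Sum>j<n. (\<Sum>k<n. N i k * A $$ (k, j)) * cofactor A i j) = 0" .
  have "(\<Sum>i<n. \<Sum>j<n. (\<Sum>k<n. N j k * A $$ (i, k)) * cofactor A i j) =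
      (\<Sum>j<n. \<Sum>k<n. N j k * (\<Sum>i<n. A $$ (i, k) * cofactor A i j))"
    by (subst sum.swap, rule sum.cong[OF refl])
      (simp add: sum_distrib_left sum_distrib_right mult.assoc, rule sum.swap)
  also have "\<dots> = 0"
    using N by (simp add: col if_distrib cong: if_cong)
  finally have 2: "(\<Sum>i<n. \<Sum>j<n. (\<Sum>k<n. N j k * A $$ (i, k)) * cofactor A i j) = 0" .
  have "D (det A) = (\<Sum>i<n. \<Sum>j<n. D (A $$ (i, j)) * cofactor A i j)"
    by (rule derivation_det[OF D A])
  also have "\<dots> = (\<Sum>i<n. \<Sum>j<n. ((\<Sum>k<n. N i k * A $$ (k, j)) + (\<Sum>k<n. N j k * A $$ (i, k))) * cofactor A i j)"
    by (intro sum.cong refl) (simp add: DA)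
  finally show ?thesis using 1 2 by (simp add: distrib_right sum.distrib)
qed

section \<open>Arithmetic of polynomials in Horner form\<close>

text \<open>
  \<open>Horn p q\<close> stands for \<open>p + t * q\<close>, where \<open>t\<close> is the first variable, \<open>q\<close> is a polynomial in the same
  variables and \<open>p\<close> one in the remaining variables. Terms with a common initial part share it, which saves
  rewriting steps in comparison with lists of monomials. A constant may stand for a polynomial at any level, so zero can always be written as \<open>Coef 0\<close>.
\<close>

datatype hpoly = Coef int | Horn hpoly hpoly

fun horn :: "hpoly \<Rightarrow> hpoly \<Rightarrow> hpoly" where
  "horn (Coef c) (Coef d) = (if d = 0 then Coef c else Horn (Coef c) (Coef d))"
| "horn (Coef c) (Horn r s) = Horn (Coef c) (Horn r s)"
| "horn (Horn p q) r = Horn (Horn p q) r"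

fun h_add :: "hpoly \<Rightarrow> hpoly \<Rightarrow> hpoly" where
  "h_add (Coef c) (Coef d) = Coef (c + d)"
| "h_add (Coef c) (Horn p q) = Horn (h_add (Coef c) p) q"
| "h_add (Horn p q) (Coef c) = Horn (h_add p (Coef c)) q"
| "h_add (Horn p q) (Horn r s) = horn (h_add p r) (h_add q s)"

fun h_smult :: "int \<Rightarrow> hpoly \<Rightarrow> hpoly" where
  "h_smult c (Coef d) = Coef (c * d)"
| "h_smult c (Horn p q) = Horn (h_smult c p) (h_smult c q)"

definition h_scale :: "int \<Rightarrow> hpoly \<Rightarrow> hpoly" where
  "h_scale c p = (if c = 0 then Coef 0 else h_smult c p)"

definition h_minus :: "hpoly \<Rightarrow> hpoly \<Rightarrow> hpoly" where
  "h_minus p q = h_add p (h_smult (- 1) q)"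

fun h_shift :: "hpoly \<Rightarrow> hpoly" where
  "h_shift (Coef c) = (if c = 0 then Coef 0 else Horn (Coef 0) (Coef c))"
| "h_shift (Horn p q) = Horn (Coef 0) (Horn p q)"

fun h_map :: "(hpoly \<Rightarrow> hpoly) \<Rightarrow> hpoly \<Rightarrow> hpoly" where
  "h_map f (Coef c) = horn (f (Coef c)) (Coef 0)"
| "h_map f (Horn p q) = horn (f p) (h_map f q)"

function (sequential) h_mul :: "hpoly \<Rightarrow> hpoly \<Rightarrow> hpoly" where
  "h_mul (Coef c) r = h_scale c r"
| "h_mul (Horn p q) (Coef d) = h_scale d (Horn p q)"
| "h_mul (Horn p q) (Horn r s) = h_add (h_map (h_mul p) (Horn r s)) (h_shift (h_mul q (Horn r s)))"
  by pat_completeness auto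
termination by (relation "measure (size \<circ> fst)") auto

fun h_lift :: "nat \<Rightarrow> hpoly \<Rightarrow> hpoly" where
  "h_lift 0 p = p"
| "h_lift (Suc n) p = horn (h_lift n p) (Coef 0)"

fun h_mul_var :: "nat \<Rightarrow> hpoly \<Rightarrow> hpoly" where
  "h_mul_var 0 p = h_shift p"
| "h_mul_var (Suc i) (Coef c) = horn (h_mul_var i (Coef c)) (Coef 0)"
| "h_mul_var (Suc i) (Horn p q) = horn (h_mul_var i p) (h_mul_var (Suc i) q)"

fun h_mul_var_pow :: "nat \<Rightarrow> nat \<Rightarrow> hpoly \<Rightarrow> hpoly" where
  "h_mul_var_pow i 0 p = p"
| "h_mul_var_pow i (Suc n) p = h_mul_var i (h_mul_var_pow i n p)"

fun h_deriv :: "nat \<Rightarrow> hpoly \<Rightarrow> hpoly" where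
  "h_deriv i (Coef c) = Coef 0"
| "h_deriv 0 (Horn p q) = h_add q (h_shift (h_deriv 0 q))"
| "h_deriv (Suc i) (Horn p q) = horn (h_deriv i p) (h_deriv (Suc i) q)"

fun h_coeff :: "nat list \<Rightarrow> hpoly \<Rightarrow> hpoly" where
  "h_coeff [] p = p"
| "h_coeff (0 # es) (Coef c) = h_coeff es (Coef c)"
| "h_coeff (Suc e # es) (Coef c) = Coef 0"
| "h_coeff (0 # es) (Horn p q) = h_coeff es p"
| "h_coeff (Suc e # es) (Horn p q) = h_coeff (e # es) q"

fun h_dvd :: "int \<Rightarrow> hpoly \<Rightarrow> bool" where
  "h_dvd n (Coef c) = (c mod n = 0)"
| "h_dvd n (Horn p q) = (h_dvd n p \<and> h_dvd n q)"

fun h_div :: "int \<Rightarrow> hpoly \<Rightarrow> hpoly" where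
  "h_div n (Coef c) = Coef (c div n)"
| "h_div n (Horn p q) = Horn (h_div n p) (h_div n q)"

text \<open>
  The polynomials \<open>ps\<close> replace the first variables; the others, starting with number \<open>n\<close>, are kept.
\<close>

fun h_subst :: "hpoly list \<Rightarrow> nat \<Rightarrow> hpoly \<Rightarrow> hpoly" where
  "h_subst ps n (Coef c) = Coef c"
| "h_subst [] n (Horn p q) = h_lift n (Horn p q)"
| "h_subst (r # ps) n (Horn p q) = h_add (h_subst ps n p) (h_mul r (h_subst (r # ps) n q))"

text \<open>
  \<open>Cross i j k l\<close> is the operator \<open>t_i \<partial>/\<partial>t_j - t_k \<partial>/\<partial>t_l\<close>. A datatype of operators instead of
  functions keeps the evaluation by rewriting first-order.
\<close>

datatype hop = Ident | Deriv nat | Cross nat nat nat nat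

fun h_apply :: "hop \<Rightarrow> hpoly \<Rightarrow> hpoly" where
  "h_apply Ident p = p"
| "h_apply (Deriv i) p = h_deriv i p"
| "h_apply (Cross i j k l) p = h_minus (h_mul_var i (h_deriv j p)) (h_mul_var k (h_deriv l p))"

text \<open>
  Horner's scheme with operators: the list gives the operators for the first \<open>n\<close> variables of
  the polynomial, and the variables from number \<open>n\<close> on act by multiplication.
\<close>

fun h_op :: "hop list \<Rightarrow> nat \<Rightarrow> hpoly \<Rightarrow> hpoly \<Rightarrow> hpoly" where
  "h_op Ls n (Coef c) f = h_scale c f"
| "h_op [] n (Horn p q) f = h_mul (h_lift n (Horn p q)) f"
| "h_op (L # Ls) n (Horn p q) f = h_add (h_op Ls n p f) (h_apply L (h_op (L # Ls) n q f))"

definition h_J4 :: "hpoly \<Rightarrow> hpoly \<Rightarrow> hpoly" where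
  "h_J4 p q = h_op [Cross 5 1 4 2, Cross 3 2 5 0, Cross 4 0 3 1, Ident, Ident, Ident] 6 p q"

definition h_D_uvw :: "hpoly \<Rightarrow> hpoly \<Rightarrow> hpoly" where
  "h_D_uvw p q = h_op [Ident, Ident, Ident, Deriv 0, Deriv 1, Deriv 2] 6 p q"

definition h_D_xyz :: "hpoly \<Rightarrow> hpoly \<Rightarrow> hpoly" where
  "h_D_xyz p q = h_op [Deriv 3, Deriv 4, Deriv 5, Ident, Ident, Ident] 6 p q"

fun h_monom :: "nat \<times> nat \<times> nat \<Rightarrow> hpoly" where
  "h_monom (i, j, k) = h_mul_var_pow 0 i (h_mul_var_pow 1 j (h_mul_var_pow 2 k (Coef 1)))"

fun multinom :: "nat \<times> nat \<times> nat \<Rightarrow> int" where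
  "multinom (i, j, k) = 24 div (fact i * fact j * fact k)"

text \<open>
  The multinomial coefficients are split off so that all covariants on the slice have
  integral coefficients.
\<close>

fun h_quartic :: "nat \<Rightarrow> (nat \<times> nat \<times> nat) list \<Rightarrow> hpoly" where
  "h_quartic t [] = Coef 0"
| "h_quartic t (m # ms) = h_add (h_smult (multinom m) (h_mul_var t (h_monom m))) (h_quartic (Suc t) ms)"

definition h_line :: "hpoly \<Rightarrow> hpoly" where
  "h_line q = h_subst [h_mul_var 5 (h_mul_var 0 (Coef 1)), h_mul_var 5 (h_mul_var 1 (Coef 1)),
     h_add (h_mul_var 3 (h_mul_var 0 (Coef (- 1)))) (h_mul_var 4 (h_mul_var 1 (Coef (- 1)))),
     h_mul_var 3 (Coef 1), h_mul_var 4 (Coef 1), h_mul_var 5 (Coef 1)] 6 q"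

text \<open>
  The Hankel determinant \<open>ace + 2bcd - ad^2 - b^2e - c^3\<close> of a binary quartic with coefficients
  \<open>a\<close>, \<open>4b\<close>, \<open>6c\<close>, \<open>4d\<close>, \<open>e\<close>.
\<close>

definition h_catalecticant :: "hpoly \<Rightarrow> hpoly \<Rightarrow> hpoly \<Rightarrow> hpoly \<Rightarrow> hpoly \<Rightarrow> hpoly" where
  "h_catalecticant a b c d e =
     h_minus (h_add (h_mul c (h_minus (h_mul a e) (h_mul c c))) (h_mul d (h_smult 2 (h_mul b c))))
       (h_add (h_mul d (h_mul a d)) (h_mul b (h_mul b e)))"

fun h_unmul_var :: "nat \<Rightarrow> hpoly \<Rightarrow> hpoly" where
  "h_unmul_var i (Coef c) = Coef 0"
| "h_unmul_var 0 (Horn p q) = q"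
| "h_unmul_var (Suc i) (Horn p q) = horn (h_unmul_var i p) (h_unmul_var (Suc i) q)"

definition h_divide_w6 :: "hpoly \<Rightarrow> hpoly" where
  "h_divide_w6 p = h_unmul_var 2 (h_unmul_var 2 (h_unmul_var 2 (h_unmul_var 2 (h_unmul_var 2 (h_unmul_var 2 p)))))"

definition h_binary :: "hpoly \<Rightarrow> hpoly \<Rightarrow> hpoly \<Rightarrow> hpoly \<Rightarrow> hpoly \<Rightarrow> hpoly" where
  "h_binary a b c d e =
     h_add (h_mul_var_pow 0 4 (h_lift 3 a)) (h_add (h_mul_var_pow 0 3 (h_mul_var 1 (h_smult 4 (h_lift 3 b))))
     (h_add (h_mul_var_pow 0 2 (h_mul_var_pow 1 2 (h_smult 6 (h_lift 3 c))))
     (h_add (h_mul_var 0 (h_mul_var_pow 1 3 (h_smult 4 (h_lift 3 d)))) (h_mul_var_pow 1 4 (h_lift 3 e)))))"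


text \<open>
  Setting the first \<open>n\<close> variables to zero.
\<close>

fun h_at_0 :: "nat \<Rightarrow> hpoly \<Rightarrow> hpoly" where
  "h_at_0 0 p = p"
| "h_at_0 (Suc n) (Coef c) = Coef c"
| "h_at_0 (Suc n) (Horn p q) = h_at_0 n p"

text \<open>
  The derivation that sends variable number \<open>i\<close> to a multiple of another variable, as listed by
  \<open>ims\<close> in the form of factor and number.
\<close>

fun h_along :: "nat \<Rightarrow> (int \<times> nat) list \<Rightarrow> hpoly \<Rightarrow> hpoly" where
  "h_along i [] p = Coef 0"
| "h_along i ((c, k) # ims) p = h_add (h_scale c (h_mul_var k (h_deriv i p))) (h_along (Suc i) ims p)"

section \<open>Values of polynomials in Horner form\<close>

primrec heval :: "hpoly \<Rightarrow> (nat \<Rightarrow> 'a::comm_ring_1) \<Rightarrow> 'a" where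
  "heval (Coef c) g = of_int c"
| "heval (Horn p q) g = heval p (\<lambda>n. g (Suc n)) + g 0 * heval q g"

lemma heval_horn [simp]: "heval (horn p q) g = heval p (\<lambda>n. g (Suc n)) + g 0 * heval q g"
  by (cases "(p, q)" rule: horn.cases) auto

lemma heval_add [simp]: "heval (h_add p q) g = heval p g + heval q g"
  by (induction p q arbitrary: g rule: h_add.induct) (simp_all add: algebra_simps)

lemma heval_smult [simp]: "heval (h_smult c p) g = of_int c * heval p g"
  by (induction p arbitrary: g) (simp_all add: algebra_simps)

lemma heval_scale [simp]: "heval (h_scale c p) g = of_int c * heval p g"
  by (simp add: h_scale_def)

lemma heval_minus [simp]: "heval (h_minus p q) g = heval p g - heval q g"
  by (simp add: h_minus_def)

lemma heval_shift [simp]: "heval (h_shift p) g = g 0 * heval p g"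
  by (cases p) simp_all

lemma heval_map:
  "(\<And>p. heval (f p) (\<lambda>n. g (Suc n)) = c * heval p (\<lambda>n. g (Suc n))) \<Longrightarrow> heval (h_map f p) g = c * heval p g"
  by (induction p) (simp_all add: algebra_simps)

lemma heval_mul [simp]: "heval (h_mul p q) g = heval p g * heval q g"
proof (induction p q arbitrary: g rule: h_mul.induct)
  case (3 p q r s)
  have "heval (h_map (h_mul p) (Horn r s)) g = heval p (\<lambda>n. g (Suc n)) * heval (Horn r s) g"
    by (rule heval_map) (rule "3.IH"(1))
  then show ?case
    using "3.IH"(2)[of g] by (simp add: algebra_simps)
qed (simp_all add: algebra_simps)

lemma heval_lift [simp]: "heval (h_lift n p) g = heval p (\<lambda>k. g (k + n))"
  by (induction n arbitrary: g) simp_all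

lemma heval_mul_var [simp]: "heval (h_mul_var i p) g = g i * heval p g"
  by (induction i p arbitrary: g rule: h_mul_var.induct) (simp_all add: algebra_simps)

lemma heval_mul_var_pow [simp]: "heval (h_mul_var_pow i n p) g = g i ^ n * heval p g"
  by (induction n) (simp_all add: algebra_simps)

lemma heval_div: "h_dvd n p \<Longrightarrow> of_int n * heval (h_div n p) g = heval p g"
proof (induction p arbitrary: g)
  case (Coef c)
  then have "n * (c div n) = c" by auto
  then show ?case by (metis heval.simps(1) h_div.simps(1) of_int_mult)
next
  case (Horn p q)
  then have "of_int n * heval (h_div n p) (\<lambda>k. g (Suc k)) = heval p (\<lambda>k. g (Suc k))"
    "of_int n * heval (h_div n q) g = heval q g" by simp_all
  then show ?case by (simp add: distrib_left mult.left_commute[of _ "g 0"])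
qed

lemma hom_heval: "comm_ring_hom h \<Longrightarrow> h (heval p g) = heval p (\<lambda>n. h (g n))"
proof (induction p arbitrary: g)
  case (Coef c)
  interpret comm_ring_hom h by fact
  show ?case by (simp add: hom_of_int)
next
  case (Horn p q)
  interpret comm_ring_hom h by fact
  show ?case using Horn by (simp add: hom_add hom_mult)
qed

text \<open>
  The chain rule.
\<close>

lemma derivation_heval:
  assumes D: "derivation D" and zero: "\<And>i. i \<ge> n \<Longrightarrow> D (g i) = 0"
  shows "D (heval p g) = (\<Sum>i<n. D (g i) * heval (h_deriv i p) g)"
  using zero
proof (induction p arbitrary: g n)
  case (Coef c)
  then show ?case by (simp add: derivation_of_int[OF D])
next
  case (Horn p q)
  show ?case
  proof (cases n)
    case 0
    then have "D (heval p (\<lambda>k. g (Suc k))) = 0" "D (heval q g) = 0" "D (g 0) = 0"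
      using Horn.IH(1)[of 0 "\<lambda>k. g (Suc k)"] Horn.IH(2)[of 0 g] Horn.prems by simp_all
    then show ?thesis using 0 by (simp add: derivation_add[OF D] derivation_mult[OF D])
  next
    case (Suc m)
    have "D (heval p (\<lambda>k. g (Suc k))) = (\<Sum>i<m. D (g (Suc i)) * heval (h_deriv i p) (\<lambda>k. g (Suc k)))"
      using Horn.IH(1)[of m "\<lambda>k. g (Suc k)"] Horn.prems Suc by simp
    moreover have "D (heval q g) = D (g 0) * heval (h_deriv 0 q) g + (\<Sum>i<m. D (g (Suc i)) * heval (h_deriv (Suc i) q) g)"
      using Horn.IH(2)[of n g] Horn.prems Suc by (simp add: sum.lessThan_Suc_shift del: sum.lessThan_Suc)
    ultimately show ?thesis
      by (simp add: Suc sum.lessThan_Suc_shift derivation_add[OF D] derivation_mult[OF D]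
          algebra_simps sum.distrib sum_distrib_left del: sum.lessThan_Suc)
  qed
qed

lemma derivation_heval_deriv:
  assumes D: "derivation D" and "\<And>k. D (g k) = (if k = i then 1 else 0)"
  shows "D (heval p g) = heval (h_deriv i p) g"
  by (subst derivation_heval[OF D, where n = "Suc i"]) (simp_all add: assms(2))

lemma heval_along:
  assumes D: "derivation D"
    and ims: "\<And>i. i < length ims \<Longrightarrow> D (g i) = of_int (fst (ims ! i)) * g (snd (ims ! i))"
    and zero: "\<And>i. i \<ge> length ims \<Longrightarrow> D (g i) = 0"
  shows "D (heval p g) = heval (h_along 0 ims p) g"
proof -
  have along: "heval (h_along k js p) g = (\<Sum>i<length js. of_int (fst (js ! i)) * g (snd (js ! i)) * heval (h_deriv (k + i) p) g)" for k js
  proof (induction k js p rule: h_along.induct)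
    case (2 k c j js p)
    then show ?case
      by (simp add: sum.lessThan_Suc_shift mult.assoc del: sum.lessThan_Suc)
  qed simp
  show ?thesis
    by (simp add: along derivation_heval[OF D zero] ims)
qed

lemma heval_at_0:
  "(\<And>i. i < n \<Longrightarrow> g i = 0) \<Longrightarrow> heval (h_at_0 n p) (\<lambda>k. g (k + n)) = heval p g"
proof (induction n p arbitrary: g rule: h_at_0.induct)
  case (3 n p q)
  then show ?case using "3.IH"[of "\<lambda>k. g (Suc k)"] "3.prems"[of 0] "3.prems"[of "Suc _"] by simp
qed simp_all

lemma heval_subst:
  assumes "length ps = n" "m \<le> n" "\<And>i. i < n \<Longrightarrow> G i = heval (ps ! i) g" "\<And>i. i \<ge> n \<Longrightarrow> G i = g i"
  shows "heval (h_subst (drop m ps) n p) g = heval p (\<lambda>k. G (k + m))"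
  using assms(2)
proof (induction p arbitrary: m)
  case (Horn p q)
  show ?case
  proof (cases "m = n")
    case True
    then show ?thesis using assms(1,4) by simp
  next
    case False
    then have "drop m ps = ps ! m # drop (Suc m) ps"
      using Horn.prems assms(1) by (simp add: Cons_nth_drop_Suc)
    then show ?thesis
      using False Horn.IH(1)[of "Suc m"] Horn.IH(2)[of m] Horn.prems assms(3)[of m] by simp
  qed
qed simp

text \<open>
  The function \<open>F\<close> will be the application of operator polynomials to the fixed form with value
  \<open>heval f g\<close>.
\<close>

lemma heval_op:
  assumes "length Ls = n" "m \<le> n"
    and add: "\<And>p q. F (p + q) = F p + F q"
    and of_int: "\<And>c. F (of_int c) = of_int c * heval f g"
    and low: "\<And>i p. i < n \<Longrightarrow> F (g i * p) = A i (F p)" "\<And>i p. i < n \<Longrightarrow> heval (h_apply (Ls ! i) p) g = A i (heval p g)"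
    and high: "\<And>i p. i \<ge> n \<Longrightarrow> F (g i * p) = g i * F p"
  shows "heval (h_op (drop m Ls) n p f) g = F (heval p (\<lambda>k. g (k + m)))"
  using assms(2)
proof (induction p arbitrary: m)
  case (Coef c)
  show ?case by (simp add: of_int)
next
  case (Horn p q)
  show ?case
  proof (cases "m = n")
    case True
    have "F (heval r (\<lambda>k. g (k + j))) = heval r (\<lambda>k. g (k + j)) * heval f g" if "j \<ge> n" for r j
      using that
    proof (induction r arbitrary: j)
      case (Horn r s)
      then show ?case using Horn.IH(1)[of "Suc j"] Horn.IH(2)[of j]
        by (simp add: add high distrib_right mult.assoc)
    qed (simp add: of_int)
    from this[of n "Horn p q"] show ?thesis using True assms(1) by simp
  next
    case False
    then have "drop m Ls = Ls ! m # drop (Suc m) Ls"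
      using Horn.prems assms(1) by (simp add: Cons_nth_drop_Suc)
    then show ?thesis
      using False Horn.IH(1)[of "Suc m"] Horn.IH(2)[of m] Horn.prems low by (simp add: add)
  qed
qed

section \<open>Forms as values of polynomials in Horner form\<close>

text \<open>
  The coefficient of the quartic divided by its multinomial coefficient.
\<close>

definition scaled_coef :: "nat \<times> nat \<times> nat \<Rightarrow> coef" where
  "scaled_coef m = Const (1 / of_int (multinom m)) * Var m"

definition coef_gens :: "(nat \<times> nat \<times> nat) list \<Rightarrow> nat \<Rightarrow> coef" where
  "coef_gens ms i = (if i < length ms then scaled_coef (ms ! i) else 0)"

text \<open>
  The values of the variables of a Horner polynomial: the six variables of forms, followed by the
  scaled coefficients for the monomials in \<open>ms\<close>.
\<close>

definition gens :: "(nat \<times> nat \<times> nat) list \<Rightarrow> nat \<Rightarrow> form" where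
  "gens ms i = (if i < 6 then Var ([X, Y, Z, U, V, W] ! i) else Const (coef_gens ms (i - 6)))"

lemma gens_Var: "gens ms 0 = Var X" "gens ms 1 = Var Y" "gens ms 2 = Var Z"
  "gens ms 3 = Var U" "gens ms 4 = Var V" "gens ms 5 = Var W"
  by (simp_all add: gens_def)

lemma less_6: "i < 6 \<longleftrightarrow> i \<in> {0, 1, 2, 3, 4, 5 :: nat}"
  by auto

lemma pderiv_at_heval:
  "i < 6 \<Longrightarrow> pderiv_at ([X, Y, Z, U, V, W] ! i) (heval p (gens ms)) = heval (h_deriv i p) (gens ms)"
  by (rule derivation_heval_deriv[OF derivation_pderiv_at])
    (auto simp: gens_def pderiv_at_Var nth_eq_iff_index_eq)

lemmas pderiv_heval = pderiv_at_heval[of 0, simplified] pderiv_at_heval[of 1, simplified]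
  pderiv_at_heval[of 2, simplified] pderiv_at_heval[of 3, simplified]
  pderiv_at_heval[of 4, simplified] pderiv_at_heval[of 5, simplified]

lemma of_int_eq_Const: "of_int c = Const (of_int c)"
  by (simp add: Const_def)

context commuting_operators
begin

lemma heval_Op:
  assumes "length Ls = 6"
    and Ls: "\<And>i p. i < 6 \<Longrightarrow> heval (h_apply (Ls ! i) p) (gens ms) = L ([X, Y, Z, U, V, W] ! i) (heval p (gens ms))"
  shows "Op (heval p (gens ms)) (heval f (gens ms)) = heval (h_op Ls 6 p f) (gens ms)"
proof -
  have "heval (h_op (drop 0 Ls) 6 p f) (gens ms) = Op (heval p (\<lambda>k. gens ms (k + 0))) (heval f (gens ms))"
  proof (rule heval_op[OF assms(1), where A = "\<lambda>i. L ([X, Y, Z, U, V, W] ! i)"])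
    show "Op (of_int c) (heval f (gens ms)) = of_int c * heval f (gens ms)" for c
      by (simp only: of_int_eq_Const Op_Const)
    show "i < 6 \<Longrightarrow> Op (gens ms i * p) (heval f (gens ms)) = L ([X, Y, Z, U, V, W] ! i) (Op p (heval f (gens ms)))" for i p
      by (simp add: gens_def Op_Var_mult)
    show "6 \<le> i \<Longrightarrow> Op (gens ms i * p) (heval f (gens ms)) = gens ms i * Op p (heval f (gens ms))" for i p
      by (simp add: gens_def Op_Const_mult)
  qed (simp_all add: Op_add Ls)
  then show ?thesis by simp
qed

end

lemma heval_J4: "J4 (heval p (gens ms)) (heval q (gens ms)) = heval (h_J4 p q) (gens ms)"
  unfolding J4_eq h_J4_def
  by (rule cross.heval_Op) (auto simp: less_6 pderiv_heval gens_Var)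

lemma heval_D_uvw: "D_uvw (heval p (gens ms)) (heval q (gens ms)) = heval (h_D_uvw p q) (gens ms)"
  unfolding D_uvw_eq h_D_uvw_def
  by (rule uvw.heval_Op) (auto simp: less_6 pderiv_heval gens_Var)

lemma heval_D_xyz: "D_xyz (heval p (gens ms)) (heval q (gens ms)) = heval (h_D_xyz p q) (gens ms)"
  unfolding D_xyz_eq h_D_xyz_def
  by (rule xyz.heval_Op) (auto simp: less_6 pderiv_heval gens_Var)

lemma const_term_mult: "const_term (p * q) = const_term p * const_term q"
  for p :: "('v, 'r::comm_ring_1) mpoly"
proof (induction p rule: mpoly_induct)
  case (Const c)
  show ?case by (simp add: const_term_def lookup_Const_mult lookup_Const)
next
  case (Var_mult v p)
  then show ?case by (simp add: const_term_def mult.assoc lookup_Var_mult)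
qed (simp add: const_term_def lookup_add distrib_right)

lemma comm_ring_hom_const_term: "comm_ring_hom (const_term :: ('v, 'r::comm_ring_1) mpoly \<Rightarrow> 'r)"
  by unfold_locales (simp_all add: const_term_mult, simp_all add: const_term_def lookup_add lookup_one)

lemma const_term_heval: "const_term (heval p (gens ms)) = heval (h_at_0 6 p) (coef_gens ms)"
proof -
  have "const_term (gens ms k) = (if k < 6 then 0 else coef_gens ms (k - 6))" for k
    using single_1_add_neq_0[of "[X, Y, Z, U, V, W] ! k" 0]
    by (auto simp: gens_def const_term_def lookup_Const Var_def lookup_single when_def)
  then have "const_term (heval p (gens ms)) = heval p (\<lambda>k. if k < 6 then 0 else coef_gens ms (k - 6))"
    by (simp add: hom_heval[OF comm_ring_hom_const_term])
  also have "\<dots> = heval (h_at_0 6 p) (coef_gens ms)"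
    by (subst heval_at_0[of 6, symmetric]) simp_all
  finally show ?thesis .
qed

lemma heval_monom: "heval (h_monom m) (gens ms) = xyz_monom m"
  by (cases m) (simp add: xyz_monom_def gens_Var mult.assoc)

lemma heval_quartic:
  assumes "\<And>m. m \<in> set ms \<Longrightarrow> multinom m \<noteq> 0"
  shows "heval (h_quartic 6 ms) (gens ms) = (\<Sum>m\<leftarrow>ms. Const (Var m) * xyz_monom m)"
proof -
  have "heval (h_quartic t ks) (gens ms) = (\<Sum>m\<leftarrow>ks. Const (Var m) * xyz_monom m)"
    if "\<And>i. i < length ks \<Longrightarrow> gens ms (t + i) = Const (scaled_coef (ks ! i))"
      "\<And>m. m \<in> set ks \<Longrightarrow> multinom m \<noteq> 0" for ks t
    using that
  proof (induction t ks rule: h_quartic.induct)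
    case (2 t m ks)
    have "of_int (multinom m) * (Const (scaled_coef m) * xyz_monom m) =
        Const (of_int (multinom m) * scaled_coef m) * xyz_monom m"
      by (simp add: of_int_eq_Const Const_mult mult.assoc)
    also have "of_int (multinom m) * scaled_coef m = Const (of_int (multinom m) * (1 / of_int (multinom m))) * Var m"
      by (simp only: scaled_coef_def of_int_eq_Const Const_mult mult.assoc)
    also have "\<dots> = Var m"
      using "2.prems"(2)[of m] by simp
    finally have "of_int (multinom m) * (gens ms t * xyz_monom m) = Const (Var m) * xyz_monom m"
      using "2.prems"(1)[of 0] by simp
    moreover have "gens ms (Suc t + i) = Const (scaled_coef (ks ! i))" if "i < length ks" for i
      using "2.prems"(1)[of "Suc i"] that by simp
    ultimately show ?case
      using "2.IH" "2.prems"(2) by (simp add: heval_monom)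
  qed simp
  from this[of ms 6] show ?thesis
    using assms by (simp add: gens_def coef_gens_def)
qed

section \<open>The contravariant psi\<close>

text \<open>
  The property that the definition of \<open>psi\<close> requires of its value.
\<close>

definition is_psi :: "form \<Rightarrow> form \<Rightarrow> bool" where
  "is_psi q s \<longleftrightarrow> (\<exists>a b c d e.
     vars a \<union> vars b \<union> vars c \<union> vars d \<union> vars e \<subseteq> {U, V, W} \<and>
     line_section q = a * Var X ^ 4 + 4 * b * Var X ^ 3 * Var Y + 6 * c * Var X ^ 2 * Var Y ^ 2
                      + 4 * d * Var X * Var Y ^ 3 + e * Var Y ^ 4 \<and>
     Var W ^ 6 * s = a * c * e + 2 * b * c * d - a * d ^ 2 - b ^ 2 * e - c ^ 3)"

lemma Var_mult_cancel: "Var v * p = Var v * q \<Longrightarrow> p = q"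
  for p :: "('v, 'r::comm_ring_1) mpoly"
  by (metis lookup_Var_mult_add poly_mapping_eqI)

lemma Var_power_mult_cancel: "Var v ^ n * p = Var v ^ n * q \<Longrightarrow> p = q"
  for p :: "('v, 'r::comm_ring_1) mpoly"
  by (induction n) (auto simp: mult.assoc dest: Var_mult_cancel)

lemma Const_Const_24: "Const (Const (1 / 24)) * 24 = (1 :: form)"
proof -
  have "(24 :: form) = Const (Const 24)"
    unfolding Const_def single_numeral ..
  then have "Const (Const (1 / 24)) * 24 = (Const (Const (1 / 24 * 24)) :: form)"
    by (simp only: Const_mult)
  then show ?thesis by simp
qed

lemma form_24_cancel:
  fixes p q :: form
  assumes "24 * p = 24 * q"
  shows "p = q"
proof -
  have "Const (Const (1 / 24)) * (24 * p) = p" for p :: form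
    unfolding mult.assoc[symmetric] Const_Const_24 by (rule mult_1_left)
  from this[of p] this[of q] show ?thesis unfolding assms by (rule trans[OF sym])
qed

text \<open>
  The coefficients are recovered as fourth derivatives, each with the factor 24. This makes them
  unique, and with them \<open>psi\<close>, since \<open>w\<close> is not a zero divisor.
\<close>

lemma binary_quartic_coeffs:
  assumes vars: "vars a \<union> vars b \<union> vars c \<union> vars d \<union> vars e \<subseteq> {U, V, W}"
    and l: "l = a * Var X ^ 4 + 4 * b * Var X ^ 3 * Var Y + 6 * c * Var X ^ 2 * Var Y ^ 2
                + 4 * d * Var X * Var Y ^ 3 + e * Var Y ^ 4"
  shows "24 * a = pderiv_at X (pderiv_at X (pderiv_at X (pderiv_at X l)))"
    "24 * b = pderiv_at X (pderiv_at X (pderiv_at X (pderiv_at Y l)))"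
    "24 * c = pderiv_at X (pderiv_at X (pderiv_at Y (pderiv_at Y l)))"
    "24 * d = pderiv_at X (pderiv_at Y (pderiv_at Y (pderiv_at Y l)))"
    "24 * e = pderiv_at Y (pderiv_at Y (pderiv_at Y (pderiv_at Y l)))"
proof -
  have 0: "pderiv_at v f = 0" if "f \<in> {a, b, c, d, e}" "v \<in> {X, Y}" for f v
    using that vars by (intro pderiv_at_eq_0) auto
  note rules = derivation_add[OF derivation_pderiv_at] derivation_mult[OF derivation_pderiv_at]
    derivation_power[OF derivation_pderiv_at] derivation_numeral[OF derivation_pderiv_at]
    derivation_1[OF derivation_pderiv_at] derivation_0[OF derivation_pderiv_at] pderiv_at_Var
  show "24 * a = pderiv_at X (pderiv_at X (pderiv_at X (pderiv_at X l)))"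
    "24 * b = pderiv_at X (pderiv_at X (pderiv_at X (pderiv_at Y l)))"
    "24 * c = pderiv_at X (pderiv_at X (pderiv_at Y (pderiv_at Y l)))"
    "24 * d = pderiv_at X (pderiv_at Y (pderiv_at Y (pderiv_at Y l)))"
    "24 * e = pderiv_at Y (pderiv_at Y (pderiv_at Y (pderiv_at Y l)))"
    unfolding l by (simp_all add: rules 0)
qed

lemma is_psi_unique:
  assumes "is_psi q s" "is_psi q s'"
  shows "s = s'"
proof -
  obtain a b c d e where 1: "vars a \<union> vars b \<union> vars c \<union> vars d \<union> vars e \<subseteq> {U, V, W}"
      "line_section q = a * Var X ^ 4 + 4 * b * Var X ^ 3 * Var Y + 6 * c * Var X ^ 2 * Var Y ^ 2
        + 4 * d * Var X * Var Y ^ 3 + e * Var Y ^ 4"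
      "Var W ^ 6 * s = a * c * e + 2 * b * c * d - a * d ^ 2 - b ^ 2 * e - c ^ 3"
    using assms(1) unfolding is_psi_def by blast
  obtain a' b' c' d' e' where 2: "vars a' \<union> vars b' \<union> vars c' \<union> vars d' \<union> vars e' \<subseteq> {U, V, W}"
      "line_section q = a' * Var X ^ 4 + 4 * b' * Var X ^ 3 * Var Y + 6 * c' * Var X ^ 2 * Var Y ^ 2
        + 4 * d' * Var X * Var Y ^ 3 + e' * Var Y ^ 4"
      "Var W ^ 6 * s' = a' * c' * e' + 2 * b' * c' * d' - a' * d' ^ 2 - b' ^ 2 * e' - c' ^ 3"
    using assms(2) unfolding is_psi_def by blast
  have "24 * a = 24 * a'" "24 * b = 24 * b'" "24 * c = 24 * c'" "24 * d = 24 * d'" "24 * e = 24 * e'"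
    unfolding binary_quartic_coeffs[OF 1(1,2)] binary_quartic_coeffs[OF 2(1,2)] by (rule refl)+
  then have "a = a'" "b = b'" "c = c'" "d = d'" "e = e'"
    by (auto dest: form_24_cancel)
  then have "Var W ^ 6 * s = Var W ^ 6 * s'"
    unfolding 1(3) 2(3) by simp
  then show ?thesis by (rule Var_power_mult_cancel)
qed

lemma psi_eq: "is_psi q s \<Longrightarrow> psi q = s"
  unfolding psi_def is_psi_def[symmetric] by (rule the_equality) (auto dest: is_psi_unique)

lemma vars_heval: "(\<And>i. vars (g i) \<subseteq> N) \<Longrightarrow> vars (heval p g) \<subseteq> N"
  for g :: "nat \<Rightarrow> ('v, 'r::comm_ring_1) mpoly"
proof (induction p arbitrary: g)
  case (Coef c)
  have "vars (of_int c :: ('v, 'r) mpoly) \<subseteq> N"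
    by (subst of_int_eq_Const) simp
  then show ?case by simp
qed (simp add: vars_add vars_mult)

lemma vars_heval_lift_3: "vars (heval (h_lift 3 p) (gens ms)) \<subseteq> {U, V, W}"
proof -
  have "vars (gens ms (i + 3)) \<subseteq> {U, V, W}" for i
  proof (cases "i < 3")
    case True
    then have "i \<in> {0, 1, 2}" by auto
    then show ?thesis by (auto simp: gens_def)
  qed (simp add: gens_def)
  then show ?thesis by (simp add: vars_heval)
qed

lemma heval_line: "line_section (heval p (gens ms)) = heval (h_line p) (gens ms)"
proof -
  let ?s = "Var(X := Var W * Var X, Y := Var W * Var Y, Z := - (Var U * Var X + Var V * Var Y)) :: var \<Rightarrow> form"
  let ?ps = "[h_mul_var 5 (h_mul_var 0 (Coef 1)), h_mul_var 5 (h_mul_var 1 (Coef 1)),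
     h_add (h_mul_var 3 (h_mul_var 0 (Coef (- 1)))) (h_mul_var 4 (h_mul_var 1 (Coef (- 1)))),
     h_mul_var 3 (Coef 1), h_mul_var 4 (Coef 1), h_mul_var 5 (Coef 1)]"
  have "heval (h_subst (drop 0 ?ps) 6 p) (gens ms) = heval p (\<lambda>k. subst ?s (gens ms (k + 0)))"
  proof (rule heval_subst)
    show "i < 6 \<Longrightarrow> subst ?s (gens ms i) = heval (?ps ! i) (gens ms)" for i
      by (auto simp: less_6 gens_Var algebra_simps)
    show "6 \<le> i \<Longrightarrow> subst ?s (gens ms i) = gens ms i" for i
      by (simp add: gens_def)
  qed simp_all
  then show ?thesis
    by (simp add: line_section_def h_line_def hom_heval[OF comm_ring_hom_subst])
qed

definition "h_line_a l = h_coeff [4, 0, 0] l"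
definition "h_line_b l = h_div 4 (h_coeff [3, 1, 0] l)"
definition "h_line_c l = h_div 6 (h_coeff [2, 2, 0] l)"
definition "h_line_d l = h_div 4 (h_coeff [1, 3, 0] l)"
definition "h_line_e l = h_coeff [0, 4, 0] l"

definition h_psi_uvw :: "hpoly \<Rightarrow> hpoly" where
  "h_psi_uvw l = h_divide_w6 (h_catalecticant (h_line_a l) (h_line_b l) (h_line_c l) (h_line_d l) (h_line_e l))"

definition h_psi :: "hpoly \<Rightarrow> hpoly" where
  "h_psi q = h_lift 3 (h_psi_uvw (h_line q))"

text \<open>
  The first equation identifies the binary quartic on the line, the second says that the
  catalecticant is divisible by \<open>w^6\<close>.
\<close>

definition psi_check :: "hpoly \<Rightarrow> bool" where
  "psi_check l \<longleftrightarrow>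
     h_binary (h_line_a l) (h_line_b l) (h_line_c l) (h_line_d l) (h_line_e l) = l \<and>
     h_mul_var_pow 2 6 (h_psi_uvw l) =
       h_catalecticant (h_line_a l) (h_line_b l) (h_line_c l) (h_line_d l) (h_line_e l)"

lemma is_psi_heval:
  assumes "psi_check (h_line q)"
  shows "is_psi (heval q (gens ms)) (heval (h_psi q) (gens ms))"
proof -
  define l where "l = h_line q"
  define A where "A p = heval (h_lift 3 p) (gens ms)" for p
  have l: "h_binary (h_line_a l) (h_line_b l) (h_line_c l) (h_line_d l) (h_line_e l) = l"
    and s: "h_mul_var_pow 2 6 (h_psi_uvw l) =
       h_catalecticant (h_line_a l) (h_line_b l) (h_line_c l) (h_line_d l) (h_line_e l)"
    using assms by (simp_all add: psi_check_def l_def)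
  have "line_section (heval q (gens ms)) =
      heval (h_binary (h_line_a l) (h_line_b l) (h_line_c l) (h_line_d l) (h_line_e l)) (gens ms)"
    by (simp only: heval_line l l_def[symmetric])
  also have "\<dots> = A (h_line_a l) * Var X ^ 4 + 4 * A (h_line_b l) * Var X ^ 3 * Var Y
      + 6 * A (h_line_c l) * Var X ^ 2 * Var Y ^ 2 + 4 * A (h_line_d l) * Var X * Var Y ^ 3 + A (h_line_e l) * Var Y ^ 4"
    by (simp add: h_binary_def A_def gens_Var mult_ac add_ac)
  finally have 1: "line_section (heval q (gens ms)) = A (h_line_a l) * Var X ^ 4 + 4 * A (h_line_b l) * Var X ^ 3 * Var Y
      + 6 * A (h_line_c l) * Var X ^ 2 * Var Y ^ 2 + 4 * A (h_line_d l) * Var X * Var Y ^ 3 + A (h_line_e l) * Var Y ^ 4" .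
  have W: "gens ms (2 + 3) = Var W" by (simp add: gens_def)
  have "Var W ^ 6 * heval (h_psi q) (gens ms) = heval (h_mul_var_pow 2 6 (h_psi_uvw l)) (\<lambda>k. gens ms (k + 3))"
    unfolding heval_mul_var_pow W by (simp add: h_psi_def l_def)
  also have "\<dots> = A (h_line_a l) * A (h_line_c l) * A (h_line_e l) + 2 * A (h_line_b l) * A (h_line_c l) * A (h_line_d l)
      - A (h_line_a l) * A (h_line_d l) ^ 2 - A (h_line_b l) ^ 2 * A (h_line_e l) - A (h_line_c l) ^ 3"
    unfolding s by (simp add: h_catalecticant_def A_def algebra_simps power2_eq_square power3_eq_cube)
  finally have 2: "Var W ^ 6 * heval (h_psi q) (gens ms) =
      A (h_line_a l) * A (h_line_c l) * A (h_line_e l) + 2 * A (h_line_b l) * A (h_line_c l) * A (h_line_d l)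
      - A (h_line_a l) * A (h_line_d l) ^ 2 - A (h_line_b l) ^ 2 * A (h_line_e l) - A (h_line_c l) ^ 3" .
  have "vars (A p) \<subseteq> {U, V, W}" for p
    unfolding A_def by (rule vars_heval_lift_3)
  then show ?thesis
    unfolding is_psi_def using 1 2 by (intro exI[of _ "A _"] conjI Un_least) assumption+
qed

lemma coeff_map_subst:
  fixes p :: "('v, 'r::comm_ring_1) mpoly"
  assumes h: "comm_ring_hom h" and s: "\<And>v. coeff_map h (s v) = s v"
  shows "coeff_map h (subst s p) = subst s (coeff_map h p)"
proof -
  interpret h: comm_ring_hom h by fact
  interpret additive_map h by unfold_locales (simp add: h.hom_add)
  interpret H: comm_ring_hom "coeff_map h :: ('v, 'r) mpoly \<Rightarrow> ('v, 'r) mpoly" using h by (rule comm_ring_hom_coeff_map)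
  show ?thesis
    by (induction p rule: mpoly_induct)
      (simp_all add: coeff_map_Const coeff_map_add coeff_map_Var_mult subst_add subst_Var_mult subst_mult s H.hom_mult[of "s _"] del: H.hom_mult)
qed

lemma vars_coeff_map:
  assumes "comm_ring_hom h"
  shows "vars (coeff_map h p) \<subseteq> vars p"
proof -
  interpret h: comm_ring_hom h by fact
  interpret additive_map h by unfold_locales (simp add: h.hom_add)
  have "m \<in> Poly_Mapping.keys p" if "m \<in> Poly_Mapping.keys (coeff_map h p)" for m
    using that by (cases "Poly_Mapping.lookup p m = 0") (simp_all add: in_keys_iff lookup_coeff_map)
  then show ?thesis unfolding vars_def by blast
qed

lemma coeff_map_Var:
  assumes "comm_ring_hom h"
  shows "coeff_map h (Var v) = Var v"
proof -
  interpret h: comm_ring_hom h by fact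
  interpret additive_map h by unfold_locales (simp add: h.hom_add)
  have "coeff_map h (Var v * Const 1) = Var v * Const (h 1)"
    by (simp only: coeff_map_Var_mult coeff_map_Const)
  then show ?thesis by simp
qed

lemma coeff_map_numeral:
  assumes "comm_ring_hom h"
  shows "coeff_map h (numeral n) = (numeral n :: ('v, 'r::comm_ring_1) mpoly)"
proof -
  interpret H: comm_ring_hom "coeff_map h :: ('v, 'r) mpoly \<Rightarrow> ('v, 'r) mpoly"
    using assms by (rule comm_ring_hom_coeff_map)
  show ?thesis by (rule H.hom_numeral)
qed

text \<open>
  Specialising the coefficients preserves the defining property of \<open>psi\<close>; so \<open>psi\<close> commutes with
  specialisation without any inspection of its value.
\<close>

lemma coeff_map_is_psi:
  assumes h: "comm_ring_hom h" and "is_psi q s"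
  shows "is_psi (coeff_map h q) (coeff_map h s)"
proof -
  interpret H: comm_ring_hom "coeff_map h :: form \<Rightarrow> form" using h by (rule comm_ring_hom_coeff_map)
  obtain a b c d e where 1: "vars a \<union> vars b \<union> vars c \<union> vars d \<union> vars e \<subseteq> {U, V, W}"
      "line_section q = a * Var X ^ 4 + 4 * b * Var X ^ 3 * Var Y + 6 * c * Var X ^ 2 * Var Y ^ 2
        + 4 * d * Var X * Var Y ^ 3 + e * Var Y ^ 4"
      "Var W ^ 6 * s = a * c * e + 2 * b * c * d - a * d ^ 2 - b ^ 2 * e - c ^ 3"
    using assms(2) unfolding is_psi_def by blast
  let ?h = "coeff_map h :: form \<Rightarrow> form"
  note hom = H.hom_mult H.hom_add H.hom_minus H.hom_power H.hom_uminus
  note hom = hom coeff_map_Var[OF h] coeff_map_numeral[OF h]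
  have "line_section (?h q) = ?h (line_section q)"
    unfolding line_section_def by (rule coeff_map_subst[OF h, symmetric]) (auto simp: coeff_map_Var[OF h] H.hom_mult H.hom_minus H.hom_uminus)
  then have 2: "line_section (?h q) = ?h a * Var X ^ 4 + 4 * ?h b * Var X ^ 3 * Var Y + 6 * ?h c * Var X ^ 2 * Var Y ^ 2
        + 4 * ?h d * Var X * Var Y ^ 3 + ?h e * Var Y ^ 4"
    unfolding 1(2) by (simp only: hom)
  have "Var W ^ 6 * ?h s = ?h (Var W ^ 6 * s)" by (simp only: hom)
  then have 3: "Var W ^ 6 * ?h s = ?h a * ?h c * ?h e + 2 * ?h b * ?h c * ?h d - ?h a * ?h d ^ 2 - ?h b ^ 2 * ?h e - ?h c ^ 3"
    unfolding 1(3) by (simp only: hom)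
  have "vars (?h a) \<union> vars (?h b) \<union> vars (?h c) \<union> vars (?h d) \<union> vars (?h e) \<subseteq> {U, V, W}"
    using 1(1) vars_coeff_map[OF h, of a] vars_coeff_map[OF h, of b] vars_coeff_map[OF h, of c]
      vars_coeff_map[OF h, of d] vars_coeff_map[OF h, of e] by auto
  then show ?thesis
    unfolding is_psi_def using 2 3
    by (intro exI[of _ "?h a"] exI[of _ "?h b"] exI[of _ "?h c"] exI[of _ "?h d"] exI[of _ "?h e"] conjI)
qed

definition roots :: "(var \<times> var) list" where
  "roots = [(X, Y), (X, Z), (Y, X), (Y, Z), (Z, X), (Z, Y)]"

lemma is_root_iff: "is_root a b \<longleftrightarrow> (a, b) \<in> set roots"
  by (auto simp: is_root_def roots_def)

fun position :: "'a \<Rightarrow> 'a list \<Rightarrow> nat" where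
  "position x [] = 0"
| "position x (y # ys) = (if x = y then 0 else Suc (position x ys))"

lemma nth_position: "x \<in> set xs \<Longrightarrow> position x xs < length xs \<and> xs ! position x xs = x"
  by (induction xs) auto

fun theta_Var_image :: "var \<Rightarrow> var \<Rightarrow> var \<Rightarrow> int \<times> nat" where
  "theta_Var_image a b v = (if v = b then (1, position a [X, Y, Z, U, V, W])
     else if v = dual a then (- 1, position (dual b) [X, Y, Z, U, V, W]) else (0, 0))"

fun theta_coef_image :: "var \<Rightarrow> var \<Rightarrow> nat \<times> nat \<times> nat \<Rightarrow> int \<times> nat" where
  "theta_coef_image a b m = (if expo a m = 0 then (0, 0)
     else (- int (expo a m), 6 + position (raise b (lower a m)) quartic_exps))"

definition theta_images :: "var \<Rightarrow> var \<Rightarrow> (int \<times> nat) list" where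
  "theta_images a b = map (theta_Var_image a b) [X, Y, Z, U, V, W] @ map (theta_coef_image a b) quartic_exps"

lemma quartic_exps_eq: "quartic_exps = [(0, 0, 4), (0, 1, 3), (0, 2, 2), (0, 3, 1), (0, 4, 0), (1, 0, 3), (1, 1, 2),
   (1, 2, 1), (1, 3, 0), (2, 0, 2), (2, 1, 1), (2, 2, 0), (3, 0, 1), (3, 1, 0), (4, 0, 0)]"
  by (code_simp)

lemma set_quartic_exps: "set quartic_exps = degree4"
proof
  show "set quartic_exps \<subseteq> degree4"
    by (auto simp: quartic_exps_def degree4_def)
  show "degree4 \<subseteq> set quartic_exps"
    by (force simp: quartic_exps_def degree4_def)
qed

lemma length_quartic_exps: "length quartic_exps = 15"
  by (simp add: quartic_exps_eq)

lemma distinct_quartic_exps: "distinct quartic_exps"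
  by (simp add: quartic_exps_eq)

text \<open>
  In the scaled coefficients \<open>\<alpha>\<close> the action becomes
  \<open>\<alpha>_m \<mapsto> - m_a \<alpha>_{m - a + b}\<close>, which is integral.
\<close>

lemma multinom_shift:
  "\<forall>(a, b)\<in>set roots. \<forall>m\<in>set quartic_exps. expo a m \<noteq> 0 \<longrightarrow>
     int (Suc (expo b m)) * multinom (raise b (lower a m)) = int (expo a m) * multinom m \<and>
     raise b (lower a m) \<in> set quartic_exps"
  by code_simp

lemma multinom_nonzero: "\<forall>m\<in>set quartic_exps. multinom m \<noteq> 0"
  by code_simp

lemma of_nat_eq_Const: "of_nat n = Const (of_nat n)"
  by (simp add: Const_def)

lemma lie_scaled_coef:
  assumes "is_root a b" "m \<in> degree4" "expo a m \<noteq> 0"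
  shows "lie a b (scaled_coef m) = of_int (- int (expo a m)) * scaled_coef (raise b (lower a m))"
proof -
  let ?m = "raise b (lower a m)"
  have "int (Suc (expo b m)) * multinom ?m = int (expo a m) * multinom m" and m': "?m \<in> degree4"
    using multinom_shift assms by (auto simp: is_root_iff set_quartic_exps)
  then have "rat_of_int (int (Suc (expo b m)) * multinom ?m) = rat_of_int (int (expo a m) * multinom m)"
    by (simp only:)
  moreover have nz: "multinom m \<noteq> 0" "multinom ?m \<noteq> 0"
    using multinom_nonzero assms(2) m' by (auto simp: set_quartic_exps)
  ultimately have eq: "1 / of_int (multinom m) * - rat_of_nat (Suc (expo b m)) = - rat_of_nat (expo a m) * (1 / of_int (multinom ?m))"
    by (simp add: field_simps)
  have "lie a b (scaled_coef m) = Const (1 / of_int (multinom m)) * lie_Var a b m"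
    by (simp add: scaled_coef_def derivation_mult[OF derivation_lie] lie_Var assms(2))
  also have "lie_Var a b m = Const (- rat_of_nat (Suc (expo b m))) * Var ?m"
    by (simp only: lie_Var_def assms(3) if_False of_nat_eq_Const Const_uminus)
  also have "Const (1 / of_int (multinom m)) * (Const (- rat_of_nat (Suc (expo b m))) * Var ?m) =
      Const (- rat_of_nat (expo a m) * (1 / of_int (multinom ?m))) * Var ?m"
    by (simp only: mult.assoc[symmetric] Const_mult[symmetric] eq)
  also have "\<dots> = of_int (- int (expo a m)) * scaled_coef ?m"
    by (simp only: Const_mult scaled_coef_def mult.assoc Const_uminus of_nat_eq_Const of_int_minus of_int_of_nat_eq)
  finally show ?thesis .
qed

lemma theta_gens:
  assumes "is_root a b" "i < 21"
  shows "theta a b (gens quartic_exps i) =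
    of_int (fst (theta_images a b ! i)) * gens quartic_exps (snd (theta_images a b ! i))"
proof (cases "i < 6")
  case True
  let ?vs = "[X, Y, Z, U, V, W]"
  define v where "v = ?vs ! i"
  have im: "theta_images a b ! i = theta_Var_image a b v"
  proof -
    have "theta_images a b ! i = map (theta_Var_image a b) ?vs ! i"
      unfolding theta_images_def nth_append length_map using True by (simp del: list.map)
    also have "\<dots> = theta_Var_image a b v"
      unfolding v_def by (rule nth_map) (use True in simp)
    finally show ?thesis .
  qed
  have gen: "gens quartic_exps (position w ?vs) = Var w" for w
  proof -
    have "w \<in> set ?vs" by (cases w) simp_all
    then show ?thesis using nth_position[of w ?vs] by (simp add: gens_def)
  qed
  have "b \<noteq> dual a" using assms(1) by (auto simp: is_root_def)
  then show ?thesis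
    unfolding im using True gen[of a] gen[of "dual b"]
    by (auto simp: gens_def[of _ i] theta_Var v_def[symmetric])
next
  case False
  define m where "m = quartic_exps ! (i - 6)"
  have m: "m \<in> degree4"
    using assms(2) False nth_mem[of "i - 6" quartic_exps] by (simp add: m_def set_quartic_exps length_quartic_exps)
  have im: "theta_images a b ! i = theta_coef_image a b m"
    using False assms(2) unfolding theta_images_def m_def
    by (simp add: nth_append length_quartic_exps del: theta_coef_image.simps theta_Var_image.simps)
  have lhs: "theta a b (gens quartic_exps i) = Const (lie a b (scaled_coef m))"
  proof -
    have "i - 6 < 15" using False assms(2) by linarith
    then show ?thesis using False by (simp add: gens_def coef_gens_def length_quartic_exps theta_Const m_def)
  qed
  show ?thesis
  proof (cases "expo a m = 0")
    case True
    have "lie a b (scaled_coef m) = 0"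
      using True by (simp add: scaled_coef_def derivation_mult[OF derivation_lie] lie_Var m lie_Var_def)
    then show ?thesis using True lhs im by simp
  next
    case False
    let ?m = "raise b (lower a m)"
    have "?m \<in> set quartic_exps"
      using multinom_shift assms(1) m False by (auto simp: is_root_iff set_quartic_exps)
    then have "gens quartic_exps (6 + position ?m quartic_exps) = Const (scaled_coef ?m)"
      using nth_position[of ?m quartic_exps] by (simp add: gens_def coef_gens_def)
    then show ?thesis
      using False lhs im lie_scaled_coef[OF assms(1) m False] by (simp add: Const_mult of_int_eq_Const Const_uminus)
  qed
qed

lemma theta_heval:
  assumes "is_root a b"
  shows "theta a b (heval p (gens quartic_exps)) = heval (h_along 0 (theta_images a b) p) (gens quartic_exps)"
proof (rule heval_along[OF derivation_theta])
  have len: "length (theta_images a b) = 21"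
    by (simp add: theta_images_def length_quartic_exps)
  show "i < length (theta_images a b) \<Longrightarrow> theta a b (gens quartic_exps i) =
      of_int (fst (theta_images a b ! i)) * gens quartic_exps (snd (theta_images a b ! i))" for i
    using theta_gens[OF assms] by (simp add: len)
  show "length (theta_images a b) \<le> i \<Longrightarrow> theta a b (gens quartic_exps i) = 0" for i
    using derivation_0[OF derivation_theta] by (simp add: len gens_def coef_gens_def length_quartic_exps)
qed

fun h_killed_by :: "(var \<times> var) list \<Rightarrow> hpoly \<Rightarrow> bool" where
  "h_killed_by [] p = True"
| "h_killed_by ((a, b) # rs) p = (h_along 0 (theta_images a b) p = Coef 0 \<and> h_killed_by rs p)"

lemma h_killed_byD: "h_killed_by rs p \<Longrightarrow> (a, b) \<in> set rs \<Longrightarrow> h_along 0 (theta_images a b) p = Coef 0"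
  by (induction rs p rule: h_killed_by.induct) auto

text \<open>
  The universal \<open>psi\<close>, a polynomial with 389 terms, is computed here as an explicit quotient by
  \<open>w^6\<close>.
\<close>

lemma universal_psi_check: "psi_check (h_line (h_quartic 6 quartic_exps))"
  by code_simp

lemma universal_psi_killed: "h_killed_by roots (h_psi (h_quartic 6 quartic_exps))"
  by code_simp

lemma heval_universal_quartic: "universal_quartic = heval (h_quartic 6 quartic_exps) (gens quartic_exps)"
proof -
  have "heval (h_quartic 6 quartic_exps) (gens quartic_exps) = (\<Sum>m\<leftarrow>quartic_exps. Const (Var m) * xyz_monom m)"
    using multinom_nonzero by (intro heval_quartic) blast
  also have "\<dots> = (\<Sum>m\<in>set quartic_exps. Const (Var m) * xyz_monom m)"
    by (rule sum_list_distinct_conv_sum_set[OF distinct_quartic_exps])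
  finally show ?thesis by (simp add: universal_quartic_eq set_quartic_exps)
qed

lemma psi_universal_quartic: "is_psi universal_quartic (psi universal_quartic)"
  "psi universal_quartic = heval (h_psi (h_quartic 6 quartic_exps)) (gens quartic_exps)"
proof -
  have *: "is_psi universal_quartic (heval (h_psi (h_quartic 6 quartic_exps)) (gens quartic_exps))"
    unfolding heval_universal_quartic by (rule is_psi_heval[OF universal_psi_check])
  then show "psi universal_quartic = heval (h_psi (h_quartic 6 quartic_exps)) (gens quartic_exps)"
    by (rule psi_eq)
  with * show "is_psi universal_quartic (psi universal_quartic)" by simp
qed

lemma vars_psi: "vars (psi universal_quartic) \<subseteq> {U, V, W}"
  unfolding psi_universal_quartic h_psi_def by (rule vars_heval_lift_3)

lemma theta_psi: "is_root a b \<Longrightarrow> theta a b (psi universal_quartic) = 0"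
  unfolding psi_universal_quartic
  by (simp add: theta_heval h_killed_byD[OF universal_psi_killed] is_root_iff)

section \<open>Invariance of the Dixmier-Ohno invariants and of the determinant of R4\<close>

lemma less_3: "i < 3 \<longleftrightarrow> i = 0 \<or> i = 1 \<or> i = (2::nat)"
  by auto

lemma lessThan_3: "{..<3} = {0, 1, 2::nat}"
  by auto

text \<open>
  The second derivatives of an invariant form are transformed by a congruence, up to the sign that
  comes from passing to the dual.
\<close>

lemma theta_hessian:
  assumes "theta a b A = 0"
  shows "theta a b (pderiv_at v (pderiv_at w A)) =
     (if w = dual b then pderiv_at v (pderiv_at (dual a) A) else 0) - (if w = a then pderiv_at v (pderiv_at b A) else 0)
     + (if v = dual b then pderiv_at (dual a) (pderiv_at w A) else 0) - (if v = a then pderiv_at b (pderiv_at w A) else 0)"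
  by (simp add: theta_pderiv_at assms pderiv_rules)

lemma vars_prod: "(\<And>i. i \<in> I \<Longrightarrow> vars (f i) \<subseteq> N) \<Longrightarrow> vars (prod f I) \<subseteq> N"
  for f :: "'i \<Rightarrow> ('v, 'r::comm_ring_1) mpoly"
  by (induction I rule: infinite_finite_induct) (simp_all add: vars_mult)

lemma vars_det:
  fixes A :: "('v, 'r::comm_ring_1) mpoly mat"
  assumes A: "A \<in> carrier_mat n n" and "\<And>i j. i < n \<Longrightarrow> j < n \<Longrightarrow> vars (A $$ (i, j)) \<subseteq> N"
  shows "vars (det A) \<subseteq> N"
  unfolding det_def'[OF A]
proof (intro vars_sum vars_mult vars_prod)
  fix p i assume "p \<in> {p. p permutes {0..<n}}" "i \<in> {0..<n}"
  then show "vars (A $$ (i, p i)) \<subseteq> N"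
    using permutes_in_image[of p "{0..<n}" i] assms(2)[of i "p i"] by simp
qed (simp add: sign_def)

lemma operators_0: "J4 0 f = 0" "J4 p 0 = 0" "D_uvw 0 f = 0" "D_uvw p 0 = 0" "D_xyz 0 f = 0" "D_xyz p 0 = 0"
  by (simp_all add: J4_eq D_uvw_eq D_xyz_eq cross.Op_0 cross.Op_0_right uvw.Op_0 uvw.Op_0_right xyz.Op_0 xyz.Op_0_right)

lemma theta_sigma: "is_root a b \<Longrightarrow> theta a b (sigma universal_quartic) = 0"
  unfolding sigma_def theta_rscale
  by (simp add: theta_J4 vars_universal_quartic theta_universal_quartic operators_0 rscale_def)

lemma vars_sigma: "vars (sigma universal_quartic) \<subseteq> {U, V, W}"
  unfolding sigma_def
  by (intro vars_rscale vars_J4[OF xyz_degree_universal_quartic xyz_degree_universal_quartic])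

lemma sum_select_xyz:
  fixes f :: "var \<Rightarrow> 'a::comm_ring_1"
  assumes "b \<in> {X, Y, Z}"
  shows "(\<Sum>k<3. (if P \<and> [X, Y, Z] ! k = b then - 1 else 0) * f ([X, Y, Z] ! k)) = (if P then - f b else 0)"
  using assms by (auto simp: lessThan_3)

lemma sum_select_uvw:
  fixes f :: "var \<Rightarrow> 'a::comm_ring_1"
  assumes "b \<in> {X, Y, Z}"
  shows "(\<Sum>k<3. - (if [X, Y, Z] ! k = b \<and> P then - 1 else 0) * f ([U, V, W] ! k)) = (if P then f (dual b) else 0)"
  using assms by (auto simp: lessThan_3)

definition hessian :: "form \<Rightarrow> form mat" where
  "hessian q = mat 3 3 (\<lambda>(r, s). pderiv_at ([X, Y, Z] ! r) (pderiv_at ([X, Y, Z] ! s) q))"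

lemma theta_He:
  assumes "is_root a b"
  shows "theta a b (He universal_quartic) = 0"
proof -
  let ?xs = "[X, Y, Z]"
  let ?N = "\<lambda>i k. (if ?xs ! i = a \<and> ?xs ! k = b then - 1 else 0 :: form)"
  have "theta a b (det (hessian universal_quartic)) = 0"
  proof (rule derivation_det_congruence[OF derivation_theta, where n = 3 and N = ?N])
    show "hessian universal_quartic \<in> carrier_mat 3 3" by (simp add: hessian_def)
    show "i < 3 \<Longrightarrow> ?N i i = 0" for i using assms by (auto simp: is_root_def)
    fix i j :: nat assume ij: "i < 3" "j < 3"
    have b: "b \<in> {X, Y, Z}" using assms by (simp add: is_root_def)
    have "?xs ! i \<in> set ?xs" "?xs ! j \<in> set ?xs" using ij by (intro nth_mem; simp)+
    then have nb: "?xs ! i \<noteq> dual b" "?xs ! j \<noteq> dual b"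
      using b by auto
    have "theta a b (hessian universal_quartic $$ (i, j)) =
        (\<Sum>k<3. ?N i k * pderiv_at (?xs ! k) (pderiv_at (?xs ! j) universal_quartic)) +
        (\<Sum>k<3. ?N j k * pderiv_at (?xs ! i) (pderiv_at (?xs ! k) universal_quartic))"
      unfolding sum_select_xyz[OF b, where f = "\<lambda>v. pderiv_at v (pderiv_at (?xs ! j) universal_quartic)"]
        sum_select_xyz[OF b, where f = "\<lambda>v. pderiv_at (?xs ! i) (pderiv_at v universal_quartic)"]
      using ij nb by (simp add: hessian_def theta_hessian theta_universal_quartic assms)
    then show "theta a b (hessian universal_quartic $$ (i, j)) =
        (\<Sum>k<3. ?N i k * hessian universal_quartic $$ (k, j)) + (\<Sum>k<3. ?N j k * hessian universal_quartic $$ (i, k))"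
      using ij by (simp add: hessian_def)
  qed
  then show ?thesis
    by (simp add: He_def theta_rscale hessian_def) (simp add: rscale_def)
qed

lemma vars_He: "vars (He universal_quartic) \<subseteq> {X, Y, Z}"
  unfolding He_def
  by (intro vars_rscale vars_det[of _ 3]) (simp_all add: vars_pderiv_at vars_universal_quartic)

lemma theta_rho: "is_root a b \<Longrightarrow> theta a b (rho universal_quartic) = 0"
  unfolding rho_def theta_rscale
  by (simp add: theta_D_xyz vars_universal_quartic theta_universal_quartic theta_psi operators_0 rscale_def)

lemma vars_rho: "vars (rho universal_quartic) \<subseteq> {U, V, W}"
  unfolding rho_def by (intro vars_rscale vars_D_xyz vars_psi)

lemma theta_tau: "is_root a b \<Longrightarrow> theta a b (tau universal_quartic) = 0"
  unfolding tau_def theta_rscale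
  by (simp add: theta_D_uvw vars_rho theta_universal_quartic theta_rho operators_0 rscale_def)

lemma theta_xi: "is_root a b \<Longrightarrow> theta a b (xi universal_quartic) = 0"
  unfolding xi_def theta_rscale
  by (simp add: theta_D_uvw vars_sigma theta_He theta_sigma operators_0 rscale_def)

lemma vars_xi: "vars (xi universal_quartic) \<subseteq> {X, Y, Z}"
  unfolding xi_def by (intro vars_rscale vars_D_uvw vars_He)

lemma theta_eta: "is_root a b \<Longrightarrow> theta a b (eta universal_quartic) = 0"
  unfolding eta_def theta_rscale
  by (simp add: theta_D_xyz vars_xi theta_xi theta_sigma operators_0 rscale_def)

definition hess_0 :: "var \<Rightarrow> var \<Rightarrow> form \<Rightarrow> coef" where
  "hess_0 v w A = const_term (pderiv_at v (pderiv_at w A))"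

lemma const_term_0 [simp]: "const_term 0 = 0"
  by (simp add: const_term_def)

lemma const_term_add: "const_term (p + q) = const_term p + const_term q"
  by (simp add: const_term_def lookup_add)

lemma const_term_diff: "const_term (p - q) = const_term p - const_term q"
  for p :: "('v, 'r::comm_ring_1) mpoly"
  by (simp add: const_term_def lookup_minus)

lemma const_term_Const_mult: "const_term (Const c * p) = c * const_term p"
  for p :: "('v, 'r::comm_ring_1) mpoly"
  by (simp add: const_term_def lookup_Const_mult)

lemma hess_0_eq: "hess_0 v w A =
    (if v = w then 2 else 1) * Poly_Mapping.lookup A (Poly_Mapping.single v 1 + Poly_Mapping.single w 1)"
  unfolding add.commute[of "Poly_Mapping.single v 1" "Poly_Mapping.single w 1"]
  by (simp add: hess_0_def const_term_def lookup_pderiv_at lookup_single)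

lemma Const_half: "Const (1 / 2) * (2 * x) = (x :: coef)"
proof -
  have "(2 :: coef) = Const 2" unfolding Const_def single_numeral ..
  then have "Const (1 / 2) * (2 * x) = Const (1 / 2 * 2) * x" by (simp only: Const_mult mult.assoc)
  then show ?thesis by simp
qed

lemma gram_eq:
  assumes "vs \<in> {[X, Y, Z], [U, V, W]}" "r < 3" "s < 3"
  shows "gram vs A $$ (r, s) = Const (1 / 2) * hess_0 (vs ! r) (vs ! s) A"
proof -
  have "vs ! r = vs ! s \<longleftrightarrow> r = s"
    using assms by (auto simp: nth_eq_iff_index_eq)
  then show ?thesis
    using assms(2,3) by (auto simp: gram_def hess_0_eq Const_half)
qed

text \<open>
  A Gram matrix is half the Hessian matrix at the origin, so it inherits its transformation from
  \<open>theta_hessian\<close>.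
\<close>

lemma lie_hess_0:
  assumes "theta a b A = 0"
  shows "lie a b (hess_0 v w A) =
     (if w = dual b then hess_0 v (dual a) A else 0) - (if w = a then hess_0 v b A else 0)
     + (if v = dual b then hess_0 (dual a) w A else 0) - (if v = a then hess_0 b w A else 0)"
  unfolding hess_0_def const_term_theta[symmetric] theta_hessian[OF assms]
  by (simp add: const_term_add const_term_diff)

definition lie_mat :: "var \<Rightarrow> var \<Rightarrow> nat \<Rightarrow> nat \<Rightarrow> coef" where
  "lie_mat a b i k = (if [X, Y, Z] ! i = a \<and> [X, Y, Z] ! k = b then - 1 else 0)"

lemma lie_gram_xyz:
  assumes "is_root a b" "theta a b A = 0" "r < 3" "s < 3"
  shows "lie a b (gram [X, Y, Z] A $$ (r, s)) =
     (\<Sum>k<3. lie_mat a b r k * gram [X, Y, Z] A $$ (k, s)) + (\<Sum>k<3. lie_mat a b s k * gram [X, Y, Z] A $$ (r, k))"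
proof -
  have "lie a b (gram [X, Y, Z] A $$ (r, s)) = Const (1 / 2) * lie a b (hess_0 ([X, Y, Z] ! r) ([X, Y, Z] ! s) A)"
    using assms by (simp add: gram_eq derivation_mult[OF derivation_lie])
  also have "\<dots> = (\<Sum>k<3. lie_mat a b r k * (Const (1 / 2) * hess_0 ([X, Y, Z] ! k) ([X, Y, Z] ! s) A))
      + (\<Sum>k<3. lie_mat a b s k * (Const (1 / 2) * hess_0 ([X, Y, Z] ! r) ([X, Y, Z] ! k) A))"
  proof -
    have b: "b \<in> {X, Y, Z}" using assms by (simp add: is_root_def)
    have "[X, Y, Z] ! r \<in> set [X, Y, Z]" "[X, Y, Z] ! s \<in> set [X, Y, Z]" using assms by (intro nth_mem; simp)+
    then have "[X, Y, Z] ! r \<noteq> dual b" "[X, Y, Z] ! s \<noteq> dual b" using b by auto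
    then show ?thesis
      unfolding lie_mat_def lie_hess_0[OF assms(2)]
        sum_select_xyz[OF b, where f = "\<lambda>v. Const (1 / 2) * hess_0 v ([X, Y, Z] ! s) A"]
        sum_select_xyz[OF b, where f = "\<lambda>v. Const (1 / 2) * hess_0 ([X, Y, Z] ! r) v A"]
      by (simp add: distrib_left right_diff_distrib)
  qed
  finally show ?thesis using assms by (simp add: gram_eq)
qed

lemma lie_gram_uvw:
  assumes "is_root a b" "theta a b A = 0" "r < 3" "s < 3"
  shows "lie a b (gram [U, V, W] A $$ (r, s)) =
     (\<Sum>k<3. - lie_mat a b k r * gram [U, V, W] A $$ (k, s)) + (\<Sum>k<3. - lie_mat a b k s * gram [U, V, W] A $$ (r, k))"
proof -
  have "lie a b (gram [U, V, W] A $$ (r, s)) = Const (1 / 2) * lie a b (hess_0 ([U, V, W] ! r) ([U, V, W] ! s) A)"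
    using assms by (simp add: gram_eq derivation_mult[OF derivation_lie])
  also have "\<dots> = (\<Sum>k<3. - lie_mat a b k r * (Const (1 / 2) * hess_0 ([U, V, W] ! k) ([U, V, W] ! s) A))
      + (\<Sum>k<3. - lie_mat a b k s * (Const (1 / 2) * hess_0 ([U, V, W] ! r) ([U, V, W] ! k) A))"
  proof -
    have ab: "a \<in> {X, Y, Z}" "b \<in> {X, Y, Z}" using assms by (simp_all add: is_root_def)
    have mem: "[U, V, W] ! k \<noteq> a" "[U, V, W] ! k = dual b \<longleftrightarrow> [X, Y, Z] ! k = b" if "k < 3" for k
      using that ab unfolding less_3 by auto
    show ?thesis
      unfolding lie_mat_def lie_hess_0[OF assms(2)] mem[OF assms(3)] mem[OF assms(4)]
        sum_select_uvw[OF ab(1), where f = "\<lambda>v. Const (1 / 2) * hess_0 v ([U, V, W] ! s) A"]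
        sum_select_uvw[OF ab(1), where f = "\<lambda>v. Const (1 / 2) * hess_0 ([U, V, W] ! r) v A"]
      using mem[OF assms(3)] mem[OF assms(4)] by (simp add: distrib_left right_diff_distrib)
  qed
  finally show ?thesis using assms by (simp add: gram_eq)
qed

lemma lie_mat_diag: "is_root a b \<Longrightarrow> lie_mat a b i i = 0"
  by (auto simp: is_root_def lie_mat_def)

lemma lie_J30: "is_root a b \<Longrightarrow> theta a b A = 0 \<Longrightarrow> lie a b (J30 A) = 0"
  unfolding J30_def
  by (rule derivation_det_congruence[OF derivation_lie, where n = 3 and N = "lie_mat a b"])
    (simp_all add: lie_gram_xyz lie_mat_diag, simp add: gram_def)

lemma lie_J03: "is_root a b \<Longrightarrow> theta a b A = 0 \<Longrightarrow> lie a b (J03 A) = 0"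
  unfolding J03_def
  by (rule derivation_det_congruence[OF derivation_lie, where n = 3 and N = "\<lambda>i k. - lie_mat a b k i"])
    (simp_all add: lie_gram_uvw lie_mat_diag, simp add: gram_def)

lemma J11_eq: "J11 A B = (\<Sum>r<3. \<Sum>s<3. gram [X, Y, Z] A $$ (r, s) * gram [U, V, W] B $$ (s, r))"
  unfolding J11_def
proof (intro sum.cong refl)
  fix r :: nat assume "r \<in> {..<3}"
  then show "(gram [X, Y, Z] A * gram [U, V, W] B) $$ (r, r) = (\<Sum>s<3. gram [X, Y, Z] A $$ (r, s) * gram [U, V, W] B $$ (s, r))"
    by (simp add: gram_def scalar_prod_def lessThan_atLeast0)
qed

text \<open>
  The trace pairs a quadratic form with one on the dual space, and the four contributions of
  \<open>N\<close> cancel in pairs.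
\<close>

lemma derivation_trace_contragredient:
  fixes A B :: "nat \<Rightarrow> nat \<Rightarrow> 'a::comm_ring_1"
  assumes D: "derivation D"
    and A: "\<And>r s. r < n \<Longrightarrow> s < n \<Longrightarrow> D (A r s) = (\<Sum>k<n. N r k * A k s) + (\<Sum>k<n. N s k * A r k)"
    and B: "\<And>r s. r < n \<Longrightarrow> s < n \<Longrightarrow> D (B r s) = (\<Sum>k<n. - N k r * B k s) + (\<Sum>k<n. - N k s * B r k)"
  shows "D (\<Sum>r<n. \<Sum>s<n. A r s * B s r) = 0"
proof -
  have "D (\<Sum>r<n. \<Sum>s<n. A r s * B s r) =
      (\<Sum>r<n. \<Sum>s<n. \<Sum>k<n. N r k * A k s * B s r + N s k * A r k * B s r
         - N k s * A r s * B k r - N k r * A r s * B s k)"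
    by (simp add: derivation_sum[OF D] derivation_mult[OF D] A B sum_distrib_left sum_distrib_right
        sum.distrib sum_subtractf sum_negf algebra_simps)
  also have "\<dots> = (\<Sum>r<n. \<Sum>s<n. \<Sum>k<n. N r k * A k s * B s r) - (\<Sum>r<n. \<Sum>s<n. \<Sum>k<n. N k r * A r s * B s k)
      + ((\<Sum>r<n. \<Sum>s<n. \<Sum>k<n. N s k * A r k * B s r) - (\<Sum>r<n. \<Sum>s<n. \<Sum>k<n. N k s * A r s * B k r))"
    by (simp add: sum.distrib sum_subtractf)
  also have "(\<Sum>r<n. \<Sum>s<n. \<Sum>k<n. N k r * A r s * B s k) = (\<Sum>r<n. \<Sum>s<n. \<Sum>k<n. N r k * A k s * B s r)"
    by (subst sum.swap, subst (2) sum.swap, subst sum.swap) (rule refl)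
  also have "(\<Sum>r<n. \<Sum>s<n. \<Sum>k<n. N k s * A r s * B k r) = (\<Sum>r<n. \<Sum>s<n. \<Sum>k<n. N s k * A r k * B s r)"
    by (rule sum.cong[OF refl]) (rule sum.swap)
  finally show ?thesis by simp
qed

lemma lie_J11: "is_root a b \<Longrightarrow> theta a b A = 0 \<Longrightarrow> theta a b B = 0 \<Longrightarrow> lie a b (J11 A B) = 0"
  unfolding J11_eq
  by (rule derivation_trace_contragredient[OF derivation_lie, where N = "lie_mat a b"])
    (simp_all add: lie_gram_xyz lie_gram_uvw)

lemma lie_I3: "is_root a b \<Longrightarrow> lie a b (I3 universal_quartic) = 0"
  by (simp add: I3_def derivation_mult[OF derivation_lie] theta_D_uvw vars_sigma theta_sigma theta_universal_quartic
      operators_0 flip: const_term_theta)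

lemma lie_I6:
  assumes "is_root a b"
  shows "lie a b (I6 universal_quartic) = 0"
proof -
  note D = derivation_lie[of a b]
  have "lie a b (const_term (D_uvw (psi universal_quartic) (He universal_quartic))) = 0"
    by (simp add: theta_D_uvw assms vars_psi theta_psi theta_He operators_0 flip: const_term_theta)
  then show ?thesis
    by (simp add: I6_def derivation_mult[OF D] derivation_diff[OF D] derivation_numeral[OF D] derivation_zero_power[OF D] lie_I3 assms)
qed

lemma t4_of_nat_mult_left: "t4 q (of_nat n * p) r = of_nat n * t4 q p r"
  by (simp only: t4_def of_nat_eq_Const J4_eq D_uvw_eq cross.Op_Const_mult_right uvw.Op_Const_mult const_term_Const_mult)

lemma t4_of_nat_mult_right: "t4 q p (of_nat n * r) = of_nat n * t4 q p r"
  by (simp only: t4_def of_nat_eq_Const J4_eq D_uvw_eq uvw.Op_Const_mult_right const_term_Const_mult)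

lemma lie_t4_xyz_monom:
  assumes "is_root a b" "m \<in> degree4" "n \<in> degree4"
  shows "lie a b (t4 universal_quartic (xyz_monom m) (xyz_monom n)) =
     of_nat (expo b m) * t4 universal_quartic (xyz_monom (raise a (lower b m))) (xyz_monom n)
     + of_nat (expo b n) * t4 universal_quartic (xyz_monom m) (xyz_monom (raise a (lower b n)))"
proof -
  have "xyz_degree 4 (xyz_monom m)"
    using assms(2) xyz_degree_xyz_monom[of "fst m" "fst (snd m)" "snd (snd m)"] by (auto simp: degree4_def)
  then have vars: "vars (J4 universal_quartic (xyz_monom m)) \<subseteq> {U, V, W}"
    by (rule vars_J4[OF xyz_degree_universal_quartic])
  have "lie a b (t4 universal_quartic (xyz_monom m) (xyz_monom n)) =
      t4 universal_quartic (theta a b (xyz_monom m)) (xyz_monom n) + t4 universal_quartic (xyz_monom m) (theta a b (xyz_monom n))"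
    unfolding t4_def const_term_theta[symmetric] theta_D_uvw[OF assms(1) vars]
      theta_J4[OF assms(1) vars_universal_quartic] theta_universal_quartic[OF assms(1)]
    by (simp add: operators_0 const_term_add)
  then show ?thesis
    by (simp only: theta_xyz_monom[OF assms(1)] t4_of_nat_mult_left t4_of_nat_mult_right)
qed

text \<open>
  Since the trilinear form \<open>t4\<close> is equivariant, \<open>R4\<close> is transformed by the congruence with the
  matrix of \<open>a \<partial>/\<partial>b\<close> on the monomials of degree four, which has no diagonal entries.
\<close>

lemma lie_det_R4:
  assumes "is_root a b"
  shows "lie a b (det (R4 universal_quartic)) = 0"
proof -
  let ?e = "\<lambda>i. quartic_exps ! i"
  let ?N = "\<lambda>i k. (if expo b (?e i) \<noteq> 0 \<and> ?e k = raise a (lower b (?e i)) then of_nat (expo b (?e i)) else 0 :: coef)"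
  have mem: "?e i \<in> degree4" if "i < 15" for i
    using that nth_mem[of i quartic_exps] by (simp add: set_quartic_exps length_quartic_exps)
  have sum: "(\<Sum>k<15. ?N i k * f (?e k)) = of_nat (expo b (?e i)) * f (raise a (lower b (?e i)))" if i: "i < 15" for i f
  proof (cases "expo b (?e i) = 0")
    case False
    then have "raise a (lower b (?e i)) \<in> set quartic_exps"
      using mem[OF i] assms unfolding set_quartic_exps by (cases "?e i") (auto simp: degree4_def is_root_def)
    then obtain k0 where k0: "k0 < 15" "?e k0 = raise a (lower b (?e i))"
      unfolding in_set_conv_nth length_quartic_exps by blast
    have "?e k = raise a (lower b (?e i)) \<longleftrightarrow> k = k0" if "k < 15" for k
      using that k0 nth_eq_iff_index_eq[OF distinct_quartic_exps, of k k0] by (simp add: length_quartic_exps)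
    then have "(\<Sum>k<15. ?N i k * f (?e k)) = (\<Sum>k<15. if k = k0 then of_nat (expo b (?e i)) * f (?e k) else 0)"
      using False by (intro sum.cong) auto
    then show ?thesis using k0 by simp
  qed simp
  show ?thesis
  proof (rule derivation_det_congruence[OF derivation_lie, where n = 15 and N = ?N])
    show "R4 universal_quartic \<in> carrier_mat 15 15" by (simp add: R4_def)
    show "?N i i = 0" for i
      using assms by (cases "?e i") (auto simp: is_root_def)
    fix i j :: nat assume ij: "i < 15" "j < 15"
    have "lie a b (R4 universal_quartic $$ (i, j)) = (\<Sum>k<15. ?N i k * t4 universal_quartic (xyz_monom (?e k)) (xyz_monom (?e j)))
        + (\<Sum>k<15. ?N j k * t4 universal_quartic (xyz_monom (?e i)) (xyz_monom (?e k)))"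
      unfolding sum[OF ij(1), of "\<lambda>m. t4 universal_quartic (xyz_monom m) (xyz_monom (?e j))"]
        sum[OF ij(2), of "\<lambda>m. t4 universal_quartic (xyz_monom (?e i)) (xyz_monom m)"]
      using ij by (simp add: R4_def lie_t4_xyz_monom[OF assms mem mem])
    then show "lie a b (R4 universal_quartic $$ (i, j)) = (\<Sum>k<15. ?N i k * R4 universal_quartic $$ (k, j)) + (\<Sum>k<15. ?N j k * R4 universal_quartic $$ (i, k))"
      using ij by (simp add: R4_def)
  qed
qed

lemma lie_rho4: "is_root a b \<Longrightarrow> lie a b (rho4 universal_quartic) = 0"
  by (simp add: rho4_def derivation_mult[OF derivation_lie] lie_det_R4)

section \<open>Determinants of matrices of polynomials in Horner form\<close>

text \<open>
  A linear combination of the minors of the rows that have not been expanded yet, stored as a binary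
  tree: a path tells for each column whether it is still available, and \<open>p\<close> in \<open>Minors p s t\<close> is the
  factor of the minor belonging to the path that ends there. Expansions that use up the same columns
  are merged.
\<close>

datatype minors = No_minors | Minors hpoly minors minors

fun mk_minors :: "hpoly \<Rightarrow> minors \<Rightarrow> minors \<Rightarrow> minors" where
  "mk_minors (Coef c) No_minors No_minors = (if c = 0 then No_minors else Minors (Coef c) No_minors No_minors)"
| "mk_minors p s t = Minors p s t"

fun add_minors :: "minors \<Rightarrow> minors \<Rightarrow> minors" where
  "add_minors No_minors t = t"
| "add_minors (Minors p s t) No_minors = Minors p s t"
| "add_minors (Minors p s t) (Minors q u v) = mk_minors (h_add p q) (add_minors s u) (add_minors t v)"

fun scale_minors :: "hpoly \<Rightarrow> minors \<Rightarrow> minors" where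
  "scale_minors r No_minors = No_minors"
| "scale_minors r (Minors p s t) = mk_minors (h_mul r p) (scale_minors r s) (scale_minors r t)"

fun mul_minors :: "hpoly \<Rightarrow> minors \<Rightarrow> minors" where
  "mul_minors (Coef c) t = (if c = 0 then No_minors else scale_minors (Coef c) t)"
| "mul_minors (Horn p q) t = scale_minors (Horn p q) t"

text \<open>
  Laplace expansion along the row \<open>es\<close>: column after column, an available column is used up. The sign
  \<open>c\<close> changes with each available column that is passed over.
\<close>

fun expand_row :: "int \<Rightarrow> hpoly list \<Rightarrow> minors \<Rightarrow> minors" where
  "expand_row c [] t = No_minors"
| "expand_row c (e # es) No_minors = No_minors"
| "expand_row c (e # es) (Minors p s t) =
     mk_minors (Coef 0) (add_minors (expand_row c es s) (mul_minors (h_smult c e) t)) (expand_row (- c) es t)"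

fun expand_rows :: "hpoly list list \<Rightarrow> minors \<Rightarrow> minors" where
  "expand_rows [] t = t"
| "expand_rows (r # rs) t = expand_rows rs (expand_row 1 r t)"

fun all_columns :: "'a list \<Rightarrow> minors" where
  "all_columns [] = Minors (Coef 1) No_minors No_minors"
| "all_columns (x # xs) = Minors (Coef 0) No_minors (all_columns xs)"

fun no_columns_left :: "minors \<Rightarrow> hpoly" where
  "no_columns_left No_minors = Coef 0"
| "no_columns_left (Minors p s t) = h_add p (no_columns_left s)"

definition h_det :: "hpoly list list \<Rightarrow> hpoly" where
  "h_det rss = no_columns_left (expand_rows rss (all_columns rss))"

text \<open>
  Here \<open>F\<close> assigns a value to each set of available columns.
\<close>

primrec mval :: "minors \<Rightarrow> (nat \<Rightarrow> 'a::comm_ring_1) \<Rightarrow> (bool list \<Rightarrow> 'a) \<Rightarrow> 'a" where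
  "mval No_minors g F = 0"
| "mval (Minors p s t) g F = heval p g * F [] + mval s g (\<lambda>ms. F (False # ms)) + mval t g (\<lambda>ms. F (True # ms))"

lemma mval_mk_minors [simp]: "mval (mk_minors p s t) g F = mval (Minors p s t) g F"
  by (cases "(p, s, t)" rule: mk_minors.cases) simp_all

lemma mval_add_minors [simp]: "mval (add_minors s t) g F = mval s g F + mval t g F"
  by (induction s t arbitrary: F rule: add_minors.induct) (simp_all add: algebra_simps)

lemma mval_scale_minors [simp]: "mval (scale_minors r t) g F = heval r g * mval t g F"
  by (induction t arbitrary: F) (simp_all add: algebra_simps)

lemma mval_mul_minors [simp]: "mval (mul_minors r t) g F = heval r g * mval t g F"
  by (cases r) simp_all

lemma mval_lincomb: "mval t g (\<lambda>ms. c * F ms + G ms) = c * mval t g F + mval t g G"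
  by (induction t arbitrary: F G) (simp_all add: algebra_simps)

lemma mval_zero: "mval t g (\<lambda>ms. 0) = 0"
  by (induction t) simp_all

fun pick :: "'a::comm_ring_1 \<Rightarrow> 'a list \<Rightarrow> bool list \<Rightarrow> (bool list \<Rightarrow> 'a) \<Rightarrow> 'a" where
  "pick c (x # xs) (False # ms) F = pick c xs ms (\<lambda>r. F (False # r))"
| "pick c (x # xs) (True # ms) F = c * x * F (False # ms) + pick (- c) xs ms (\<lambda>r. F (True # r))"
| "pick c xs ms F = 0"

text \<open>
  The determinant formed from the columns marked \<open>True\<close>.
\<close>

fun masked_det :: "'a::comm_ring_1 list list \<Rightarrow> bool list \<Rightarrow> 'a" where
  "masked_det [] ms = (if True \<in> set ms then 0 else 1)"
| "masked_det (r # rs) ms = pick 1 r ms (masked_det rs)"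

lemma mval_expand_row:
  "mval (expand_row c es t) g F = mval t g (\<lambda>ms. pick (of_int c) (map (\<lambda>e. heval e g) es) ms F)"
  by (induction c es t arbitrary: F rule: expand_row.induct)
    (simp_all add: mval_zero mval_lincomb)

lemma masked_det_Cons: "masked_det (r # rs) = (\<lambda>ms. pick 1 r ms (masked_det rs))"
  by (rule ext) simp

lemma masked_det_Nil: "masked_det [] = (\<lambda>ms. if True \<in> set ms then 0 else 1)"
  by (rule ext) simp

lemma mval_expand_rows:
  "mval (expand_rows rss t) g (masked_det []) = mval t g (masked_det (map (map (\<lambda>e. heval e g)) rss))"
  by (induction rss arbitrary: t) (simp_all add: mval_expand_row masked_det_Cons)

lemma heval_no_columns_left: "heval (no_columns_left t) g = mval t g (\<lambda>ms. if True \<in> set ms then 0 else 1)"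
  by (induction t) (simp_all add: mval_zero)

lemma mval_all_columns: "mval (all_columns xs) g F = F (replicate (length xs) True)"
  by (induction xs arbitrary: F) simp_all

fun columns :: "bool list \<Rightarrow> nat list" where
  "columns [] = []"
| "columns (b # ms) = (if b then [0] else []) @ map Suc (columns ms)"

lemma columns_replicate: "columns (replicate n True) = [0..<n]"
  by (induction n) (simp_all add: map_Suc_upt upt_conv_Cons del: upt_Suc)

lemma columns_remove:
  "j < length (columns ms) \<Longrightarrow>
     columns (ms[columns ms ! j := False]) = take j (columns ms) @ drop (Suc j) (columns ms)"
proof (induction ms arbitrary: j)
  case (Cons b ms)
  show ?case
  proof (cases b)
    case True
    then show ?thesis using Cons by (cases j) (simp_all add: take_map drop_map)
  next
    case False
    then show ?thesis using Cons by (simp add: take_map drop_map)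
  qed
qed simp

lemma pick_eq_sum:
  "length xs = length ms \<Longrightarrow>
     pick c xs ms F = (\<Sum>j<length (columns ms). c * (- 1) ^ j * xs ! (columns ms ! j) * F (ms[columns ms ! j := False]))"
proof (induction c xs ms F rule: pick.induct)
  case (2 c x xs ms F)
  then show ?case
    by (simp add: sum.lessThan_Suc_shift mult.assoc del: sum.lessThan_Suc)
qed simp_all

lemma masked_det_eq_det:
  assumes "length (columns ms) = length rss" "\<And>r. r \<in> set rss \<Longrightarrow> length r = length ms"
  shows "masked_det rss ms = det (mat (length rss) (length rss) (\<lambda>(i, j). rss ! i ! (columns ms ! j)))"
  using assms
proof (induction rss arbitrary: ms)
  case Nil
  have "True \<notin> set ms" if "columns ms = []" for ms
    using that by (induction ms) (auto split: if_splits)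
  then show ?case using Nil by (simp add: det_dim_zero)
next
  case (Cons r rss)
  let ?n = "length rss" and ?cs = "columns ms"
  define A where "A = mat (Suc ?n) (Suc ?n) (\<lambda>(i, j). (r # rss) ! i ! (?cs ! j))"
  have A: "A \<in> carrier_mat (Suc ?n) (Suc ?n)" by (simp add: A_def)
  have len: "length ?cs = Suc ?n" using Cons.prems by simp
  have minor: "masked_det rss (ms[?cs ! j := False]) = det (mat_delete A 0 j)" if "j < Suc ?n" for j
  proof -
    have cs': "columns (ms[?cs ! j := False]) = take j ?cs @ drop (Suc j) ?cs"
      using that len by (intro columns_remove) simp
    have "masked_det rss (ms[?cs ! j := False]) =
        det (mat ?n ?n (\<lambda>(i, k). rss ! i ! ((take j ?cs @ drop (Suc j) ?cs) ! k)))"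
      unfolding cs'[symmetric] using Cons.prems that len by (intro Cons.IH) (simp_all add: cs')
    also have "mat ?n ?n (\<lambda>(i, k). rss ! i ! ((take j ?cs @ drop (Suc j) ?cs) ! k)) = mat_delete A 0 j"
    proof (rule eq_matI)
      fix i k assume "i < dim_row (mat_delete A 0 j)" "k < dim_col (mat_delete A 0 j)"
      then have "i < ?n" "k < ?n" by (simp_all add: mat_delete_def A_def)
      then show "mat ?n ?n (\<lambda>(i, k). rss ! i ! ((take j ?cs @ drop (Suc j) ?cs) ! k)) $$ (i, k) = mat_delete A 0 j $$ (i, k)"
        using that len by (auto simp: mat_delete_def A_def nth_append min_def)
    qed (simp_all add: mat_delete_def A_def)
    finally show ?thesis .
  qed
  have "det A = (\<Sum>j<Suc ?n. A $$ (0, j) * cofactor A 0 j)"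
    by (rule laplace_expansion_row[OF A]) simp
  also have "\<dots> = (\<Sum>j<Suc ?n. 1 * (- 1) ^ j * r ! (?cs ! j) * masked_det rss (ms[?cs ! j := False]))"
    by (intro sum.cong refl) (simp add: A_def cofactor_def minor[unfolded A_def] mult_ac)
  also have "\<dots> = masked_det (r # rss) ms"
    using Cons.prems pick_eq_sum[of r ms 1 "masked_det rss"] by (simp add: len del: sum.lessThan_Suc)
  finally show ?case by (simp add: A_def)
qed

lemma heval_det:
  assumes "length rss = n" "\<And>r. r \<in> set rss \<Longrightarrow> length r = n"
  shows "heval (h_det rss) g = det (mat n n (\<lambda>(i, j). heval (rss ! i ! j) g))"
proof -
  let ?rss = "map (map (\<lambda>e. heval e g)) rss"
  have "heval (h_det rss) g = masked_det ?rss (replicate n True)"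
    using mval_expand_rows[of rss "all_columns rss" g] assms(1)
    by (simp add: h_det_def heval_no_columns_left mval_all_columns masked_det_Nil del: masked_det.simps)
  also have "\<dots> = det (mat n n (\<lambda>(i, j). ?rss ! i ! (columns (replicate n True) ! j)))"
    using assms by (subst masked_det_eq_det) (auto simp: columns_replicate)
  also have "mat n n (\<lambda>(i, j). ?rss ! i ! (columns (replicate n True) ! j)) = mat n n (\<lambda>(i, j). heval (rss ! i ! j) g)"
    using assms by (intro eq_matI) (auto simp: columns_replicate)
  finally show ?thesis .
qed

section \<open>Specialising the coefficients of a quartic\<close>

text \<open>
  All constructions commute with homomorphisms of the coefficient ring that fix the rational
  numbers.
\<close>

locale specialisation =
  fixes h :: "coef \<Rightarrow> coef"
  assumes h: "comm_ring_hom h" and h_Const: "h (Const r) = Const r"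
begin

sublocale h: comm_ring_hom h by (rule h)
sublocale H: comm_ring_hom "coeff_map h :: form \<Rightarrow> form" by (rule comm_ring_hom_coeff_map[OF h])
sublocale additive_map h by unfold_locales (simp add: h.hom_add)

abbreviation "H \<equiv> coeff_map h"

lemma H_Var: "H (Var v) = Var v"
  by (rule coeff_map_Var[OF h])

lemma H_rscale: "H (rscale r p) = rscale r (H p)"
  by (simp add: rscale_def H.hom_mult coeff_map_Const h_Const)

lemma H_xyz_monom: "H (xyz_monom m) = xyz_monom m"
  by (cases m) (simp add: xyz_monom_def H.hom_mult H.hom_power H_Var)

lemma H_J4: "H (J4 p q) = J4 (H p) (H q)"
  unfolding J4_eq
proof (rule cross.coeff_map_Op[OF h])
  show "H (diff_cross v f) = diff_cross v (H f)" for v f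
    by (cases v) (simp_all add: H.hom_minus H.hom_mult H_Var coeff_map_pderiv_at)
qed

lemma H_D_uvw: "H (D_uvw p q) = D_uvw (H p) (H q)"
  unfolding D_uvw_eq
proof (rule uvw.coeff_map_Op[OF h])
  show "H (diff_uvw v f) = diff_uvw v (H f)" for v f
    by (cases v) (simp_all add: coeff_map_pderiv_at)
qed

lemma H_D_xyz: "H (D_xyz p q) = D_xyz (H p) (H q)"
  unfolding D_xyz_eq
proof (rule xyz.coeff_map_Op[OF h])
  show "H (diff_xyz v f) = diff_xyz v (H f)" for v f
    by (cases v) (simp_all add: coeff_map_pderiv_at)
qed

lemma const_term_H: "const_term (H p) = h (const_term p)"
  by (simp add: const_term_def lookup_coeff_map)

lemma gram_H: "gram vs (H A) = map_mat h (gram vs A)"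
  by (rule eq_matI) (auto simp: gram_def h.hom_mult h_Const lookup_coeff_map)

lemma J11_H: "J11 (H A) (H B) = h (J11 A B)"
proof -
  have "gram [X, Y, Z] (H A) * gram [U, V, W] (H B) = map_mat h (gram [X, Y, Z] A * gram [U, V, W] B)"
    unfolding gram_H by (rule h.mat_hom_mult[symmetric, of _ 3 3 _ 3]) (simp_all add: gram_def)
  then show ?thesis
    by (simp add: J11_def h.hom_sum) (simp add: gram_def)
qed

lemma J30_H: "J30 (H A) = h (J30 A)"
  by (simp add: J30_def gram_H)

lemma J03_H: "J03 (H A) = h (J03 A)"
  by (simp add: J03_def gram_H)

lemma sigma_H: "sigma (H q) = H (sigma q)"
  by (simp add: sigma_def H_rscale H_J4)

lemma He_H: "He (H q) = H (He q)"
proof -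
  have "mat 3 3 (\<lambda>(r, s). pderiv_at ([X, Y, Z] ! r) (pderiv_at ([X, Y, Z] ! s) (H q))) =
      map_mat H (mat 3 3 (\<lambda>(r, s). pderiv_at ([X, Y, Z] ! r) (pderiv_at ([X, Y, Z] ! s) q)))"
    by (rule eq_matI) (auto simp: coeff_map_pderiv_at)
  then show ?thesis by (simp add: He_def H_rscale)
qed

lemma t4_H: "t4 (H q) (xyz_monom m) (xyz_monom n) = h (t4 q (xyz_monom m) (xyz_monom n))"
  by (simp add: t4_def H_J4 H_D_uvw H_xyz_monom flip: const_term_H)

lemma rho4_H: "rho4 (H q) = h (rho4 q)"
proof -
  have "R4 (H q) = map_mat h (R4 q)"
    by (rule eq_matI) (auto simp: R4_def t4_H)
  then show ?thesis by (simp add: rho4_def h.hom_mult h_Const)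
qed

context
  fixes q :: form
  assumes psi: "is_psi q (psi q)"
begin

lemma psi_H: "psi (H q) = H (psi q)"
  by (rule psi_eq) (rule coeff_map_is_psi[OF h psi])

lemma rho_H: "rho (H q) = H (rho q)"
  by (simp add: rho_def H_rscale H_D_xyz psi_H)

lemma tau_H: "tau (H q) = H (tau q)"
  by (simp add: tau_def H_rscale H_D_uvw rho_H)

lemma xi_H: "xi (H q) = H (xi q)"
  by (simp add: xi_def H_rscale H_D_uvw sigma_H He_H)

lemma eta_H: "eta (H q) = H (eta q)"
  by (simp add: eta_def H_rscale H_D_xyz sigma_H xi_H)

lemma I3_H: "I3 (H q) = h (I3 q)"
  by (simp add: I3_def h.hom_mult h_Const sigma_H H_D_uvw flip: const_term_H)

lemma I6_H: "I6 (H q) = h (I6 q)"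
  by (simp add: I6_def h.hom_mult h.hom_minus h.hom_power h.hom_numeral h_Const psi_H He_H I3_H H_D_uvw flip: const_term_H)

lemma invariants_H:
  "I9 (H q) = h (I9 q)" "I12 (H q) = h (I12 q)" "I15 (H q) = h (I15 q)"
  "J9 (H q) = h (J9 q)" "J12 (H q) = h (J12 q)" "J15 (H q) = h (J15 q)"
  by (simp_all add: I9_def I12_def I15_def J9_def J12_def J15_def tau_H rho_H xi_H eta_H J11_H J30_H J03_H)

end

end

section \<open>A slice that detects every invariant\<close>

text \<open>
  The monomials that are absent from the quartics of the slice.
\<close>

definition killed :: "(nat \<times> nat \<times> nat) set" where
  "killed = {(0, 0, 4), (0, 1, 3), (0, 2, 2), (1, 1, 2), (1, 2, 1), (2, 0, 2)}"

definition slice_hom :: "coef \<Rightarrow> coef" where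
  "slice_hom = subst (\<lambda>m. if m \<in> killed then 0 else Var m)"

interpretation slice_hom: specialisation slice_hom
  by (rule specialisation.intro) (simp_all add: slice_hom_def comm_ring_hom_subst)

text \<open>
  The degree in the coordinates transversal to the slice.
\<close>

definition killed_degree :: "(nat \<times> nat \<times> nat \<Rightarrow>\<^sub>0 nat) \<Rightarrow> nat" where
  "killed_degree m = (\<Sum>k\<in>killed. Poly_Mapping.lookup m k)"

lemma finite_killed: "finite killed"
  by (simp add: killed_def)

lemma killed_degree_add: "killed_degree (m + n) = killed_degree m + killed_degree n"
  by (simp add: killed_degree_def lookup_add sum.distrib)

lemma killed_degree_single: "killed_degree (Poly_Mapping.single k 1) = (if k \<in> killed then 1 else 0)"
  by (simp add: killed_degree_def lookup_single when_def finite_killed)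

text \<open>
  Membership in the \<open>N\<close>-th power of the ideal of the slice.
\<close>

definition order_ge :: "nat \<Rightarrow> coef \<Rightarrow> bool" where
  "order_ge N f \<longleftrightarrow> (\<forall>m\<in>Poly_Mapping.keys f. N \<le> killed_degree m)"

lemma order_ge_0 [simp]: "order_ge N 0"
  by (simp add: order_ge_def)

lemma order_ge_add: "order_ge N f \<Longrightarrow> order_ge N g \<Longrightarrow> order_ge N (f + g)"
  using keys_add[of f g] by (auto simp: order_ge_def)

lemma order_ge_uminus: "order_ge N f \<Longrightarrow> order_ge N (- f)"
  by (simp add: order_ge_def)

lemma order_ge_sum: "(\<And>i. i \<in> A \<Longrightarrow> order_ge N (f i)) \<Longrightarrow> order_ge N (sum f A)"
  by (induction A rule: infinite_finite_induct) (simp_all add: order_ge_add)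

lemma order_ge_mult:
  assumes "order_ge M f" "order_ge N g"
  shows "order_ge (M + N) (f * g)"
  unfolding order_ge_def
proof
  fix m assume "m \<in> Poly_Mapping.keys (f * g)"
  then obtain k l where "m = k + l" "k \<in> Poly_Mapping.keys f" "l \<in> Poly_Mapping.keys g"
    using keys_mult[of f g] by blast
  then show "M + N \<le> killed_degree m"
    using assms by (auto simp: order_ge_def killed_degree_add intro: add_mono)
qed

lemma order_ge_trivial: "order_ge 0 f"
  by (simp add: order_ge_def)

lemma order_ge_mult_left: "order_ge N f \<Longrightarrow> order_ge N (c * f)"
  using order_ge_mult[OF order_ge_trivial] by simp

lemma order_ge_Var: "k \<in> killed \<Longrightarrow> order_ge 1 (Var k)"
  by (simp add: order_ge_def Var_def killed_degree_single)

lemma order_ge_pderiv_at: "order_ge N f \<Longrightarrow> v \<notin> killed \<Longrightarrow> order_ge N (pderiv_at v f)"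
  using keys_pderiv_at[of _ v f] by (force simp: order_ge_def killed_degree_add killed_degree_single)

lemma order_ge_pderiv_at_killed: "order_ge (Suc N) f \<Longrightarrow> order_ge N (pderiv_at v f)"
proof -
  assume f: "order_ge (Suc N) f"
  have "N \<le> killed_degree m" if "m \<in> Poly_Mapping.keys (pderiv_at v f)" for m
  proof -
    have "Suc N \<le> killed_degree (Poly_Mapping.single v 1 + m)"
      using f keys_pderiv_at[OF that] by (simp add: order_ge_def)
    then show ?thesis by (simp add: killed_degree_add killed_degree_single split: if_splits)
  qed
  then show ?thesis by (simp add: order_ge_def)
qed

lemma order_ge_cancel_Var:
  assumes "v \<notin> killed" "order_ge N (Var v * f)"
  shows "order_ge N f"
  unfolding order_ge_def
proof
  fix m assume "m \<in> Poly_Mapping.keys f"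
  then have "Poly_Mapping.single v 1 + m \<in> Poly_Mapping.keys (Var v * f)"
    by (simp add: in_keys_iff lookup_Var_mult_add)
  then show "N \<le> killed_degree m"
    using assms by (force simp: order_ge_def killed_degree_add killed_degree_single)
qed

lemma order_ge_cancel_of_nat:
  assumes "n \<noteq> 0" "order_ge N (of_nat n * f)"
  shows "order_ge N f"
proof -
  have "Poly_Mapping.keys (of_nat n * f) = Poly_Mapping.keys f"
    using assms(1) by (auto simp: of_nat_eq_Const in_keys_iff lookup_Const_mult)
  then show ?thesis using assms(2) by (simp add: order_ge_def)
qed

text \<open>
  In characteristic zero a polynomial that vanishes on the slice gains one order of vanishing over
  its transversal derivatives.
\<close>

lemma order_ge_Suc:
  assumes "order_ge 1 f" "\<And>k. k \<in> killed \<Longrightarrow> order_ge N (pderiv_at k f)"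
  shows "order_ge (Suc N) f"
  unfolding order_ge_def
proof
  fix m assume m: "m \<in> Poly_Mapping.keys f"
  then have "killed_degree m \<noteq> 0" using assms(1) by (force simp: order_ge_def)
  then obtain k where k: "k \<in> killed" "Poly_Mapping.lookup m k \<noteq> 0"
    unfolding killed_degree_def by (meson sum.neutral)
  define m' where "m' = m - Poly_Mapping.single k 1"
  have m': "m = Poly_Mapping.single k 1 + m'"
    using k(2) single_1_add_minus[of m k] by (simp add: m'_def)
  then have "m' \<in> Poly_Mapping.keys (pderiv_at k f)"
    using m by (simp add: in_keys_iff lookup_pderiv_at del: of_nat_Suc)
  then have "N \<le> killed_degree m'"
    using assms(2)[OF k(1)] by (simp add: order_ge_def)
  then show "Suc N \<le> killed_degree m"
    using k(1) by (simp add: m' killed_degree_add killed_degree_single)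
qed

lemma order_ge_all_imp_0: "(\<And>N. order_ge N f) \<Longrightarrow> f = 0"
proof (rule ccontr)
  assume *: "\<And>N. order_ge N f" and "f \<noteq> 0"
  then obtain m where "m \<in> Poly_Mapping.keys f" by (metis ex_in_conv keys_eq_empty)
  then show False using *[of "Suc (killed_degree m)"] by (force simp: order_ge_def)
qed

lemma order_ge_diff_slice_hom: "order_ge 1 (f - slice_hom f)"
proof (induction f rule: mpoly_induct)
  case (Const c)
  show ?case by (simp add: slice_hom.h_Const)
next
  case (add p q)
  have "p + q - slice_hom (p + q) = (p - slice_hom p) + (q - slice_hom q)"
    by (simp add: slice_hom.h.hom_add)
  then show ?case using order_ge_add[OF add] by (simp only:)
next
  case (Var_mult v p)
  have "slice_hom (Var v * p) = (if v \<in> killed then 0 else Var v * slice_hom p)"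
    by (simp add: slice_hom_def subst_Var_mult)
  moreover have "Var v * p - Var v * slice_hom p = Var v * (p - slice_hom p)"
    by (simp add: right_diff_distrib)
  ultimately show ?case
    using Var_mult order_ge_mult[OF order_ge_Var order_ge_trivial, of v p] by (simp add: order_ge_mult_left)
qed

lemma order_ge_lie_Var:
  "expo a m = 0 \<or> raise b (lower a m) \<in> killed \<Longrightarrow> order_ge 1 (lie_Var a b m)"
  by (auto simp: lie_Var_def intro!: order_ge_uminus order_ge_mult_left order_ge_Var)

text \<open>
  One equation of the triangular system. In \<open>lie a b f = 0\<close> the derivatives along the slice have
  order \<open>N + 1\<close> like \<open>f\<close> itself, and a transversal derivative is harmless if its factor vanishes on the
  slice. If all other transversal derivatives are already known to have order \<open>N + 1\<close>, the one in
  direction \<open>k\<close> remains, with a factor that is a nonzero multiple of a coordinate of the slice.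
\<close>

lemma order_ge_pivot:
  assumes f: "order_ge (Suc N) f" "lie a b f = 0"
    and k: "k \<in> degree4" "expo a k \<noteq> 0" "raise b (lower a k) \<notin> killed"
    and other: "\<And>m. m \<in> killed \<Longrightarrow> m \<noteq> k \<Longrightarrow> expo a m \<noteq> 0 \<Longrightarrow>
      raise b (lower a m) \<notin> killed \<Longrightarrow> order_ge (Suc N) (pderiv_at m f)"
  shows "order_ge (Suc N) (pderiv_at k f)"
proof -
  have "lie a b f = lie_Var a b k * pderiv_at k f + (\<Sum>m\<in>degree4 - {k}. lie_Var a b m * pderiv_at m f)"
    unfolding lie_def using k(1) finite_degree4 by (rule sum.remove[rotated])
  then have eq: "of_nat (Suc (expo b k)) * (Var (raise b (lower a k)) * pderiv_at k f) =
      (\<Sum>m\<in>degree4 - {k}. lie_Var a b m * pderiv_at m f)"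
    using f(2) k(2) by (simp add: lie_Var_def mult.assoc del: of_nat_Suc)
  have "order_ge (Suc N) (lie_Var a b m * pderiv_at m f)" if m: "m \<in> degree4 - {k}" for m
  proof (cases "m \<in> killed")
    case True
    show ?thesis
    proof (cases "expo a m = 0 \<or> raise b (lower a m) \<in> killed")
      case True
      from order_ge_mult[OF order_ge_lie_Var[OF this] order_ge_pderiv_at_killed[OF f(1), of m]]
      show ?thesis by (simp add: plus_1_eq_Suc)
    next
      case False
      then show ?thesis using other[of m] m \<open>m \<in> killed\<close> by (intro order_ge_mult_left) simp
    qed
  next
    case False
    then show ?thesis using f(1) by (intro order_ge_mult_left order_ge_pderiv_at)
  qed
  then have "order_ge (Suc N) (of_nat (Suc (expo b k)) * (Var (raise b (lower a k)) * pderiv_at k f))"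
    unfolding eq by (rule order_ge_sum)
  then have "order_ge (Suc N) (Var (raise b (lower a k)) * pderiv_at k f)"
    by (rule order_ge_cancel_of_nat[rotated]) simp
  then show ?thesis
    by (rule order_ge_cancel_Var[OF k(3)])
qed

lemma eq_0_if_killed_by_lie:
  assumes lie: "\<And>a b. is_root a b \<Longrightarrow> lie a b f = 0" and "slice_hom f = 0"
  shows "f = 0"
proof -
  have start: "order_ge 1 f"
    using order_ge_diff_slice_hom[of f] assms(2) by simp
  have step: "order_ge (Suc (Suc N)) f" if f: "order_ge (Suc N) f" for N
  proof -
    have is_root: "is_root X Y" "is_root X Z" "is_root Y Z" "is_root Y X" "is_root Z X" "is_root Z Y"
      by (simp_all add: is_root_def)
    \<comment> \<open>Each derivative is solved for after those that occur in its equation.\<close>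
    have 121: "order_ge (Suc N) (pderiv_at (1, 2, 1) f)"
      by (rule order_ge_pivot[OF f lie[OF is_root(1)]]) (auto simp: killed_def degree4_def)
    have 202: "order_ge (Suc N) (pderiv_at (2, 0, 2) f)"
      by (rule order_ge_pivot[OF f lie[OF is_root(2)]]) (auto simp: killed_def degree4_def)
    have 112: "order_ge (Suc N) (pderiv_at (1, 1, 2) f)"
      by (rule order_ge_pivot[OF f lie[OF is_root(3)]]) (auto simp: killed_def degree4_def)
    have 013: "order_ge (Suc N) (pderiv_at (0, 1, 3) f)"
      by (rule order_ge_pivot[OF f lie[OF is_root(4)]]) (auto simp: killed_def degree4_def 121)
    have 004: "order_ge (Suc N) (pderiv_at (0, 0, 4) f)"
      by (rule order_ge_pivot[OF f lie[OF is_root(5)]]) (auto simp: killed_def degree4_def 112 121 202)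
    have 022: "order_ge (Suc N) (pderiv_at (0, 2, 2) f)"
      by (rule order_ge_pivot[OF f lie[OF is_root(6)]]) (auto simp: killed_def degree4_def 121 202)
    show ?thesis
    proof (rule order_ge_Suc[OF start])
      fix k assume "k \<in> killed"
      then show "order_ge (Suc N) (pderiv_at k f)"
        using 121 202 112 013 004 022 by (auto simp: killed_def)
    qed
  qed
  have "order_ge (Suc N) f" for N
    by (induction N) (simp_all add: start[unfolded One_nat_def] step)
  then have "order_ge N f" for N
    using order_ge_trivial by (cases N) simp_all
  then show ?thesis by (rule order_ge_all_imp_0)
qed

section \<open>The invariants on the slice\<close>

definition slice_exps :: "(nat \<times> nat \<times> nat) list" where
  "slice_exps = [(0, 3, 1), (0, 4, 0), (1, 0, 3), (1, 3, 0), (2, 1, 1), (2, 2, 0), (3, 0, 1), (3, 1, 0), (4, 0, 0)]"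

definition h_hessian :: "hpoly \<Rightarrow> hpoly list list" where
  "h_hessian p =
     [[h_deriv 0 (h_deriv 0 p), h_deriv 0 (h_deriv 1 p), h_deriv 0 (h_deriv 2 p)],
      [h_deriv 1 (h_deriv 0 p), h_deriv 1 (h_deriv 1 p), h_deriv 1 (h_deriv 2 p)],
      [h_deriv 2 (h_deriv 0 p), h_deriv 2 (h_deriv 1 p), h_deriv 2 (h_deriv 2 p)]]"

definition h_hess_0 :: "nat \<Rightarrow> nat \<Rightarrow> hpoly \<Rightarrow> hpoly" where
  "h_hess_0 i j p = h_at_0 6 (h_deriv i (h_deriv j p))"

definition h_gram_xyz :: "hpoly \<Rightarrow> hpoly list list" where
  "h_gram_xyz p =
     [[h_hess_0 0 0 p, h_hess_0 0 1 p, h_hess_0 0 2 p],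
      [h_hess_0 1 0 p, h_hess_0 1 1 p, h_hess_0 1 2 p],
      [h_hess_0 2 0 p, h_hess_0 2 1 p, h_hess_0 2 2 p]]"

definition h_gram_uvw :: "hpoly \<Rightarrow> hpoly list list" where
  "h_gram_uvw p =
     [[h_hess_0 3 3 p, h_hess_0 3 4 p, h_hess_0 3 5 p],
      [h_hess_0 4 3 p, h_hess_0 4 4 p, h_hess_0 4 5 p],
      [h_hess_0 5 3 p, h_hess_0 5 4 p, h_hess_0 5 5 p]]"

fun h_dot :: "hpoly list \<Rightarrow> hpoly list \<Rightarrow> hpoly" where
  "h_dot (p # ps) (q # qs) = h_add (h_mul p q) (h_dot ps qs)"
| "h_dot ps qs = Coef 0"

definition h_J11 :: "hpoly \<Rightarrow> hpoly \<Rightarrow> hpoly" where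
  "h_J11 p q = h_dot (concat (h_gram_xyz p)) (concat (h_gram_uvw q))"

fun h_t4_row :: "hpoly \<Rightarrow> (nat \<times> nat \<times> nat) list \<Rightarrow> hpoly list" where
  "h_t4_row j [] = []"
| "h_t4_row j (n # ns) = h_at_0 6 (h_D_uvw j (h_monom n)) # h_t4_row j ns"

text \<open>
  The monomials are taken in reverse order because the last rows of \<open>R4\<close> are the sparsest on the
  slice: expanding them first keeps the number of nonzero minors small.
\<close>

fun h_t4_rows :: "hpoly \<Rightarrow> (nat \<times> nat \<times> nat) list \<Rightarrow> hpoly list list" where
  "h_t4_rows q [] = []"
| "h_t4_rows q (m # ms) = h_t4_row (h_J4 q (h_monom m)) (rev quartic_exps) # h_t4_rows q ms"

text \<open>
  Eight times the right-hand side of the identity, arranged by powers of \<open>I3\<close> and \<open>I6\<close>. The arguments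
  stand for the invariants, those of degree nine with a factor 4 and \<open>J12\<close> likewise, \<open>I12\<close>, \<open>I15\<close> and \<open>J15\<close>
  with a factor 8; these factors arise from Gram matrices that are doubled to be integral.
\<close>

definition h_rhs :: "hpoly \<Rightarrow> hpoly \<Rightarrow> hpoly \<Rightarrow> hpoly \<Rightarrow> hpoly \<Rightarrow> hpoly \<Rightarrow> hpoly \<Rightarrow> hpoly \<Rightarrow> hpoly" where
  "h_rhs i3 i6 i9 i12 i15 j9 j12 j15 =
     h_add (h_add (h_smult 13230 j15) (h_smult (- 1890) i15))
     (h_add (h_mul i6 (h_add (h_smult 105840 j9) (h_smult (- 211680) i9)))
       (h_mul i3 (h_add (h_add (h_smult (- 9810) j12) (h_smult 9720 i12))
         (h_add (h_mul i6 (h_smult 12579840 i6))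
           (h_mul i3 (h_add (h_add (h_smult 4932 j9) (h_smult 1626 i9)) (h_mul i3 (h_smult (- 333760) i6))))))))"

text \<open>
  The predicates from here to \<open>check_quartic\<close> pass the covariants on to each other as
  arguments, so that rewriting computes each of them once. The factors account for the
  normalisation: \<open>d\<close> is the determinant of \<open>R4/48\<close>, and
  \<open>2 * 5^4 * 7 * 48^15 / (24^15 * \<kappa>) = 4375 / (8 * 629856)\<close>, with \<open>\<kappa>\<close> the value of \<open>kappa4\<close>.
\<close>

definition check_identity :: "hpoly \<Rightarrow> hpoly \<Rightarrow> hpoly \<Rightarrow> hpoly \<Rightarrow> hpoly \<Rightarrow> hpoly \<Rightarrow> hpoly \<Rightarrow> bool" where
  "check_identity rh ta xh et i3 i6 d \<longleftrightarrow>
     h_smult 4375 d = h_smult 629856 (h_rhs i3 i6 (h_J11 ta rh) (h_det (h_gram_uvw rh)) (h_det (h_gram_xyz ta))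
       (h_J11 xh rh) (h_J11 ta et) (h_det (h_gram_xyz xh)))"

definition check_I6 :: "hpoly \<Rightarrow> hpoly \<Rightarrow> hpoly \<Rightarrow> hpoly \<Rightarrow> hpoly \<Rightarrow> hpoly \<Rightarrow> hpoly \<Rightarrow> bool" where
  "check_I6 rh ta xh et i3 i6 d \<longleftrightarrow> h_dvd 4608 i6 \<and> check_identity rh ta xh et i3 (h_div 4608 i6) d"

definition check_I3 :: "hpoly \<Rightarrow> hpoly \<Rightarrow> hpoly \<Rightarrow> hpoly \<Rightarrow> hpoly \<Rightarrow> hpoly \<Rightarrow> hpoly \<Rightarrow> bool" where
  "check_I3 rh ta xh et i3 p d \<longleftrightarrow> check_I6 rh ta xh et i3 (h_minus p (h_smult 8 (h_mul i3 i3))) d"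

definition check_tau_eta :: "hpoly \<Rightarrow> hpoly \<Rightarrow> hpoly \<Rightarrow> hpoly \<Rightarrow> hpoly \<Rightarrow> hpoly \<Rightarrow> hpoly \<Rightarrow> bool" where
  "check_tau_eta rh xh ta et i3 p d \<longleftrightarrow> h_dvd 12 ta \<and> h_dvd 12 et \<and> h_dvd 72 i3 \<and>
     check_I3 rh (h_div 12 ta) xh (h_div 12 et) (h_div 72 i3) p d"

definition check_rho_xi_reduced :: "hpoly \<Rightarrow> hpoly \<Rightarrow> hpoly \<Rightarrow> hpoly \<Rightarrow> hpoly \<Rightarrow> hpoly \<Rightarrow> hpoly \<Rightarrow> bool" where
  "check_rho_xi_reduced q sg ps he d rh xh \<longleftrightarrow>
     check_tau_eta rh xh (h_D_uvw rh q) (h_D_xyz xh sg) (h_at_0 6 (h_D_uvw sg q)) (h_at_0 6 (h_D_uvw ps he)) d"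

definition check_rho_xi :: "hpoly \<Rightarrow> hpoly \<Rightarrow> hpoly \<Rightarrow> hpoly \<Rightarrow> hpoly \<Rightarrow> hpoly \<Rightarrow> hpoly \<Rightarrow> bool" where
  "check_rho_xi q sg ps he d rh xh \<longleftrightarrow> h_dvd 144 rh \<and> h_dvd 72 xh \<and>
     check_rho_xi_reduced q sg ps he d (h_div 144 rh) (h_div 72 xh)"

definition check_sigma_He_reduced :: "hpoly \<Rightarrow> hpoly \<Rightarrow> hpoly \<Rightarrow> hpoly \<Rightarrow> hpoly \<Rightarrow> bool" where
  "check_sigma_He_reduced q sg ps he d \<longleftrightarrow> check_rho_xi q sg ps he d (h_D_xyz q ps) (h_D_uvw sg he)"

definition check_sigma_He :: "hpoly \<Rightarrow> hpoly \<Rightarrow> hpoly \<Rightarrow> hpoly \<Rightarrow> hpoly \<Rightarrow> bool" where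
  "check_sigma_He q sg ps he d \<longleftrightarrow> h_dvd 48 sg \<and> h_dvd 1728 he \<and>
     check_sigma_He_reduced q (h_div 48 sg) ps (h_div 1728 he) d"

definition check_R4 :: "hpoly \<Rightarrow> hpoly list list \<Rightarrow> bool" where
  "check_R4 q M \<longleftrightarrow> list_all (list_all (h_dvd 48)) M \<and>
     check_sigma_He q (h_J4 q q) (h_psi q) (h_det (h_hessian q)) (h_det (map (map (h_div 48)) M))"

definition check_quartic :: "hpoly \<Rightarrow> bool" where
  "check_quartic q \<longleftrightarrow> psi_check (h_line q) \<and> check_R4 q (h_t4_rows q (rev quartic_exps))"

lemma check_slice: "check_quartic (h_quartic 6 slice_exps)"
  by code_simp

lemma Const_numeral: "Const (numeral n) = numeral n"
  by (simp add: Const_def)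

section \<open>Correctness of the computation on the slice\<close>

lemma rscale_heval:
  assumes "h_dvd n p" "n \<noteq> 0"
  shows "rscale (1 / of_int n) (heval p (gens ms)) = heval (h_div n p) (gens ms)"
proof -
  have "of_int n = (Const (Const (rat_of_int n)) :: form)"
    by (simp only: of_int_eq_Const[symmetric])
  then have "rscale (1 / of_int n) (heval p (gens ms)) =
      Const (Const (1 / of_int n)) * (Const (Const (rat_of_int n)) * heval (h_div n p) (gens ms))"
    unfolding rscale_def heval_div[OF assms(1), symmetric] by simp
  also have "\<dots> = Const (Const (1 / of_int n * rat_of_int n)) * heval (h_div n p) (gens ms)"
    by (simp only: Const_mult mult.assoc)
  also have "1 / of_int n * rat_of_int n = 1" using assms(2) by simp
  finally show ?thesis by simp
qed

lemma Const_mult_heval: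
  fixes g :: "nat \<Rightarrow> coef"
  assumes "h_dvd n p" "n \<noteq> 0"
  shows "Const (1 / of_int n) * heval p g = heval (h_div n p) g"
proof -
  have "of_int n = (Const (rat_of_int n) :: coef)"
    by (simp only: of_int_eq_Const[symmetric])
  then have "Const (1 / of_int n) * heval p g =
      Const (1 / of_int n) * (Const (rat_of_int n) * heval (h_div n p) g)"
    unfolding heval_div[OF assms(1), symmetric] by simp
  also have "\<dots> = Const (1 / of_int n * rat_of_int n) * heval (h_div n p) g"
    by (simp only: Const_mult mult.assoc)
  also have "1 / of_int n * rat_of_int n = 1" using assms(2) by simp
  finally show ?thesis by simp
qed

lemma He_heval:
  "He (heval p (gens ms)) = rscale (1 / 1728) (heval (h_det (h_hessian p)) (gens ms))"
proof -
  have "mat 3 3 (\<lambda>(r, s). pderiv_at ([X, Y, Z] ! r) (pderiv_at ([X, Y, Z] ! s) (heval p (gens ms)))) =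
      mat 3 3 (\<lambda>(i, j). heval (h_hessian p ! i ! j) (gens ms))"
    by (rule eq_matI) (auto simp: less_3 h_hessian_def pderiv_heval)
  moreover have "heval (h_det (h_hessian p)) (gens ms) = det (mat 3 3 (\<lambda>(i, j). heval (h_hessian p ! i ! j) (gens ms)))"
    by (rule heval_det) (auto simp: h_hessian_def)
  ultimately show ?thesis by (simp add: He_def)
qed

lemma hess_0_heval:
  "hess_0 X X (heval p (gens ms)) = heval (h_hess_0 0 0 p) (coef_gens ms)"
  "hess_0 X Y (heval p (gens ms)) = heval (h_hess_0 0 1 p) (coef_gens ms)"
  "hess_0 X Z (heval p (gens ms)) = heval (h_hess_0 0 2 p) (coef_gens ms)"
  "hess_0 Y X (heval p (gens ms)) = heval (h_hess_0 1 0 p) (coef_gens ms)"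
  "hess_0 Y Y (heval p (gens ms)) = heval (h_hess_0 1 1 p) (coef_gens ms)"
  "hess_0 Y Z (heval p (gens ms)) = heval (h_hess_0 1 2 p) (coef_gens ms)"
  "hess_0 Z X (heval p (gens ms)) = heval (h_hess_0 2 0 p) (coef_gens ms)"
  "hess_0 Z Y (heval p (gens ms)) = heval (h_hess_0 2 1 p) (coef_gens ms)"
  "hess_0 Z Z (heval p (gens ms)) = heval (h_hess_0 2 2 p) (coef_gens ms)"
  "hess_0 U U (heval p (gens ms)) = heval (h_hess_0 3 3 p) (coef_gens ms)"
  "hess_0 U V (heval p (gens ms)) = heval (h_hess_0 3 4 p) (coef_gens ms)"
  "hess_0 U W (heval p (gens ms)) = heval (h_hess_0 3 5 p) (coef_gens ms)"
  "hess_0 V U (heval p (gens ms)) = heval (h_hess_0 4 3 p) (coef_gens ms)"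
  "hess_0 V V (heval p (gens ms)) = heval (h_hess_0 4 4 p) (coef_gens ms)"
  "hess_0 V W (heval p (gens ms)) = heval (h_hess_0 4 5 p) (coef_gens ms)"
  "hess_0 W U (heval p (gens ms)) = heval (h_hess_0 5 3 p) (coef_gens ms)"
  "hess_0 W V (heval p (gens ms)) = heval (h_hess_0 5 4 p) (coef_gens ms)"
  "hess_0 W W (heval p (gens ms)) = heval (h_hess_0 5 5 p) (coef_gens ms)"
  by (simp_all add: hess_0_def h_hess_0_def pderiv_heval const_term_heval)

lemma gram_heval:
  assumes "i < 3" "j < 3"
  shows "gram [X, Y, Z] (heval p (gens ms)) $$ (i, j) = Const (1 / 2) * heval (h_gram_xyz p ! i ! j) (coef_gens ms)"
    "gram [U, V, W] (heval p (gens ms)) $$ (i, j) = Const (1 / 2) * heval (h_gram_uvw p ! i ! j) (coef_gens ms)"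
  using assms by (auto simp: gram_eq less_3 h_gram_xyz_def h_gram_uvw_def hess_0_heval)

lemma Const_power: "Const c ^ n = Const (c ^ n :: 'r::comm_ring_1)"
  by (induction n) (simp_all add: Const_mult)

lemma det_Const_smult:
  assumes "A = mat n n (\<lambda>ij. Const c * f ij)"
  shows "det A = Const (c ^ n) * det (mat n n f)"
proof -
  have "A = Const c \<cdot>\<^sub>m mat n n f" unfolding assms by (rule eq_matI) auto
  then show ?thesis by (simp add: det_smult Const_power)
qed

lemma J30_heval: "J30 (heval p (gens ms)) = Const (1 / 8) * heval (h_det (h_gram_xyz p)) (coef_gens ms)"
proof -
  have gram: "gram [X, Y, Z] (heval p (gens ms)) = mat 3 3 (\<lambda>ij. Const (1 / 2) * (case ij of (i, j) \<Rightarrow> heval (h_gram_xyz p ! i ! j) (coef_gens ms)))"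
    by (rule eq_matI) (simp_all add: gram_heval, simp_all add: gram_def)
  have "heval (h_det (h_gram_xyz p)) (coef_gens ms) =
      det (mat 3 3 (\<lambda>(i, j). heval (h_gram_xyz p ! i ! j) (coef_gens ms)))"
    by (rule heval_det) (auto simp: h_gram_xyz_def)
  then show ?thesis
    unfolding J30_def det_Const_smult[OF gram] by (simp add: power3_eq_cube)
qed

lemma J03_heval: "J03 (heval p (gens ms)) = Const (1 / 8) * heval (h_det (h_gram_uvw p)) (coef_gens ms)"
proof -
  have gram: "gram [U, V, W] (heval p (gens ms)) = mat 3 3 (\<lambda>ij. Const (1 / 2) * (case ij of (i, j) \<Rightarrow> heval (h_gram_uvw p ! i ! j) (coef_gens ms)))"
    by (rule eq_matI) (simp_all add: gram_heval, simp_all add: gram_def)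
  have "heval (h_det (h_gram_uvw p)) (coef_gens ms) =
      det (mat 3 3 (\<lambda>(i, j). heval (h_gram_uvw p ! i ! j) (coef_gens ms)))"
    by (rule heval_det) (auto simp: h_gram_uvw_def)
  then show ?thesis
    unfolding J03_def det_Const_smult[OF gram] by (simp add: power3_eq_cube)
qed

lemma J11_heval: "J11 (heval p (gens ms)) (heval q (gens ms)) = Const (1 / 4) * heval (h_J11 p q) (coef_gens ms)"
proof -
  let ?a = "\<lambda>i j. heval (h_gram_xyz p ! i ! j) (coef_gens ms)" and ?b = "\<lambda>i j. heval (h_gram_uvw q ! i ! j) (coef_gens ms)"
  have half: "Const (1 / 2) * x * (Const (1 / 2) * y) = Const (1 / 4) * (x * y)" for x y :: coef
  proof -
    have "Const (1 / 2) * x * (Const (1 / 2) * y) = (Const (1 / 2) * Const (1 / 2)) * (x * y)"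
      by (simp only: mult_ac)
    then show ?thesis by (simp flip: Const_mult)
  qed
  have sym: "gram [U, V, W] B $$ (s, r) = gram [U, V, W] B $$ (r, s)" if "r < 3" "s < 3" for B r s
    using that by (auto simp: gram_def add.commute)
  have "J11 (heval p (gens ms)) (heval q (gens ms)) = (\<Sum>r<3. \<Sum>s<3. Const (1 / 4) * (?a r s * ?b r s))"
    unfolding J11_eq
  proof (intro sum.cong refl)
    fix r s :: nat assume "r \<in> {..<3}" "s \<in> {..<3}"
    then show "gram [X, Y, Z] (heval p (gens ms)) $$ (r, s) * gram [U, V, W] (heval q (gens ms)) $$ (s, r) =
        Const (1 / 4) * (?a r s * ?b r s)"
      using sym[of r s] by (simp add: gram_heval half)
  qed
  also have "\<dots> = Const (1 / 4) * (\<Sum>r<3. \<Sum>s<3. ?a r s * ?b r s)"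
    by (simp only: sum_distrib_left)
  also have "(\<Sum>r<3. \<Sum>s<3. ?a r s * ?b r s) = heval (h_J11 p q) (coef_gens ms)"
    by (simp add: h_J11_def h_gram_xyz_def h_gram_uvw_def lessThan_3 add_ac)
  finally show ?thesis .
qed

lemma h_t4_row_eq: "h_t4_row j ns = map (\<lambda>n. h_at_0 6 (h_D_uvw j (h_monom n))) ns"
  by (induction j ns rule: h_t4_row.induct) simp_all

lemma h_t4_rows_eq: "h_t4_rows q ms = map (\<lambda>m. h_t4_row (h_J4 q (h_monom m)) (rev quartic_exps)) ms"
  by (induction q ms rule: h_t4_rows.induct) simp_all

lemma t4_heval:
  "t4 (heval q (gens ms)) (xyz_monom m) (xyz_monom n) =
     heval (h_at_0 6 (h_D_uvw (h_J4 q (h_monom m)) (h_monom n))) (coef_gens ms)"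
  by (simp only: t4_def heval_monom[of _ ms, symmetric] heval_J4 heval_D_uvw const_term_heval)

text \<open>
  The sign of the permutation enters twice.
\<close>

lemma det_simultaneous_permutation:
  fixes A :: "'a::comm_ring_1 mat"
  assumes A: "A \<in> carrier_mat n n" and p: "p permutes {0..<n}"
  shows "det (mat n n (\<lambda>(i, j). A $$ (p i, p j))) = det A"
proof -
  have p_less: "p i < n" if "i < n" for i
    using permutes_in_image[OF p, of i] that by simp
  define B where "B = mat n n (\<lambda>(i, j). A $$ (p i, j))"
  have B: "B \<in> carrier_mat n n" by (simp add: B_def)
  have "mat n n (\<lambda>(i, j). A $$ (p i, p j)) = transpose_mat (mat n n (\<lambda>(i, j). transpose_mat B $$ (p i, j)))"
    using p_less by (intro eq_matI) (simp_all add: B_def)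
  then have "det (mat n n (\<lambda>(i, j). A $$ (p i, p j))) = det (mat n n (\<lambda>(i, j). transpose_mat B $$ (p i, j)))"
    by (simp add: det_transpose[of _ n])
  also have "\<dots> = signof p * det (transpose_mat B)"
    by (rule det_permute_rows[OF _ p]) (simp add: B)
  also have "\<dots> = signof p * (signof p * det A)"
    unfolding det_transpose[OF B] using det_permute_rows[OF A p] by (simp add: B_def)
  also have "\<dots> = det A"
    by (simp add: sign_def)
  finally show ?thesis .
qed

lemma det_R4_heval:
  assumes "list_all (list_all (h_dvd 48)) (h_t4_rows q (rev quartic_exps))"
  shows "det (R4 (heval q (gens ms))) =
    Const (48 ^ 15) * heval (h_det (map (map (h_div 48)) (h_t4_rows q (rev quartic_exps)))) (coef_gens ms)"
proof -
  let ?M = "map (map (h_div 48)) (h_t4_rows q (rev quartic_exps))"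
  let ?p = "\<lambda>i. if i < 15 then 14 - i else i :: nat"
  have p: "?p permutes {0..<15}"
    by (rule inj_imp_permutes) (auto simp: inj_on_def)
  have R4: "mat 15 15 (\<lambda>(i, j). R4 (heval q (gens ms)) $$ (?p i, ?p j)) =
      mat 15 15 (\<lambda>ij. Const 48 * (case ij of (i, j) \<Rightarrow> heval (?M ! i ! j) (coef_gens ms)))" (is "?A = ?B")
  proof (rule eq_matI)
    fix i j assume "i < dim_row ?B" "j < dim_col ?B"
    then have ij: "i < 15" "j < 15" by simp_all
    let ?e = "h_at_0 6 (h_D_uvw (h_J4 q (h_monom (quartic_exps ! (14 - i)))) (h_monom (quartic_exps ! (14 - j))))"
    have entry: "h_t4_rows q (rev quartic_exps) ! i ! j = ?e" and M: "?M ! i ! j = h_div 48 ?e"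
      using ij by (simp_all add: h_t4_rows_eq h_t4_row_eq length_quartic_exps rev_nth)
    have "h_dvd 48 ?e"
      using assms ij unfolding entry[symmetric] list_all_length
      by (simp add: h_t4_rows_eq h_t4_row_eq length_quartic_exps)
    then have "heval ?e (coef_gens ms) = Const 48 * heval (h_div 48 ?e) (coef_gens ms)"
      by (simp add: heval_div[symmetric] Const_numeral)
    then show "?A $$ (i, j) = ?B $$ (i, j)"
      using ij by (simp add: R4_def t4_heval M del: nth_map)
  qed simp_all
  have "heval (h_det ?M) (coef_gens ms) = det (mat 15 15 (\<lambda>(i, j). heval (?M ! i ! j) (coef_gens ms)))"
    by (rule heval_det) (auto simp: h_t4_rows_eq h_t4_row_eq length_quartic_exps)
  moreover have "det (R4 (heval q (gens ms))) = det ?A"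
    by (rule det_simultaneous_permutation[OF _ p, symmetric]) (simp add: R4_def)
  ultimately show ?thesis
    by (simp only: det_Const_smult[OF R4])
qed

lemma kappa4_eq: "kappa4 = 2 ^ 24 * 3 ^ 9"
proof -
  have "kappa4 = (\<Prod>(i, j, k)\<in>set quartic_exps. fact i * fact j * fact k)"
    unfolding kappa4_def set_quartic_exps degree4_def ..
  also have "\<dots> = prod_list (map (\<lambda>(i, j, k). fact i * fact j * fact k) quartic_exps)"
    by (rule prod.distinct_set_conv_list[OF distinct_quartic_exps])
  also have "\<dots> = 2 ^ 24 * 3 ^ 9"
    by (simp add: quartic_exps_eq fact_numeral)
  finally show ?thesis .
qed

definition dixmier_ohno_rhs :: "form \<Rightarrow> coef" where
  "dixmier_ohno_rhs q = 2 * 3 ^ 3 * 5 * 7 ^ 2 * J15 q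
    - 2 * 3 ^ 3 * 5 * 7 * I15 q
    - 3 ^ 2 * 5 * 109 * I3 q * J12 q
    + 2 ^ 3 * 3 ^ 5 * 5 * I3 q * I12 q
    + 2 * 3 ^ 2 * 137 * I3 q ^ 2 * J9 q
    + 3 * 271 * I3 q ^ 2 * I9 q
    + 2 ^ 3 * 3 ^ 3 * 5 * 7 ^ 2 * I6 q * J9 q
    - 2 ^ 4 * 3 ^ 3 * 5 * 7 ^ 2 * I6 q * I9 q
    - 2 ^ 3 * 5 * 7 * 149 * I3 q ^ 3 * I6 q
    + 2 ^ 7 * 3 ^ 3 * 5 * 7 * 13 * I3 q * I6 q ^ 2"

lemma dixmier_ohno_rhs_scaled:
  fixes i3 i6 :: coef
  assumes "I3 q = i3" "I6 q = i6" "I9 q = Const (1 / 4) * i9" "I12 q = Const (1 / 8) * i12"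
    "I15 q = Const (1 / 8) * i15" "J9 q = Const (1 / 4) * j9" "J12 q = Const (1 / 4) * j12" "J15 q = Const (1 / 8) * j15"
  shows "8 * dixmier_ohno_rhs q = 13230 * j15 - 1890 * i15 + (i6 * (105840 * j9 - 211680 * i9) +
     i3 * (- 9810 * j12 + 9720 * i12 + (i6 * (12579840 * i6) +
       i3 * (4932 * j9 + 1626 * i9 + i3 * (- 333760 * i6)))))"
proof -
  have cancel: "x = Const (1 / numeral n) * y \<Longrightarrow> numeral n * x = y" for x y :: coef and n
  proof -
    assume "x = Const (1 / numeral n) * y"
    then have "numeral n * x = Const (numeral n * (1 / numeral n)) * y"
      by (simp only: Const_mult Const_numeral mult.assoc)
    then show "numeral n * x = y" by simp
  qed
  have eqs: "4 * I9 q = i9" "8 * I12 q = i12" "8 * I15 q = i15" "4 * J9 q = j9" "4 * J12 q = j12" "8 * J15 q = j15"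
    using assms by (auto intro: cancel)
  show ?thesis
    unfolding dixmier_ohno_rhs_def assms(1,2) eqs[symmetric]
    by (simp add: algebra_simps power2_eq_square power3_eq_cube)
qed

text \<open>
  The covariants of a quartic are the values of the Horner polynomials that \<open>check_quartic\<close> passes
  on; what is left is to compare the rational factors.
\<close>

lemma slice_identity:
  fixes p :: hpoly and ms :: "(nat \<times> nat \<times> nat) list"
  assumes "check_quartic p"
  defines "q \<equiv> heval p (gens ms)"
  shows "Const (2 * 5 ^ 4 * 7 / 24 ^ 15) * rho4 q = dixmier_ohno_rhs q"
proof -
  define sg ps he where "sg = h_div 48 (h_J4 p p)" "ps = h_psi p" "he = h_div 1728 (h_det (h_hessian p))"
  define rh xi' where "rh = h_div 144 (h_D_xyz p ps)" "xi' = h_div 72 (h_D_uvw sg he)"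
  define ta et where "ta = h_div 12 (h_D_uvw rh p)" "et = h_div 12 (h_D_xyz xi' sg)"
  define i3 where "i3 = h_div 72 (h_at_0 6 (h_D_uvw sg p))"
  define i6' where "i6' = h_minus (h_at_0 6 (h_D_uvw ps he)) (h_smult 8 (h_mul i3 i3))"
  define i6 where "i6 = h_div 4608 i6'"
  define d where "d = h_det (map (map (h_div 48)) (h_t4_rows p (rev quartic_exps)))"
  note defs = sg_ps_he_def rh_xi'_def ta_et_def i3_def i6'_def i6_def d_def
  have check: "psi_check (h_line p)" "list_all (list_all (h_dvd 48)) (h_t4_rows p (rev quartic_exps))"
    "h_dvd 48 (h_J4 p p)" "h_dvd 1728 (h_det (h_hessian p))" "h_dvd 144 (h_D_xyz p ps)" "h_dvd 72 (h_D_uvw sg he)"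
    "h_dvd 12 (h_D_uvw rh p)" "h_dvd 12 (h_D_xyz xi' sg)" "h_dvd 72 (h_at_0 6 (h_D_uvw sg p))" "h_dvd 4608 i6'"
    "check_identity rh ta xi' et i3 i6 d"
    using assms(1) unfolding check_quartic_def check_R4_def check_sigma_He_def check_sigma_He_reduced_def
      check_rho_xi_def check_rho_xi_reduced_def check_tau_eta_def check_I3_def check_I6_def
      sg_ps_he_def(1)[symmetric] sg_ps_he_def(2)[symmetric] sg_ps_he_def(3)[symmetric]
      rh_xi'_def[symmetric] ta_et_def[symmetric] i3_def[symmetric] i6'_def[symmetric] i6_def[symmetric] d_def[symmetric]
    by blast+
  note scale = rscale_heval[of 48, simplified] rscale_heval[of 1728, simplified] rscale_heval[of 144, simplified]
    rscale_heval[of 72, simplified] rscale_heval[of 12, simplified]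
  have sigma: "sigma q = heval sg (gens ms)"
    by (simp add: sigma_def q_def heval_J4 scale check sg_ps_he_def)
  have psi: "psi q = heval ps (gens ms)"
    unfolding q_def sg_ps_he_def by (rule psi_eq) (rule is_psi_heval[OF check(1)])
  have He: "He q = heval he (gens ms)"
    by (simp add: q_def He_heval scale check sg_ps_he_def)
  have rho: "rho q = heval rh (gens ms)"
    unfolding rho_def psi by (simp add: q_def heval_D_xyz scale check rh_xi'_def)
  have xi: "xi q = heval xi' (gens ms)"
    unfolding xi_def sigma He by (simp add: heval_D_uvw scale check rh_xi'_def)
  have tau: "tau q = heval ta (gens ms)"
    unfolding tau_def rho by (simp add: q_def heval_D_uvw scale check ta_et_def)
  have eta: "eta q = heval et (gens ms)"
    unfolding eta_def xi sigma by (simp add: heval_D_xyz scale check ta_et_def)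
  have I3: "I3 q = heval i3 (coef_gens ms)"
    unfolding I3_def sigma
    using Const_mult_heval[OF check(9)] by (simp add: q_def heval_D_uvw const_term_heval i3_def)
  have "const_term (D_uvw (psi q) (He q)) - 8 * I3 q ^ 2 = heval i6' (coef_gens ms)"
    unfolding psi He I3 by (simp add: heval_D_uvw const_term_heval i6'_def power2_eq_square)
  then have I6: "I6 q = heval i6 (coef_gens ms)"
    unfolding I6_def using Const_mult_heval[OF check(10)] by (simp add: i6_def)
  have "8 * dixmier_ohno_rhs q = heval (h_rhs i3 i6 (h_J11 ta rh) (h_det (h_gram_uvw rh)) (h_det (h_gram_xyz ta))
       (h_J11 xi' rh) (h_J11 ta et) (h_det (h_gram_xyz xi'))) (coef_gens ms)"
    by (subst dixmier_ohno_rhs_scaled[OF I3 I6])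
      (rule I9_def[of q, unfolded tau rho J11_heval] I12_def[of q, unfolded rho J03_heval]
        I15_def[of q, unfolded tau J30_heval] J9_def[of q, unfolded xi rho J11_heval]
        J12_def[of q, unfolded tau eta J11_heval] J15_def[of q, unfolded xi J30_heval]
       | simp add: h_rhs_def)+
  then have id: "4375 * heval d (coef_gens ms) = 629856 * (8 * dixmier_ohno_rhs q)"
    using check(11) unfolding check_identity_def
    by (metis heval_smult of_int_numeral)
  have "rho4 q = Const (1 / of_nat kappa4) * (Const (48 ^ 15) * heval d (coef_gens ms))"
    unfolding rho4_def q_def det_R4_heval[OF check(2)] d_def ..
  then have "Const (2 * 5 ^ 4 * 7 / 24 ^ 15) * rho4 q =
      Const (2 * 5 ^ 4 * 7 / 24 ^ 15 * (1 / of_nat kappa4) * 48 ^ 15) * heval d (coef_gens ms)"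
    by (simp only: Const_mult mult.assoc)
  \<comment> \<open>Here \<open>5038848\<close> is \<open>8 * 629856\<close>.\<close>
  also have "2 * 5 ^ 4 * 7 / 24 ^ 15 * (1 / of_nat kappa4) * 48 ^ 15 = (1 / 5038848 * 4375 :: rat)"
    by (simp add: kappa4_eq)
  also have "Const (1 / 5038848 * 4375) * heval d (coef_gens ms) = Const (1 / 5038848) * (629856 * (8 * dixmier_ohno_rhs q))"
    unfolding id[symmetric] Const_mult Const_numeral mult.assoc ..
  also have "\<dots> = Const (1 / 5038848 * (629856 * 8)) * dixmier_ohno_rhs q"
    by (simp only: Const_mult Const_numeral mult.assoc)
  also have "1 / 5038848 * (629856 * 8) = (1 :: rat)" by simp
  finally show ?thesis by simp
qed

section \<open>The identity\<close>

lemma set_slice_exps: "set slice_exps = degree4 - killed"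
  unfolding set_quartic_exps[symmetric] by (auto simp: slice_exps_def quartic_exps_eq killed_def)

lemma slice_hom_universal_quartic:
  "coeff_map slice_hom universal_quartic = heval (h_quartic 6 slice_exps) (gens slice_exps)"
proof -
  have Var: "slice_hom (Var m) = (if m \<in> killed then 0 else Var m)" for m
    by (simp add: slice_hom_def)
  have "coeff_map slice_hom universal_quartic = (\<Sum>m\<in>degree4. Const (slice_hom (Var m)) * xyz_monom m)"
    unfolding universal_quartic_eq
    by (simp add: slice_hom.H.hom_sum slice_hom.H.hom_mult slice_hom.coeff_map_Const slice_hom.H_xyz_monom)
  also have "\<dots> = (\<Sum>m\<in>set slice_exps. Const (Var m) * xyz_monom m)"
    unfolding set_slice_exps by (rule sum.mono_neutral_cong_right) (auto simp: Var finite_degree4)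
  also have "\<dots> = (\<Sum>m\<leftarrow>slice_exps. Const (Var m) * xyz_monom m)"
    by (rule sum_list_distinct_conv_sum_set[symmetric]) (simp add: slice_exps_def)
  also have "\<dots> = heval (h_quartic 6 slice_exps) (gens slice_exps)"
    using multinom_nonzero set_slice_exps by (intro heval_quartic[symmetric]) (auto simp: set_quartic_exps)
  finally show ?thesis .
qed

theorem theorem3p1:
  fixes q :: form
  defines "q \<equiv> universal_quartic"
  shows "Const (2 * 5 ^ 4 * 7 / 24 ^ 15) * rho4 q =
      2 * 3 ^ 3 * 5 * 7 ^ 2 * J15 q
    - 2 * 3 ^ 3 * 5 * 7 * I15 q
    - 3 ^ 2 * 5 * 109 * I3 q * J12 q
    + 2 ^ 3 * 3 ^ 5 * 5 * I3 q * I12 q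
    + 2 * 3 ^ 2 * 137 * I3 q ^ 2 * J9 q
    + 3 * 271 * I3 q ^ 2 * I9 q
    + 2 ^ 3 * 3 ^ 3 * 5 * 7 ^ 2 * I6 q * J9 q
    - 2 ^ 4 * 3 ^ 3 * 5 * 7 ^ 2 * I6 q * I9 q
    - 2 ^ 3 * 5 * 7 * 149 * I3 q ^ 3 * I6 q
    + 2 ^ 7 * 3 ^ 3 * 5 * 7 * 13 * I3 q * I6 q ^ 2"
proof -
  define f where "f = Const (2 * 5 ^ 4 * 7 / 24 ^ 15) * rho4 q - dixmier_ohno_rhs q"
  have "lie a b f = 0" if ab: "is_root a b" for a b
  proof -
    note D = derivation_lie[of a b]
    have zero: "lie a b (I3 q) = 0" "lie a b (I6 q) = 0" "lie a b (I9 q) = 0" "lie a b (I12 q) = 0"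
      "lie a b (I15 q) = 0" "lie a b (J9 q) = 0" "lie a b (J12 q) = 0" "lie a b (J15 q) = 0" "lie a b (rho4 q) = 0"
      unfolding q_def I9_def I12_def I15_def J9_def J12_def J15_def
      by (intro lie_I3 lie_I6 lie_rho4 lie_J11 lie_J03 lie_J30 theta_tau theta_rho theta_xi theta_eta ab)+
    show ?thesis
      unfolding f_def dixmier_ohno_rhs_def
      by (simp add: derivation_diff[OF D] derivation_add[OF D] derivation_mult[OF D] derivation_numeral[OF D]
          derivation_zero_power[OF D] zero)
  qed
  moreover have "slice_hom f = 0"
  proof -
    have slice: "coeff_map slice_hom q = heval (h_quartic 6 slice_exps) (gens slice_exps)"
      unfolding q_def by (rule slice_hom_universal_quartic)
    have psi: "is_psi q (psi q)" unfolding q_def by (rule psi_universal_quartic)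
    have "dixmier_ohno_rhs (coeff_map slice_hom q) = slice_hom (dixmier_ohno_rhs q)"
      unfolding dixmier_ohno_rhs_def slice_hom.invariants_H[OF psi] slice_hom.I3_H[OF psi] slice_hom.I6_H[OF psi]
      by (simp only: slice_hom.h.hom_add slice_hom.h.hom_minus slice_hom.h.hom_mult slice_hom.h.hom_power slice_hom.h.hom_numeral)
    moreover have "Const (2 * 5 ^ 4 * 7 / 24 ^ 15) * rho4 (coeff_map slice_hom q) = slice_hom (Const (2 * 5 ^ 4 * 7 / 24 ^ 15) * rho4 q)"
      by (simp only: slice_hom.rho4_H slice_hom.h.hom_mult slice_hom.h_Const)
    ultimately show ?thesis
      using slice_identity[OF check_slice, of slice_exps]
      unfolding f_def slice_hom.h.hom_minus slice[symmetric] by simp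
  qed
  ultimately have "f = 0" by (rule eq_0_if_killed_by_lie)
  then show ?thesis unfolding f_def dixmier_ohno_rhs_def by simp
qed

end
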